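(* Let $\mathcal{G}$ be a metric graph in the class $\mathbf{G}$ which is noncompact, has finitely many edges, and contains at least one pendant or at least one signpost. Then for every $p>6$ there exists $\mu_{p,\mathcal{G}}>0$, depending on $p$ and $\mathcal{G}$, such that for every $\mu\in(0,\mu_{p,\mathcal{G}}]$ problem \[ \begin{cases} u''+u^{p-1}=\lambda u & \text{on every edge of }\mathcal{G},\\ u\in H^1(\mathcal{G}),\ u>0 & \text{on }\mathcal{G},\\ \sum_{e\succ \mathrm{v}}\frac{du}{dx_e}(\mathrm{v})=0 & \text{for every vertex }\mathrm{v}, \end{cases} \] admits a solution $(u,\lambda)$ with $u\in H^1_\mu(\mathcal{G})$, $E(u,\mathcal{G})>0$ and $\lambda>0$.
   Context: A metric graph $\mathcal{G}=(\mathbb{V},\mathbb{E})$ belongs to the class $\mathbf{G}$ if it is connected, has at most countably many edges, every vertex has finite degree (number of incident edges), and $e_0:=\inf_{e\in\mathbb{E}}|e|>0$, where $|e|$ is the length of $e$ (edges may be bounded intervals or half-lines). $\mathcal{G}$ is noncompact if it has at least one half-line or infinitely many edges. $H^1(\mathcal{G})$ is the space of continuous functions on $\mathcal{G}$ whose restriction to each edge is in $H^1$ of that edge, with $\int_{\mathcal G}(|u'|^2+|u|^2)<\infty$. $H^1_\mu(\mathcal{G})=\{v\in H^1(\mathcal{G}):\|v\|_{L^2(\mathcal{G})}^2=\mu\}$. $E(u,\mathcal{G})=\frac12\|u'\|_{L^2(\mathcal G)}^2-\frac1p\|u\|_{L^p(\mathcal G)}^p$. In the vertex condition, $e\succ\mathrm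 v$ means the edge $e$ is incident at $\mathrm v$ and $\frac{du}{dx_e}(\mathrm v)$ is the derivative of $u$ at $\mathrm v$ along $e$ parametrized so that $\mathrm v$ corresponds to $0$ (Kirchhoff condition). A pendant is a bounded edge one of whose vertices has degree $1$. A signpost is the union of a bounded edge and a loop glued together at a common vertex. *)

theory Defs
  imports "HOL-Analysis.Analysis"
begin

text \<open>
  A metric graph is encoded by:
  - E :: 'e set  -- the edges;
  - H \<subseteq> E     -- the edges that are half-lines (all other edges are bounded);
  - L :: 'e \<Rightarrow> real -- the length of each bounded edge (ignored for half-lines);
  - src, tgt :: 'e \<Rightarrow> 'v -- the endpoints of an edge.  A bounded edge e is identified with
    the interval [0, L e], the point 0 being the vertex src e and L e the vertex tgt e
    (loops: src e = tgt e).  A half-line e is identified with [0,\<infinity>), the point 0 being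
    the vertex src e (tgt is irrelevant for half-lines).
\<close>

definition edom :: "'e set \<Rightarrow> ('e \<Rightarrow> real) \<Rightarrow> 'e \<Rightarrow> real set" where
  "edom H L e = (if e \<in> H then {0..} else {0..L e})"

definition vertices :: "'e set \<Rightarrow> 'e set \<Rightarrow> ('e \<Rightarrow> 'v) \<Rightarrow> ('e \<Rightarrow> 'v) \<Rightarrow> 'v set" where
  "vertices E H src tgt = src ` E \<union> tgt ` (E - H)"

definition degree :: "'e set \<Rightarrow> 'e set \<Rightarrow> ('e \<Rightarrow> 'v) \<Rightarrow> ('e \<Rightarrow> 'v) \<Rightarrow> 'v \<Rightarrow> nat" where
  "degree E H src tgt v = card {e \<in> E. src e = v} + card {e \<in> E - H. tgt e = v}"

definition adjacent :: "'e set \<Rightarrow> 'e set \<Rightarrow> ('e \<Rightarrow> 'v) \<Rightarrow> ('e \<Rightarrow> 'v) \<Rightarrow> 'v \<Rightarrow> 'v \<Rightarrow> bool" where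
  "adjacent E H src tgt a b = (\<exists>e \<in> E - H. {a, b} = {src e, tgt e})"

definition class_G ::
  "'e set \<Rightarrow> 'e set \<Rightarrow> ('e \<Rightarrow> real) \<Rightarrow> ('e \<Rightarrow> 'v) \<Rightarrow> ('e \<Rightarrow> 'v) \<Rightarrow> bool" where
  "class_G E H L src tgt \<longleftrightarrow>
     H \<subseteq> E \<and> countable E \<and>
     (\<forall>v \<in> vertices E H src tgt. \<forall>w \<in> vertices E H src tgt. (adjacent E H src tgt)\<^sup>*\<^sup>* v w) \<and>
     (\<forall>v. finite {e \<in> E. src e = v} \<and> finite {e \<in> E - H. tgt e = v}) \<and>
     (\<exists>\<delta>>0. \<forall>e \<in> E - H. \<delta> \<le> L e)"

definition noncompact_graph :: "'e set \<Rightarrow> 'e set \<Rightarrow> bool" where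
  "noncompact_graph E H \<longleftrightarrow> H \<noteq> {} \<or> infinite E"

definition has_pendant ::
  "'e set \<Rightarrow> 'e set \<Rightarrow> ('e \<Rightarrow> 'v) \<Rightarrow> ('e \<Rightarrow> 'v) \<Rightarrow> bool" where
  "has_pendant E H src tgt \<longleftrightarrow>
     (\<exists>e \<in> E - H. degree E H src tgt (src e) = 1 \<or> degree E H src tgt (tgt e) = 1)"

definition has_signpost ::
  "'e set \<Rightarrow> 'e set \<Rightarrow> ('e \<Rightarrow> 'v) \<Rightarrow> ('e \<Rightarrow> 'v) \<Rightarrow> bool" where
  "has_signpost E H src tgt \<longleftrightarrow>
     (\<exists>e \<in> E - H. \<exists>l \<in> E - H. src e \<noteq> tgt e \<and> src l = tgt l \<and>
         src l \<in> {src e, tgt e})"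

text \<open>Mass and energy of u (edgewise functions, with edgewise derivative u1).\<close>
definition mass :: "'e set \<Rightarrow> 'e set \<Rightarrow> ('e \<Rightarrow> real) \<Rightarrow> ('e \<Rightarrow> real \<Rightarrow> real) \<Rightarrow> real" where
  "mass E H L u = (\<Sum>e\<in>E. integral (edom H L e) (\<lambda>x. (u e x)\<^sup>2))"

definition energy ::
  "real \<Rightarrow> 'e set \<Rightarrow> 'e set \<Rightarrow> ('e \<Rightarrow> real) \<Rightarrow> ('e \<Rightarrow> real \<Rightarrow> real) \<Rightarrow> ('e \<Rightarrow> real \<Rightarrow> real) \<Rightarrow> real" where
  "energy p E H L u u1 =
     1/2 * (\<Sum>e\<in>E. integral (edom H L e) (\<lambda>x. (u1 e x)\<^sup>2))
     - 1/p * (\<Sum>e\<in>E. integral (edom H L e) (\<lambda>x. \<bar>u e x\<bar> powr p))"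

text \<open>
  u is a (strong) positive solution of  u'' + u^(p-1) = lam u  on every edge, u \<in> H^1(G),
  with the Kirchhoff condition at every vertex; u1 is the edgewise derivative of u.
  Continuity at vertices: all edge ends at a common vertex carry the same value.
  Derivative at v along e, with v at 0: at src e it is u1 e 0, at tgt e it is -(u1 e (L e)).
\<close>
definition kirchhoff_solution ::
  "real \<Rightarrow> 'e set \<Rightarrow> 'e set \<Rightarrow> ('e \<Rightarrow> real) \<Rightarrow> ('e \<Rightarrow> 'v) \<Rightarrow> ('e \<Rightarrow> 'v)
    \<Rightarrow> ('e \<Rightarrow> real \<Rightarrow> real) \<Rightarrow> ('e \<Rightarrow> real \<Rightarrow> real) \<Rightarrow> real \<Rightarrow> bool" where
  "kirchhoff_solution p E H L src tgt u u1 lam \<longleftrightarrow>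
     (\<forall>e \<in> E. \<forall>x \<in> edom H L e.
        (u e has_real_derivative u1 e x) (at x within edom H L e) \<and> u e x > 0) \<and>
     (\<forall>e \<in> E. \<forall>x \<in> interior (edom H L e).
        \<exists>u2. (u1 e has_real_derivative u2) (at x) \<and> u2 + (u e x) powr (p - 1) = lam * u e x) \<and>
     (\<forall>e \<in> E. (\<lambda>x. (u e x)\<^sup>2) integrable_on edom H L e \<and>
              (\<lambda>x. (u1 e x)\<^sup>2) integrable_on edom H L e \<and>
              (\<lambda>x. \<bar>u e x\<bar> powr p) integrable_on edom H L e) \<and>
     (\<forall>e \<in> E. \<forall>e' \<in> E.
        (src e = src e' \<longrightarrow> u e 0 = u e' 0) \<and>
        (e' \<notin> H \<and> src e = tgt e' \<longrightarrow> u e 0 = u e' (L e')) \<and>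
        (e \<notin> H \<and> e' \<notin> H \<and> tgt e = tgt e' \<longrightarrow> u e (L e) = u e' (L e'))) \<and>
     (\<forall>v \<in> vertices E H src tgt.
        (\<Sum>e\<in>{e \<in> E. src e = v}. u1 e 0) - (\<Sum>e\<in>{e \<in> E - H. tgt e = v}. u1 e (L e)) = 0)"

end

theory Submission
  imports Defs
begin

text \<open>Put \<open>lam = T\<^sup>2\<close> and dilate the graph by \<open>T\<close>: the equation becomes \<open>w'' + w\<^bsup>p-1\<^esup> = w\<close>, and the
  mass of \<open>u\<close> is \<open>T\<^bsup>(6-p)/(p-2)\<^esup>\<close> times that of \<open>w\<close>, so that small masses correspond to large \<open>T\<close>. The
  solution sought is close to a half soliton centred at the tip of a pendant, or to a soliton centred
  at the midpoint of the loop of a signpost (the other edge of the signpost plays no role), and small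
  on the rest of the graph.

  The special edge is shot from its base vertex: boundary value \<open>s\<close> and slope \<open>r\<close>, both small,
  determine the time at which the solution peaks, and this time fixes \<open>T\<close>. On the other bounded edges
  the small Dirichlet problem is uniquely solvable because the force is monotone near zero; on the
  half-lines the solution is the explicit soliton tail. What remains are finitely many equations, the
  Kirchhoff conditions and the prescribed mass, for the vertex values, for \<open>s + r\<close> and for the ratio
  \<open>r / (s + r)\<close>. They have the sign pattern required by the Poincare-Miranda theorem, whence a solution;
  no uniqueness or continuity of a branch in \<open>T\<close> is needed. The energy is positive because for \<open>p > 6\<close>
  the energy of the soliton is, and the rest contributes only \<open>O(s + r)\<close>.\<close>

text \<open>The zero function satisfies every vertex condition, so a fixed point argument might find
  only that. Measuring the start on the special edge by its size \<open>eps = s + r\<close>, kept in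
  \<open>[eps1, eps0]\<close> with \<open>eps1 > 0\<close>, excludes it. Measuring the other vertex
  values as fractions of \<open>eps\<close> gives the sign pattern: at a vertex with value 0 all
  outgoing slopes are nonnegative, a vertex with value \<open>eps\<close> is a maximum and has
  nonpositive ones, and at the base \<open>r = 0\<close> puts the value itself at
  \<open>eps\<close>. The size is paired with the mass: a smaller \<open>eps\<close> delays the
  peak, enlarges \<open>T\<close> and lowers the mass, so the two ends of the range bracket any
  small mass.

  The dilated edges grow without bound as \<open>eps\<close> tends to 0, so every mass bound must be
  independent of length. It comes from \<open>w^2 <= 2 max(w) w''\<close> for small
  \<open>w\<close>, whose integral sees only the end slopes. For the peak time a bound of order
  \<open>1 / eps\<close> is enough, because the conserved energy is of order
  \<open>eps^2\<close>.\<close>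

subsection \<open>Flows of Lipschitz vector fields\<close>

text \<open>The substitution \<open>s = t * sg\<close> puts the integral over the fixed interval
  \<open>{0..1}\<close>, so joint continuity in \<open>(x, t)\<close> is continuity of a parameter
  integral.\<close>

primrec picard :: "('a::euclidean_space \<Rightarrow> 'a) \<Rightarrow> nat \<Rightarrow> 'a \<Rightarrow> real \<Rightarrow> 'a" where
  "picard f 0 x t = x"
| "picard f (Suc n) x t = x + t *\<^sub>R integral {0..1} (\<lambda>sg. f (picard f n x (t * sg)))"

declare picard.simps(2) [simp del]

lemma continuous_on_picard:
  fixes f :: "'a::euclidean_space \<Rightarrow> 'a"
  assumes f: "continuous_on UNIV f" and "continuous_on S u" "continuous_on S v"
  shows "continuous_on S (\<lambda>z. picard f n (u z) (v z))"
proof -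
  have "continuous_on UNIV (\<lambda>z. picard f n (fst z) (snd z))"
  proof (induction n)
    case 0
    show ?case by (simp add: continuous_on_fst)
  next
    case (Suc n)
    have "continuous_on (UNIV \<times> cbox 0 1) (\<lambda>w :: ('a \<times> real) \<times> real. (fst (fst w), snd (fst w) * snd w))"
      by (intro continuous_on_Pair continuous_on_mult continuous_on_fst continuous_on_snd continuous_on_id)
    from continuous_on_compose2[OF f continuous_on_compose2[OF Suc this]]
    have "continuous_on (UNIV \<times> cbox 0 1) (\<lambda>(z, sg). f (picard f n (fst z) (snd z * sg)))"
      by (simp add: case_prod_unfold)
    from integral_continuous_on_param[OF this]
    have "continuous_on UNIV (\<lambda>z. integral {0..1} (\<lambda>sg. f (picard f n (fst z) (snd z * sg))))"
      by simp
    then show ?case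
      unfolding picard.simps(2) by (intro continuous_intros)
  qed
  from continuous_on_compose2[OF this, of S "\<lambda>z. (u z, v z)"] show ?thesis
    using assms by (simp add: continuous_on_Pair)
qed

text \<open>In the induction the integral of \<open>sg ^ Suc n\<close> over the unit interval
  supplies the next factor of the factorial, and the Lipschitz constant the next power of
  \<open>K\<close>.\<close>

lemma picard_step_bound:
  fixes f :: "'a::euclidean_space \<Rightarrow> 'a"
  assumes lip: "\<And>x y. norm (f x - f y) \<le> K * norm (x - y)" and K: "K \<ge> 0"
  shows "norm (picard f (Suc n) x t - picard f n x t) \<le> norm (f x) * K ^ n * \<bar>t\<bar> ^ Suc n / fact (Suc n)"
proof (induction n arbitrary: t)
  case 0
  show ?case by (simp add: picard.simps(2))
next
  case (Suc n)
  have lipf: "K-lipschitz_on UNIV f"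
    using lip K by (intro lipschitz_onI) (auto simp: dist_norm)
  have contf: "continuous_on UNIV f"
    by (rule lipschitz_on_continuous_on[OF lipf])
  have cp: "continuous_on {0..1} (\<lambda>sg. f (picard f m x (t * sg)))" for m
    by (rule continuous_on_compose2[OF contf continuous_on_picard[OF contf]])
       (simp_all add: continuous_on_mult_left)
  define C where "C = norm (f x) * K ^ Suc n * \<bar>t\<bar> ^ Suc n / fact (Suc n)"
  have "picard f (Suc (Suc n)) x t - picard f (Suc n) x t =
      t *\<^sub>R (integral {0..1} (\<lambda>sg. f (picard f (Suc n) x (t * sg))) - integral {0..1} (\<lambda>sg. f (picard f n x (t * sg))))"
    by (simp add: scaleR_diff_right picard.simps(2)[of f "Suc n"] picard.simps(2)[of f "n" x t])
  also have "... = t *\<^sub>R integral {0..1} (\<lambda>sg. f (picard f (Suc n) x (t * sg)) - f (picard f n x (t * sg)))"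
    by (subst integral_diff) (auto intro!: integrable_continuous_real cp)
  finally have eq: "norm (picard f (Suc (Suc n)) x t - picard f (Suc n) x t) =
      \<bar>t\<bar> * norm (integral {0..1} (\<lambda>sg. f (picard f (Suc n) x (t * sg)) - f (picard f n x (t * sg))))"
    by simp
  have le: "norm (integral {0..1} (\<lambda>sg. f (picard f (Suc n) x (t * sg)) - f (picard f n x (t * sg))))
     \<le> integral {0..1} (\<lambda>sg. C * sg ^ Suc n)"
  proof (rule integral_norm_bound_integral)
    show "(\<lambda>sg. f (picard f (Suc n) x (t * sg)) - f (picard f n x (t * sg))) integrable_on {0..1}"
      by (intro integrable_continuous_real continuous_intros cp)
    show "(\<lambda>sg. C * sg ^ Suc n) integrable_on {0..1}"
      by (intro integrable_continuous_real continuous_intros)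
    fix sg :: real assume s: "sg \<in> {0..1}"
    have "norm (f (picard f (Suc n) x (t * sg)) - f (picard f n x (t * sg)))
       \<le> K * norm (picard f (Suc n) x (t * sg) - picard f n x (t * sg))"
      by (rule lip)
    also have "... \<le> K * (norm (f x) * K ^ n * \<bar>t * sg\<bar> ^ Suc n / fact (Suc n))"
      by (intro mult_left_mono Suc K)
    also have "... = C * sg ^ Suc n"
      using s by (simp add: C_def abs_mult power_mult_distrib)
    finally show "norm (f (picard f (Suc n) x (t * sg)) - f (picard f n x (t * sg))) \<le> C * sg ^ Suc n" .
  qed
  have "((\<lambda>sg. C * sg ^ Suc n) has_integral C * (1 ^ Suc (Suc n) / Suc (Suc n)) - C * (0 ^ Suc (Suc n) / Suc (Suc n))) {0..1}"
    by (rule fundamental_theorem_of_calculus)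
       (auto intro!: derivative_eq_intros simp: has_real_derivative_iff_has_vector_derivative[symmetric] field_simps simp del: power_Suc of_nat_Suc)
  from integral_unique[OF this]
  have int_eq: "integral {0..1} (\<lambda>sg. C * sg ^ Suc n) = C / Suc (Suc n)" by (simp only: power_one) simp
  have "norm (picard f (Suc (Suc n)) x t - picard f (Suc n) x t) \<le> \<bar>t\<bar> * (C / Suc (Suc n))"
    using le unfolding eq int_eq by (intro mult_left_mono) auto
  also have "... = norm (f x) * K ^ Suc n * \<bar>t\<bar> ^ Suc (Suc n) / fact (Suc (Suc n))"
    unfolding C_def fact_Suc[of "Suc n"] by (simp add: field_simps del: of_nat_Suc fact_Suc)
  finally show ?case .
qed

text \<open>Picard iteration. On bounded sets of \<open>(x, t)\<close> the steps are dominated by an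
  exponential series, so convergence is locally uniform and the limit jointly continuous. That
  continuity later gives the continuous dependence of a shot on its data.\<close>

theorem lipschitz_flow_exists:
  fixes f :: "'a::euclidean_space \<Rightarrow> 'a"
  assumes lip: "\<And>x y. norm (f x - f y) \<le> K * norm (x - y)" and K: "K \<ge> 0"
  obtains Phi where "\<And>x. Phi x 0 = x"
    and "\<And>x t X. t \<in> {0..X} \<Longrightarrow> (Phi x has_vector_derivative f (Phi x t)) (at t within {0..X})"
    and "continuous_on UNIV (\<lambda>(x, t). Phi x t)"
proof -
  have lipf: "K-lipschitz_on UNIV f"
    using lip K by (intro lipschitz_onI) (auto simp: dist_norm)
  have contf: "continuous_on UNIV f"
    by (rule lipschitz_on_continuous_on[OF lipf])
  define Phi where "Phi x t = x + (\<Sum>i. picard f (Suc i) x t - picard f i x t)" for x t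
  have ul: "uniform_limit (ball 0 R \<times> {-R<..<R}) (\<lambda>n (x, t). picard f n x t) (\<lambda>(x, t). Phi x t) sequentially" 
    for R :: real
  proof (cases "R > 0")
    case False
    then have "ball (0::'a) R \<times> {-R<..<R} = {}" by auto
    then show ?thesis by simp
  next
    case True
    define C where "C = norm (f 0) + K * R"
    have C: "norm (f x) \<le> C" if "x \<in> ball 0 R" for x
    proof -
      have "norm (f x) \<le> norm (f 0) + norm (f x - f 0)" by (rule norm_triangle_sub)
      also have "... \<le> norm (f 0) + K * norm x" using lip[of x 0] by simp
      also have "... \<le> C" unfolding C_def using that K by (auto intro!: mult_left_mono)
      finally show ?thesis .
    qed
    have C0: "C \<ge> 0" unfolding C_def using K True by simp
    have "uniform_limit (ball 0 R \<times> {-R<..<R}) 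
       (\<lambda>n z. \<Sum>i<n. picard f (Suc i) (fst z) (snd z) - picard f i (fst z) (snd z))
       (\<lambda>z. \<Sum>i. picard f (Suc i) (fst z) (snd z) - picard f i (fst z) (snd z)) sequentially"
    proof (rule Weierstrass_m_test)
      show "summable (\<lambda>n. C * R * ((K * R) ^ n /\<^sub>R fact n))"
        by (intro summable_mult summable_exp_generic)
      fix n and z :: "'a \<times> real" assume z: "z \<in> ball 0 R \<times> {-R<..<R}"
      have "norm (picard f (Suc n) (fst z) (snd z) - picard f n (fst z) (snd z))
        \<le> norm (f (fst z)) * K ^ n * \<bar>snd z\<bar> ^ Suc n / fact (Suc n)"
        by (rule picard_step_bound[OF lip K])
      also have "... \<le> C * K ^ n * R ^ Suc n / fact n"
        using z K C[of "fst z"] C0 True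
        by (intro frac_le mult_mono power_mono fact_mono) (auto simp: mem_Times_iff)
      also have "... = C * R * ((K * R) ^ n /\<^sub>R fact n)"
        by (simp add: power_mult_distrib divide_inverse mult_ac)
      finally show "norm (picard f (Suc n) (fst z) (snd z) - picard f n (fst z) (snd z))
        \<le> C * R * ((K * R) ^ n /\<^sub>R fact n)" .
    qed
    note ul = uniform_limit_add[OF uniform_limit_const[where c = "\<lambda>z. fst z"] this]
    have tel: "(\<Sum>i<n. picard f (Suc i) x t - picard f i x t) = picard f n x t - x" for n x t
      using sum_lessThan_telescope[of "\<lambda>i. picard f i x t" n] by simp
    with ul show ?thesis
      by (simp add: Phi_def case_prod_unfold)
  qed
  have "continuous_on (\<Union>R. ball 0 R \<times> {-R<..<R}) (\<lambda>(x, t). Phi x t)"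
    by (rule continuous_on_open_UN[OF _ uniform_limit_theorem[OF _ ul]])
       (auto intro!: open_Times always_eventually continuous_on_picard[OF contf] continuous_on_fst continuous_on_snd continuous_on_id
         simp: case_prod_unfold)
  moreover have "(\<Union>R. ball (0::'a) R \<times> {-R<..<R}) = UNIV"
  proof -
    have "z \<in> ball 0 (norm (fst z) + \<bar>snd z\<bar> + 1) \<times> {- (norm (fst z) + \<bar>snd z\<bar> + 1)<..<norm (fst z) + \<bar>snd z\<bar> + 1}"
      for z :: "'a \<times> real"
      by (cases z) (auto simp: abs_if intro: add_nonneg_pos, (smt (verit) norm_ge_zero)+)
    then show ?thesis by blast
  qed
  ultimately have cont: "continuous_on UNIV (\<lambda>(x, t). Phi x t)" by simp
  have contt: "continuous_on S (Phi x)" for x S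
    using continuous_on_compose2[OF cont[unfolded case_prod_unfold], of S "\<lambda>t. (x, t)"]
    by (simp add: continuous_on_Pair)
  have inteq: "Phi x t = x + t *\<^sub>R integral {0..1} (\<lambda>sg. f (Phi x (t * sg)))" for x t
  proof -
    define R where "R = norm x + \<bar>t\<bar> + 1"
    have in_R: "(x, t * sg) \<in> ball 0 R \<times> {-R<..<R}" if "sg \<in> {0..1}" for sg
    proof -
      have "\<bar>t * sg\<bar> \<le> \<bar>t\<bar> * 1" unfolding abs_mult using that by (intro mult_left_mono) auto
      then show ?thesis unfolding R_def by (auto simp: abs_if intro: add_nonneg_pos split: if_splits; smt (verit) norm_ge_zero)
    qed
    have u1: "uniform_limit {0..1} (\<lambda>n sg. picard f n x (t * sg)) (\<lambda>sg. Phi x (t * sg)) sequentially"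
      using uniform_limit_compose'[OF ul[of R], of "\<lambda>sg. (x, t * sg)" "{0..1}"] in_R by auto
    have u2: "uniform_limit {0..1} (\<lambda>n sg. f (picard f n x (t * sg))) (\<lambda>sg. f (Phi x (t * sg))) sequentially"
      by (rule uniform_limit_compose_uniformly_continuous_on[OF u1 lipschitz_on_uniformly_continuous[OF lipf]]) auto
    have cp: "continuous_on {0..1} (\<lambda>sg. f (picard f m x (t * sg)))" for m
      by (rule continuous_on_compose2[OF contf continuous_on_picard[OF contf]])
       (simp_all add: continuous_on_mult_left)
    obtain I J where IJ: "\<And>n. ((\<lambda>sg. f (picard f n x (t * sg))) has_integral I n) {0..1}"
        "((\<lambda>sg. f (Phi x (t * sg))) has_integral J) {0..1}" "I \<longlonglongrightarrow> J"
      using uniform_limit_integral[OF u2 cp] by auto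
    have "picard f (Suc n) x t = x + t *\<^sub>R I n" for n
      using IJ(1) by (simp add: picard.simps(2) integral_unique)
    moreover have "(\<lambda>n. x + t *\<^sub>R I n) \<longlonglongrightarrow> x + t *\<^sub>R J" by (intro tendsto_intros IJ)
    ultimately have "(\<lambda>n. picard f (Suc n) x t) \<longlonglongrightarrow> x + t *\<^sub>R J" by simp
    moreover have "(\<lambda>n. picard f n x t) \<longlonglongrightarrow> Phi x t"
      using tendsto_uniform_limitI[OF u1, of 1] by simp
    ultimately have "Phi x t = x + t *\<^sub>R J"
      by (intro LIMSEQ_unique[OF LIMSEQ_Suc]) auto
    then show ?thesis
      using integral_unique[OF IJ(2)] by simp
  qed
  have "(Phi x has_vector_derivative f (Phi x t)) (at t within {0..X})" if t: "t \<in> {0..X}" for x t X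
  proof -
    have cf: "continuous_on {0..X} (\<lambda>s. f (Phi x s))" for X
      by (intro continuous_on_compose2[OF contf contt]) auto
    have eq: "Phi x u = x + integral {0..u} (\<lambda>s. f (Phi x s))" if u: "u \<in> {0..X}" for u
    proof (cases "u = 0")
      case True
      then show ?thesis by (subst inteq) simp
    next
      case False
      with u have u: "u > 0" by auto
      have "((\<lambda>s. f (Phi x s)) has_integral integral {0..u} (\<lambda>s. f (Phi x s))) {0..u}"
        by (intro integrable_integral integrable_continuous_real cf)
      from has_integral_stretch_real[OF this, of u]
      have "((\<lambda>s. f (Phi x (u * s))) has_integral (1 / u) *\<^sub>R integral {0..u} (\<lambda>s. f (Phi x s))) {0..1}"
        using u by (simp add: image_divide_atLeastAtMost)
      from integral_unique[OF this] show ?thesis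
        by (subst inteq) (use u in simp)
    qed
    have "((\<lambda>u. x + integral {0..u} (\<lambda>s. f (Phi x s))) has_vector_derivative f (Phi x t)) (at t within {0..X})"
      using integral_has_vector_derivative[OF cf t] by (auto intro!: derivative_eq_intros)
    then show ?thesis
      by (rule has_vector_derivative_transform[OF t, rotated -1]) (use eq in auto)
  qed
  moreover have "Phi x 0 = x" for x by (subst inteq) simp
  ultimately show ?thesis by (intro that[OF _ _ cont])
qed

subsection \<open>The Poincare-Miranda theorem\<close>

text \<open>Kuhn's labelling lemma on finer and finer grids: each grid has a cell carrying both
  signs of every \<open>G i\<close>, and by compactness a subsequence of cells shrinks to a common
  zero. Points are functions on all of \<open>nat\<close>; grid points have the coordinates from
  \<open>n\<close> on equal to 0.\<close>

lemma poincare_miranda_nat: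
  fixes G :: "nat \<Rightarrow> (nat \<Rightarrow> real) \<Rightarrow> real" and n :: nat
  assumes cont: "\<And>i. i < n \<Longrightarrow> continuous_on {x. \<forall>j. 0 \<le> x j \<and> x j \<le> 1} (G i)"
    and lo: "\<And>i x. i < n \<Longrightarrow> (\<And>j. 0 \<le> x j \<and> x j \<le> 1) \<Longrightarrow> x i = 0 \<Longrightarrow> G i x \<le> 0"
    and hi: "\<And>i x. i < n \<Longrightarrow> (\<And>j. 0 \<le> x j \<and> x j \<le> 1) \<Longrightarrow> x i = 1 \<Longrightarrow> G i x \<ge> 0"
  obtains x where "\<And>j. 0 \<le> x j \<and> x j \<le> 1" "\<And>i. i < n \<Longrightarrow> G i x = 0"
proof -
  let ?Q = "{x :: nat \<Rightarrow> real. \<forall>j. 0 \<le> x j \<and> x j \<le> 1}"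
  have Qeq: "?Q = Pi\<^sub>E UNIV (\<lambda>_. {0..1})" by (auto simp: PiE_def Pi_def)
  have cptQ: "compact ?Q"
  proof -
    have "compactin (product_topology (\<lambda>i::nat. euclideanreal) UNIV) (Pi\<^sub>E UNIV (\<lambda>_. {0..1}))"
      by (subst compactin_PiE) auto
    then show ?thesis unfolding Qeq by (metis compactin_euclidean_iff euclidean_product_topology)
  qed
  define sc where "sc p q = (\<lambda>j. if j < n then real (q j) / real (Suc p) else 0)" for p :: nat and q :: "nat \<Rightarrow> nat"
  \<comment> \<open>The labels on the faces are the ones Kuhn's lemma prescribes. By
    \<open>lo\<close> and \<open>hi\<close>, label 0 means \<open>G i <= 0\<close> and label 1 means
    \<open>G i >= 0\<close> there as well.\<close>
  define lab where "lab p q i = (if q i = 0 then 0 else if q i = Suc p then 1 else if G i (sc p q) \<le> 0 then 0 else 1::nat)" for p q i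
  have scQ: "sc p q \<in> ?Q" if "\<forall>i<n. q i \<le> Suc p" for p q
    using that by (auto simp: sc_def le_divide_eq divide_le_eq simp flip: of_nat_Suc simp del: of_nat_Suc)
  have lab0: "G i (sc p q) \<le> 0" if "lab p q i = 0" "i < n" "\<forall>i<n. q i \<le> Suc p" for p q i
    using that lo[of i "sc p q"] scQ[OF that(3)] by (auto simp: lab_def sc_def split: if_splits)
  have lab1: "G i (sc p q) \<ge> 0" if "lab p q i = 1" "i < n" "\<forall>i<n. q i \<le> Suc p" for p q i
    using that hi[of i "sc p q"] scQ[OF that(3)] by (auto simp: lab_def sc_def split: if_splits)
  define Q where "Q p i a b c \<longleftrightarrow> a \<in> ?Q \<and> b \<in> ?Q \<and> c \<in> ?Q \<and>
      (\<forall>j. \<bar>b j - a j\<bar> \<le> 1 / Suc p) \<and> (\<forall>j. \<bar>c j - a j\<bar> \<le> 1 / Suc p) \<and> G i b \<le> 0 \<and> G i c \<ge> 0"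
    for p :: nat and i a b c
  have "\<exists>a. \<forall>i<n. \<exists>b c. a \<in> ?Q \<and> b \<in> ?Q \<and> c \<in> ?Q \<and>
      (\<forall>j. \<bar>b j - a j\<bar> \<le> 1 / Suc p) \<and> (\<forall>j. \<bar>c j - a j\<bar> \<le> 1 / Suc p) \<and> G i b \<le> 0 \<and> G i c \<ge> 0" for p
  proof -
    obtain q where q: "\<forall>i<n. q i < Suc p" 
       "\<forall>i<n. \<exists>r s. (\<forall>j<n. q j \<le> r j \<and> r j \<le> q j + 1) \<and> (\<forall>j<n. q j \<le> s j \<and> s j \<le> q j + 1) \<and> lab p r i \<noteq> lab p s i"
      by (rule kuhn_lemma[of "Suc p" n "lab p"]) (auto simp: lab_def)
    show ?thesis
    proof (rule exI[of _ "sc p q"], intro allI impI)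
      fix i assume i: "i < n"
      obtain r s where rs: "\<forall>j<n. q j \<le> r j \<and> r j \<le> q j + 1" "\<forall>j<n. q j \<le> s j \<and> s j \<le> q j + 1" "lab p r i \<noteq> lab p s i"
        using q(2) i by blast
      have le: "\<forall>i<n. r i \<le> Suc p" "\<forall>i<n. s i \<le> Suc p" "\<forall>i<n. q i \<le> Suc p"
        using rs q(1) by fastforce+
      have near: "\<bar>sc p t j - sc p q j\<bar> \<le> 1 / Suc p" if "\<forall>j<n. q j \<le> t j \<and> t j \<le> q j + 1" for t j
        using that by (auto simp: sc_def simp flip: diff_divide_distrib intro!: divide_right_mono)
      from rs(3) consider "lab p r i = 0" "lab p s i = 1" | "lab p r i = 1" "lab p s i = 0"
        unfolding lab_def by (auto split: if_splits)
      then show "\<exists>b c. sc p q \<in> ?Q \<and> b \<in> ?Q \<and> c \<in> ?Q \<and>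
        (\<forall>j. \<bar>b j - sc p q j\<bar> \<le> 1 / Suc p) \<and> (\<forall>j. \<bar>c j - sc p q j\<bar> \<le> 1 / Suc p) \<and> G i b \<le> 0 \<and> G i c \<ge> 0"
      proof cases
        case 1
        then show ?thesis
          by (intro exI[of _ "sc p r"] exI[of _ "sc p s"] conjI allI near rs scQ le lab0[OF _ i] lab1[OF _ i])
      next
        case 2
        then show ?thesis
          by (intro exI[of _ "sc p s"] exI[of _ "sc p r"] conjI allI near rs scQ le lab0[OF _ i] lab1[OF _ i])
      qed
    qed
  qed
  then have "\<exists>a. \<forall>i<n. \<exists>b c. Q p i a b c" for p
    unfolding Q_def .
  then obtain a where a: "\<And>p i. i < n \<Longrightarrow> \<exists>b c. Q p i (a p) b c"
    by metis
  define bc where "bc p i = (SOME z. Q p i (a p) (fst z) (snd z))" for p i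
  define b where "b p i = fst (bc p i)" for p i
  define c where "c p i = snd (bc p i)" for p i
  have "Q p i (a p) (b p i) (c p i)" if "i < n" for p i
    unfolding b_def c_def bc_def by (rule someI_ex) (use a[OF that] in auto)
  note abc = this[unfolded Q_def]
  show ?thesis
  proof (cases "n = 0")
    case True
    then show ?thesis using that[of "\<lambda>_. 0"] by auto
  next
    case False
    then have "\<forall>p. a p \<in> ?Q" using abc[of 0] by auto
    then obtain x rho where x: "x \<in> ?Q" "strict_mono rho" "(a \<circ> rho) \<longlonglongrightarrow> x"
      using cptQ unfolding compact_def by blast
    have ax: "(\<lambda>k. a (rho k) j) \<longlonglongrightarrow> x j" for j
      using continuous_on_tendsto_compose[OF continuous_on_product_coordinates x(3), of j] by (simp add: o_def)
    have lim0: "(\<lambda>k. 1 / real (Suc (rho k))) \<longlonglongrightarrow> 0"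
      using LIMSEQ_subseq_LIMSEQ[OF LIMSEQ_inverse_real_of_nat x(2)] by (simp add: o_def inverse_eq_divide)
    have near_lim: "(\<lambda>k. d (rho k)) \<longlonglongrightarrow> x" if "\<And>p j. \<bar>d p j - a p j\<bar> \<le> 1 / Suc p" for d :: "nat \<Rightarrow> nat \<Rightarrow> real"
    proof -
      have "(\<lambda>k. d (rho k) j) \<longlonglongrightarrow> x j" for j
      proof -
        have "(\<lambda>k. d (rho k) j - a (rho k) j) \<longlonglongrightarrow> 0"
          by (rule Lim_null_comparison[OF _ lim0]) (use that in auto)
        from tendsto_add[OF this ax[of j]] show ?thesis by simp
      qed
      then have "limitin (product_topology (\<lambda>_. euclidean) UNIV) (\<lambda>k. d (rho k)) x sequentially"
        by (simp add: limitin_componentwise)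
      then show ?thesis by (simp add: euclidean_product_topology)
    qed
    have "G i x = 0" if i: "i < n" for i
    proof -
      have "(\<lambda>k. G i (b (rho k) i)) \<longlonglongrightarrow> G i x" "(\<lambda>k. G i (c (rho k) i)) \<longlonglongrightarrow> G i x"
        by (rule continuous_on_tendsto_compose[OF cont[OF i]],
            use abc[OF i] x(1) in \<open>auto intro!: near_lim always_eventually\<close>)+
      then have "G i x \<le> 0" "0 \<le> G i x"
        using abc[OF i] by (auto intro: tendsto_upperbound tendsto_lowerbound simp: always_eventually)
      then show ?thesis by simp
    qed
    then show ?thesis using that x(1) by auto
  qed
qed

theorem poincare_miranda:
  fixes G :: "'i \<Rightarrow> ('i \<Rightarrow> real) \<Rightarrow> real" and I :: "'i set"
  assumes fin: "finite I"
    and cont: "\<And>i. i \<in> I \<Longrightarrow> continuous_on {x. \<forall>j. 0 \<le> x j \<and> x j \<le> 1} (G i)"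
    and lo: "\<And>i x. i \<in> I \<Longrightarrow> (\<And>j. 0 \<le> x j \<and> x j \<le> 1) \<Longrightarrow> x i = 0 \<Longrightarrow> G i x \<le> 0"
    and hi: "\<And>i x. i \<in> I \<Longrightarrow> (\<And>j. 0 \<le> x j \<and> x j \<le> 1) \<Longrightarrow> x i = 1 \<Longrightarrow> G i x \<ge> 0"
  obtains x where "\<And>j. 0 \<le> x j \<and> x j \<le> 1" "\<And>i. i \<in> I \<Longrightarrow> G i x = 0"
proof -
  obtain idx where idx: "bij_betw idx {..<card I} I"
    using ex_bij_betw_nat_finite[OF fin] by (auto simp: atLeast0LessThan)
  define inv where "inv = the_inv_into {..<card I} idx"
  have inv: "inv i < card I" "idx (inv i) = i" if "i \<in> I" for i
    using that idx the_inv_into_into[of idx "{..<card I}" i "{..<card I}"] f_the_inv_into_f[of idx "{..<card I}" i]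
    unfolding inv_def bij_betw_def by auto
  have inv_idx: "inv (idx k) = k" "idx k \<in> I" if "k < card I" for k
    using that idx unfolding inv_def bij_betw_def by (auto simp: the_inv_into_f_f)
  define ext where "ext x = (\<lambda>i. if i \<in> I then x (inv i) else 0)" for x :: "nat \<Rightarrow> real"
  have ext_cont: "continuous_on S ext" for S
  proof (rule continuous_on_coordinatewise_then_product)
    fix i show "continuous_on S (\<lambda>x. ext x i)"
      unfolding ext_def by (cases "i \<in> I") (auto intro: continuous_on_subset[OF continuous_on_product_coordinates])
  qed
  obtain x where x: "\<And>j. 0 \<le> x j \<and> x j \<le> 1" "\<And>k. k < card I \<Longrightarrow> G (idx k) (ext x) = 0"
  proof (rule poincare_miranda_nat[of "card I" "\<lambda>k x. G (idx k) (ext x)"])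
    fix k assume k: "k < card I"
    show "continuous_on {x. \<forall>j. 0 \<le> x j \<and> x j \<le> 1} (\<lambda>x. G (idx k) (ext x))"
      by (rule continuous_on_compose2[OF cont[OF inv_idx(2)[OF k]] ext_cont]) (auto simp: ext_def)
    fix x :: "nat \<Rightarrow> real" assume x: "\<And>j. 0 \<le> x j \<and> x j \<le> 1"
    have e: "0 \<le> ext x j \<and> ext x j \<le> 1" "ext x (idx k) = x k" for j
      using x k inv_idx by (auto simp: ext_def)
    show "G (idx k) (ext x) \<le> 0" if "x k = 0" using lo[OF inv_idx(2)[OF k] e(1)] e(2) that by simp
    show "G (idx k) (ext x) \<ge> 0" if "x k = 1" using hi[OF inv_idx(2)[OF k] e(1)] e(2) that by simp
  qed auto
  have "G i (ext x) = 0" if "i \<in> I" for i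
    using x(2)[OF inv(1)[OF that]] inv(2)[OF that] by simp
  then show ?thesis
    using x(1) by (intro that[of "ext x"]) (auto simp: ext_def)
qed

subsection \<open>Real-variable preliminaries\<close>

text \<open>Closed graph theorem with compact range. It takes the place of an implicit function
  argument for the peak time and for the Dirichlet slope: both are unique solutions of closed
  conditions within a bounded range.\<close>

lemma continuous_on_unique_solution:
  fixes X :: "'a::euclidean_space set" and F :: "'a \<Rightarrow> real"
  assumes "closed X" and closed_R: "closed {(x, y). x \<in> X \<and> y \<in> {lo..hi} \<and> R x y}"
    and sol: "\<And>x. x \<in> X \<Longrightarrow> F x \<in> {lo..hi} \<and> R x (F x)"
    and uniq: "\<And>x y. x \<in> X \<Longrightarrow> y \<in> {lo..hi} \<Longrightarrow> R x y \<Longrightarrow> y = F x"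
  shows "continuous_on X F"
proof (rule continuous_from_closed_graph[of "{lo..hi}"])
  have "(\<lambda>x. (x, F x)) ` X = {(x, y). x \<in> X \<and> y \<in> {lo..hi} \<and> R x y}"
  proof (intro equalityI subsetI)
    fix z assume "z \<in> (\<lambda>x. (x, F x)) ` X"
    then show "z \<in> {(x, y). x \<in> X \<and> y \<in> {lo..hi} \<and> R x y}" using sol by blast
  next
    fix z assume "z \<in> {(x, y). x \<in> X \<and> y \<in> {lo..hi} \<and> R x y}"
    then obtain x y where "z = (x, y)" "x \<in> X" "y = F x" using uniq by blast
    then show "z \<in> (\<lambda>x. (x, F x)) ` X" by blast
  qed
  then show "closed ((\<lambda>x. (x, F x)) ` X)" using closed_R by simp
  show "F \<in> X \<rightarrow> {lo..hi}" using sol by blast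
qed simp

lemma has_real_derivative_glue:
  fixes f g :: "real \<Rightarrow> real"
  assumes ab: "a \<le> c" "c \<le> b"
    and f: "\<And>x. x \<in> {a..c} \<Longrightarrow> (f has_real_derivative f' x) (at x within {a..c})"
    and g: "\<And>x. x \<in> {c..b} \<Longrightarrow> (g has_real_derivative g' x) (at x within {c..b})"
    and eq: "f c = g c" "f' c = g' c"
    and x: "x \<in> {a..b}"
  shows "((\<lambda>x. if x \<le> c then f x else g x) has_real_derivative (if x \<le> c then f' x else g' x)) (at x within {a..b})"
proof -
  let ?h = "\<lambda>x. if x \<le> c then f x else g x" and ?h' = "if x \<le> c then f' x else g' x"
  \<comment> \<open>Off a closed piece the filter is trivial, so each of the two one-sided claims
    has content only on its own piece.\<close>
  have bot: "at y within S = bot" if "closed S" "y \<notin> S" for y :: real and S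
    using that by (simp add: at_within_eq_bot_iff)
  have 1: "(?h has_real_derivative ?h') (at x within {a..c})"
  proof (cases "x \<le> c")
    case True
    then have xin: "x \<in> {a..c}" using x by auto
    have "(?h has_real_derivative f' x) (at x within {a..c})"
      by (rule has_field_derivative_transform_within[OF f[OF xin] zero_less_one xin]) auto
    then show ?thesis using True by simp
  next
    case False
    then show ?thesis using bot[of "{a..c}" x] by (simp add: has_field_derivative_iff)
  qed
  have 2: "(?h has_real_derivative ?h') (at x within {c..b})"
  proof (cases "x \<ge> c")
    case True
    then have xin: "x \<in> {c..b}" using x by auto
    have "(?h has_real_derivative g' x) (at x within {c..b})"
      by (rule has_field_derivative_transform_within[OF g[OF xin] zero_less_one xin]) (use eq in auto)
    then show ?thesis using True eq by (cases "x = c") auto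
  next
    case False
    then show ?thesis using bot[of "{c..b}" x] by (simp add: has_field_derivative_iff)
  qed
  have "{a..b} = {a..c} \<union> {c..b}" using ab by auto
  moreover have "(?h has_real_derivative ?h') (at x within {a..c} \<union> {c..b})"
    using 1 2 unfolding has_field_derivative_iff unfolding at_within_union by (intro filterlim_sup)
  ultimately show ?thesis by simp
qed

text \<open>Monotonicity is the case \<open>m = 0\<close>; applied to a product with an exponential
  it plays the part of Gronwall's inequality.\<close>

lemma derivative_lower_bound:
  fixes f :: "real \<Rightarrow> real"
  assumes "u \<le> v" and "\<And>t. t \<in> {u..v} \<Longrightarrow> (f has_real_derivative f' t) (at t within {u..v})"
    and "\<And>t. t \<in> {u..v} \<Longrightarrow> m \<le> f' t"
  shows "f u + m * (v - u) \<le> f v"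
proof (cases "u = v")
  case False
  then have "u < v" using assms by simp
  then obtain t where "t \<in> {u<..<v}" "f v - f u = f' t * (v - u)"
    using mvt_simple[of u v f "\<lambda>t. (*) (f' t)"] assms(2)
    by (auto simp: has_field_derivative_def)
  moreover have "m * (v - u) \<le> f' t * (v - u)"
    using assms(1,3) calculation(1) by (intro mult_right_mono) auto
  ultimately show ?thesis by linarith
qed simp

lemma derivative_upper_bound:
  fixes f :: "real \<Rightarrow> real"
  assumes "u \<le> v" and "\<And>t. t \<in> {u..v} \<Longrightarrow> (f has_real_derivative f' t) (at t within {u..v})"
    and "\<And>t. t \<in> {u..v} \<Longrightarrow> f' t \<le> m"
  shows "f v \<le> f u + m * (v - u)"
proof -
  have "- f u + - m * (v - u) \<le> - f v"
    by (rule derivative_lower_bound[where f' = "\<lambda>t. - f' t"]) (use assms in \<open>auto intro!: derivative_intros\<close>)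
  then show ?thesis by simp
qed

text \<open>At 0 the difference quotient is \<open>y powr (a - 1)\<close>, which tends to 0 because
  \<open>a > 1\<close>. The point 0 matters since a wave may start at the value 0.\<close>

lemma has_real_derivative_powr_nonneg:
  fixes x a :: real
  assumes "x \<ge> 0" "a > 1"
  shows "((\<lambda>x. x powr a) has_real_derivative a * x powr (a - 1)) (at x within {0..})"
proof (cases "x = 0")
  case False
  then show ?thesis
    using assms by (intro has_field_derivative_at_within[OF has_real_derivative_powr]) auto
next
  case True
  have "((\<lambda>y. y powr (a - 1)) \<longlongrightarrow> 0) (at 0 within {0..})"
    using assms by (intro tendsto_eq_intros tendsto_powr') (auto simp: eventually_at_filter)
  then have "((\<lambda>y. (y powr a - 0 powr a) / (y - 0)) \<longlongrightarrow> 0) (at 0 within {0..})"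
    by (rule Lim_transform_within[OF _ zero_less_one]) (auto simp: powr_diff)
  then show ?thesis using True by (simp add: has_field_derivative_iff)
qed

lemma has_real_derivative_powr_nonneg_chain:
  fixes f :: "real \<Rightarrow> real" and a :: real
  assumes "(f has_real_derivative D) (at x within S)" "\<And>y. y \<in> S \<Longrightarrow> f y \<ge> 0" "x \<in> S" "a > 1"
  shows "((\<lambda>x. f x powr a) has_real_derivative a * f x powr (a - 1) * D) (at x within S)"
proof -
  have "((\<lambda>x. x powr a) has_real_derivative a * f x powr (a - 1)) (at (f x) within (f ` S))"
    using assms by (intro has_field_derivative_subset[OF has_real_derivative_powr_nonneg]) auto
  from DERIV_image_chain[OF this assms(1)] show ?thesis by (simp add: o_def)
qed

text \<open>Makes the first integral differentiable for the flow with velocity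
  \<open>max (Q x t) 0\<close>.\<close>

lemma has_real_derivative_max_0_squared:
  "((\<lambda>x. (max x 0)\<^sup>2) has_real_derivative 2 * max x 0) (at (x::real))"
proof -
  consider "x > 0" | "x < 0" | "x = 0" by linarith
  then show ?thesis
  proof cases
    case 1
    have "((\<lambda>x. x\<^sup>2) has_real_derivative 2 * max x 0) (at x)"
      using 1 by (auto intro!: derivative_eq_intros)
    then show ?thesis
      by (rule has_field_derivative_transform_within_open[of _ _ _ "{0<..}"]) (use 1 in auto)
  next
    case 2
    have "((\<lambda>x. 0) has_real_derivative 2 * max x 0) (at x)"
      using 2 by (auto intro!: derivative_eq_intros)
    then show ?thesis
      by (rule has_field_derivative_transform_within_open[of _ _ _ "{..<0}"]) (use 2 in auto)
  next
    case 3
    have "((\<lambda>y::real. (max y 0)\<^sup>2 / y) \<longlongrightarrow> 0) (at 0)"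
    proof (rule Lim_null_comparison)
      show "\<forall>\<^sub>F y in at 0. norm ((max y 0)\<^sup>2 / y) \<le> norm (y::real)"
        by (auto simp: eventually_at_filter max_def power2_eq_square)
      show "((\<lambda>y::real. norm y) \<longlongrightarrow> 0) (at 0)" by (intro tendsto_eq_intros) auto
    qed
    then show ?thesis using 3 by (simp add: has_field_derivative_iff)
  qed
qed

subsection \<open>The truncated force\<close>

text \<open>Beyond \<^term>\<open>c\<close> the force is frozen, which makes it globally Lipschitz; the solutions
  used below stay in \<^term>\<open>{0..c}\<close>, where the truncation is invisible.\<close>

definition force :: "real \<Rightarrow> real \<Rightarrow> real \<Rightarrow> real" where
  "force p c w = (let v = max 0 (min w c) in v - v powr (p - 1))"

lemma force_eq: "0 \<le> w \<Longrightarrow> w \<le> c \<Longrightarrow> force p c w = w - w powr (p - 1)"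
  by (simp add: force_def)

lemma powr_diff_le:
  fixes u v c a :: real
  assumes "0 \<le> u" "u \<le> v" "v \<le> c" "a \<ge> 1"
  shows "v powr a - u powr a \<le> a * c powr (a - 1) * (v - u)"
proof (cases "u = v")
  case False
  then have uv: "u < v" using assms by simp
  obtain z where z: "u < z" "z < v" "v powr a - u powr a = (v - u) * (a * z powr (a - 1))"
  proof -
    have "continuous_on {u..v} (\<lambda>x. x powr a)"
      using assms by (intro continuous_on_powr' continuous_intros) auto
    moreover have "((\<lambda>x. x powr a) has_real_derivative a * x powr (a - 1)) (at x)" if "u < x" for x
      using that assms by (intro has_real_derivative_powr) auto
    ultimately show ?thesis
      using MVT[OF uv, of "\<lambda>x. x powr a"] that uv
      by (metis DERIV_unique real_differentiable_def)
  qed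
  have "z powr (a - 1) \<le> c powr (a - 1)"
    using z assms by (intro powr_mono2) auto
  then have "(v - u) * (a * z powr (a - 1)) \<le> (v - u) * (a * c powr (a - 1))"
    using uv assms by (intro mult_left_mono) auto
  then show ?thesis using z by (simp add: mult_ac)
qed simp

lemma powr_p1_split: "w \<ge> 0 \<Longrightarrow> w powr (p - 1) = w * w powr (p - 2)" for w p :: real
  by (cases "w = 0") (auto simp: powr_diff powr_add field_simps power2_eq_square powr_numeral)

lemma powr_p_split: "w \<ge> 0 \<Longrightarrow> w powr p = w\<^sup>2 * w powr (p - 2)" for w p :: real
  by (cases "w = 0") (auto simp: powr_diff powr_add field_simps power2_eq_square powr_numeral)

lemma force_lipschitz:
  assumes "p \<ge> 2" "c \<ge> 0"
  shows "\<bar>force p c x - force p c y\<bar> \<le> (1 + (p - 1) * c powr (p - 2)) * \<bar>x - y\<bar>"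
proof -
  have *: "\<bar>force p c x - force p c y\<bar> \<le> (1 + (p - 1) * c powr (p - 2)) * (y - x)" if "x \<le> y" for x y
  proof -
    define u where "u = max 0 (min x c)"
    define v where "v = max 0 (min y c)"
    have uv: "0 \<le> u" "u \<le> v" "v \<le> c" "v - u \<le> y - x" using that assms by (auto simp: u_def v_def)
    have "0 \<le> v powr (p - 1) - u powr (p - 1)"
      using uv assms by (auto intro: powr_mono2)
    moreover have "v powr (p - 1) - u powr (p - 1) \<le> (p - 1) * c powr (p - 2) * (v - u)"
      using powr_diff_le[of u v c "p - 1"] uv assms by simp
    moreover have "(p - 1) * c powr (p - 2) * (v - u) \<le> (p - 1) * c powr (p - 2) * (y - x)"
      using uv assms by (intro mult_left_mono) auto
    ultimately have "\<bar>(v - u) - (v powr (p - 1) - u powr (p - 1))\<bar> \<le> (1 + (p - 1) * c powr (p - 2)) * (y - x)"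
      using uv by (auto simp: algebra_simps abs_le_iff)
    then show ?thesis
      unfolding force_def Let_def u_def[symmetric] v_def[symmetric] by (simp add: abs_le_iff algebra_simps)
  qed
  show ?thesis
    using *[of x y] *[of y x] by (cases "x \<le> y") (auto simp: abs_minus_commute)
qed

lemma continuous_force [continuous_intros]:
  assumes "p \<ge> 2" "c \<ge> 0" "continuous_on S f"
  shows "continuous_on S (\<lambda>x. force p c (f x))"
  unfolding force_def Let_def using assms
  by (intro continuous_intros continuous_on_powr') auto

lemma force_le:
  assumes "0 \<le> w" "0 \<le> c"
  shows "force p c w \<le> w"
proof -
  have "max 0 (min w c) \<le> w" using assms by auto
  then show ?thesis
    unfolding force_def Let_def by (smt (verit) powr_ge_zero)
qed

text \<open>\<open>h\<close> will be the identity for the plain second order equation, and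
  \<open>max x 0\<close> for the flow that stops at its peak.\<close>

lemma force_flow_exists:
  fixes p c :: real and h :: "real \<Rightarrow> real"
  assumes pc: "p \<ge> 2" "c \<ge> 0" and h: "\<And>x y. \<bar>h x - h y\<bar> \<le> \<bar>x - y\<bar>"
  obtains Y Q :: "real \<times> real \<Rightarrow> real \<Rightarrow> real" where "\<And>x. Y x 0 = fst x" "\<And>x. Q x 0 = snd x"
    "\<And>x t X. t \<in> {0..X} \<Longrightarrow> (Y x has_real_derivative h (Q x t)) (at t within {0..X})"
    "\<And>x t X. t \<in> {0..X} \<Longrightarrow> (Q x has_real_derivative force p c (Y x t)) (at t within {0..X})"
    "continuous_on UNIV (\<lambda>(x, t). Y x t)" "continuous_on UNIV (\<lambda>(x, t). Q x t)"
proof -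
  define K where "K = 1 + (p - 1) * c powr (p - 2)"
  have K: "K \<ge> 1" unfolding K_def using pc by simp
  define f where "f z = (h (snd z), force p c (fst z))" for z :: "real \<times> real"
  have lip: "norm (f x - f y) \<le> (1 + K) * norm (x - y)" for x y
  proof -
    have "norm (f x - f y) \<le> \<bar>h (snd x) - h (snd y)\<bar> + \<bar>force p c (fst x) - force p c (fst y)\<bar>"
      using norm_Pair_le[of "h (snd x) - h (snd y)" "force p c (fst x) - force p c (fst y)"] by (simp add: f_def)
    also have "... \<le> \<bar>snd x - snd y\<bar> + K * \<bar>fst x - fst y\<bar>"
      unfolding K_def using pc by (intro add_mono force_lipschitz h)
    also have "... \<le> norm (x - y) + K * norm (x - y)"
    proof -
      have "(fst x - fst y, snd x - snd y) = x - y" by (simp add: prod_eq_iff)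
      then show ?thesis
        using norm_fst_le[of "fst x - fst y" "snd x - snd y"] norm_snd_le[of "snd x - snd y" "fst x - fst y"] K
        by (intro add_mono mult_left_mono) auto
    qed
    finally show ?thesis by (simp add: algebra_simps)
  qed
  obtain Phi where Phi: "\<And>x. Phi x 0 = x"
    "\<And>x t X. t \<in> {0..X} \<Longrightarrow> (Phi x has_vector_derivative f (Phi x t)) (at t within {0..X})"
    "continuous_on UNIV (\<lambda>(x, t). Phi x t)"
    using lipschitz_flow_exists[OF lip] K by auto
  show ?thesis
  proof (rule that[of "\<lambda>x t. fst (Phi x t)" "\<lambda>x t. snd (Phi x t)"])
    show "fst (Phi x 0) = fst x" "snd (Phi x 0) = snd x" for x using Phi by auto
    show "continuous_on UNIV (\<lambda>(x, t). fst (Phi x t))" "continuous_on UNIV (\<lambda>(x, t). snd (Phi x t))"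
      using Phi(3) by (auto simp: case_prod_unfold intro!: continuous_intros)
    fix t X :: real and x :: "real \<times> real" assume t: "t \<in> {0..X}"
    have "(Phi x has_derivative (\<lambda>k. k *\<^sub>R f (Phi x t))) (at t within {0..X})"
      using Phi(2)[OF t] by (simp add: has_vector_derivative_def)
    from has_derivative_fst[OF this] has_derivative_snd[OF this]
    show "((\<lambda>t. fst (Phi x t)) has_real_derivative h (snd (Phi x t))) (at t within {0..X})"
      "((\<lambda>t. snd (Phi x t)) has_real_derivative force p c (fst (Phi x t))) (at t within {0..X})"
      by (simp_all add: f_def has_field_derivative_def mult.commute[of _ "h _"] mult.commute[of _ "force _ _ _"])
  qed
qed

section \<open>Threshold levels and the first integral\<close>

locale nls =
  fixes p :: real
  assumes p_gt: "p > 6"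
begin

text \<open>Levels of \<open>w powr (p - 2)\<close>. Up to \<open>c0\<close> (where it is
  \<open>1 / (2 * p)\<close>) the force is increasing and at least \<open>w / 2\<close>; from
  \<open>b1\<close> (where it is 2) to \<open>beta\<close> the force is at most \<open>-1\<close>;
  \<open>beta\<close> (where it is \<open>p\<close>) lies beyond the soliton maximum (where it is
  \<open>p / 2\<close>), so solutions of small energy never get there.\<close>

definition "c0 = (1 / (2 * p)) powr (1 / (p - 2))"
definition "b1 = 2 powr (1 / (p - 2))"
definition "beta = p powr (1 / (p - 2))"

lemma levels_powr: "c0 powr (p - 2) = 1 / (2 * p)" "b1 powr (p - 2) = 2" "beta powr (p - 2) = p"
  using p_gt by (simp_all add: c0_def b1_def beta_def powr_powr)

lemma levels: "0 < c0" "c0 < 1" "1 < b1" "b1 < beta"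
proof -
  show "0 < c0" using p_gt by (simp add: c0_def)
  show "c0 < 1" unfolding c0_def using p_gt powr_less_mono2[of "1 / (p - 2)" "1 / (2 * p)" 1] by simp
  show "1 < b1" unfolding b1_def using p_gt by simp
  show "b1 < beta" unfolding b1_def beta_def using p_gt by (intro powr_less_mono2) auto
qed

lemma powr_p2_le_iff:
  assumes "0 \<le> x" "0 \<le> y"
  shows "x \<le> y \<longleftrightarrow> x powr (p - 2) \<le> y powr (p - 2)"
proof
  assume "x \<le> y"
  then show "x powr (p - 2) \<le> y powr (p - 2)" using assms p_gt by (intro powr_mono2) auto
next
  assume "x powr (p - 2) \<le> y powr (p - 2)"
  then show "x \<le> y" using powr_less_mono2[of "p - 2" y x] assms p_gt by (cases "y < x") auto
qed

text \<open>Minus twice the potential energy: \<open>(y')^2 - pot y\<close> is constant along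
  solutions of \<open>y'' = y - y powr (p - 1)\<close> and vanishes on the soliton.\<close>

definition "pot y = y\<^sup>2 - 2 / p * y powr p"

lemma pot_eq: "y \<ge> 0 \<Longrightarrow> pot y = y\<^sup>2 * (1 - 2 / p * y powr (p - 2))"
  unfolding pot_def by (subst powr_p_split) (auto simp: algebra_simps)

lemma pot_le: "pot y \<le> y\<^sup>2"
  using p_gt by (simp add: pot_def)

lemma pot_nonneg: "0 \<le> y \<Longrightarrow> y \<le> 1 \<Longrightarrow> 0 \<le> pot y"
  using p_gt powr_p2_le_iff[of y 1] mult_mono[of "2/p" 1 "y powr (p-2)" 1] by (auto simp: pot_eq intro!: mult_nonneg_nonneg)

text \<open>Here \<open>p > 6\<close> gives \<open>1 - 4 / p >= 1 / 3\<close>. Against an energy of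
  size at most \<open>c0^2 / 9\<close> this keeps the slope away from 0 between \<open>c0\<close>
  and \<open>b1\<close>.\<close>

lemma pot_mid: 
  assumes "c0 \<le> y" "y \<le> b1"
  shows "c0\<^sup>2 / 3 \<le> pot y"
proof -
  have y0: "y \<ge> 0" using assms levels by linarith
  have "y powr (p - 2) \<le> 2" using powr_p2_le_iff[of y b1] y0 assms levels levels_powr by auto
  then have "2 / p * y powr (p - 2) \<le> 2 / p * 2" using p_gt by (intro mult_left_mono) auto
  also have "... \<le> 2 / 3" using p_gt by (simp add: field_simps)
  finally have "1 - 2 / p * y powr (p - 2) \<ge> 1 / 3" by linarith
  then have "y\<^sup>2 * (1 - 2 / p * y powr (p - 2)) \<ge> c0\<^sup>2 * (1 / 3)"
    using assms levels by (intro mult_mono power_mono) auto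
  then show ?thesis using y0 by (simp add: pot_eq)
qed

lemma pot_beta: "pot beta = - beta\<^sup>2"
  using levels p_gt by (simp add: pot_eq levels_powr)

lemma force_beta_nonneg: "0 \<le> y \<Longrightarrow> y \<le> 1 \<Longrightarrow> 0 \<le> force p beta y"
  using levels p_gt powr_mono'[of 1 "p - 1" y] by (cases "y = 0") (auto simp: force_eq)

lemma force_beta_half:
  assumes "0 \<le> y" "y \<le> c0"
  shows "y / 2 \<le> force p beta y"
proof -
  have "y powr (p - 2) \<le> 1 / (2 * p)" using powr_p2_le_iff[of y c0] assms levels levels_powr by auto
  also have "... \<le> 1 / 2" using p_gt by (simp add: field_simps)
  finally have "y * y powr (p - 2) \<le> y * (1 / 2)" using assms by (intro mult_left_mono) auto
  then show ?thesis using assms levels by (simp add: force_eq powr_p1_split)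
qed

lemma force_beta_high:
  assumes "b1 \<le> y" "y \<le> beta"
  shows "force p beta y \<le> - 1"
proof -
  have "2 \<le> y powr (p - 2)" using powr_p2_le_iff[of b1 y] assms levels levels_powr by auto
  then have "y * y powr (p - 2) \<ge> y * 2" using assms levels by (intro mult_left_mono) auto
  moreover have "force p beta y = y - y * y powr (p - 2)"
    using assms levels by (simp add: force_eq powr_p1_split)
  ultimately show ?thesis using assms levels by linarith
qed

end

subsection \<open>The wave on the special edge\<close>

text \<open>The velocity \<open>max (Q x t) 0\<close> freezes \<open>Y\<close> once the slope is
  negative, so \<open>Y\<close> is monotone for all times. Up to the peak the slope is nonnegative
  and the equation is the true one.\<close>

locale peak_flow = nls +
  fixes Y Q :: "real \<times> real \<Rightarrow> real \<Rightarrow> real"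
  assumes init: "Y x 0 = fst x" "Q x 0 = snd x"
    and dY: "t \<in> {0..X} \<Longrightarrow> (Y x has_real_derivative max (Q x t) 0) (at t within {0..X})"
    and dQ: "t \<in> {0..X} \<Longrightarrow> (Q x has_real_derivative force p beta (Y x t)) (at t within {0..X})"
    and contY: "continuous_on UNIV (\<lambda>(x, t). Y x t)"
    and contQ: "continuous_on UNIV (\<lambda>(x, t). Q x t)"
begin

text \<open>\<open>qmax\<close> comes from \<open>Q^2 <= beta^2 + 1\<close>, and \<open>kmin\<close>
  from \<open>c0^2 / 3 - c0^2 / 9 >= c0^2 / 9\<close>. \<open>phase_time\<close> adds the time from
  \<open>c0\<close> to \<open>b1\<close> at speed \<open>kmin\<close> to the time in which a slope
  of at most \<open>qmax\<close> falls to 0 at rate 1.\<close>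

definition "qmax = beta + 1"
definition "kmin = c0 / 3"
definition "phase_time = (b1 - c0) / kmin + qmax"
definition "peak_bound = 2 * (c0 + qmax) + phase_time"

lemma const_pos: "qmax > 0" "kmin > 0" "phase_time > 0" "peak_bound > 0"
  using levels by (auto simp: qmax_def kmin_def phase_time_def peak_bound_def intro!: add_pos_pos divide_pos_pos)

text \<open>The pair is value and slope at the base vertex. The bound \<open>c0 / 3\<close> keeps
  the energy within \<open>c0^2 / 9\<close>; positivity of the sum excludes the zero solution, which
  has no peak.\<close>

definition admissible :: "real \<times> real \<Rightarrow> bool" where
  "admissible x \<longleftrightarrow> 0 \<le> fst x \<and> 0 \<le> snd x \<and> 0 < fst x + snd x \<and> fst x + snd x \<le> c0 / 3"

lemma dY': "0 \<le> u \<Longrightarrow> t \<in> {u..v} \<Longrightarrow> (Y x has_real_derivative max (Q x t) 0) (at t within {u..v})"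
  by (rule has_field_derivative_subset[OF dY[of t v x]]) auto

lemma dQ': "0 \<le> u \<Longrightarrow> t \<in> {u..v} \<Longrightarrow> (Q x has_real_derivative force p beta (Y x t)) (at t within {u..v})"
  by (rule has_field_derivative_subset[OF dQ[of t v x]]) auto

lemma contYQ: "continuous_on S (Y x)" "continuous_on S (Q x)"
  using continuous_on_compose2[OF contY, of S "\<lambda>t. (x, t)"] continuous_on_compose2[OF contQ, of S "\<lambda>t. (x, t)"]
  by (auto simp: continuous_on_Pair)

lemma Y_mono: "0 \<le> u \<Longrightarrow> u \<le> v \<Longrightarrow> Y x u \<le> Y x v"
  using derivative_lower_bound[of u v "Y x" "\<lambda>t. max (Q x t) 0" 0] dY' by auto

lemma Y_growth: "0 \<le> u \<Longrightarrow> u \<le> v \<Longrightarrow> (\<And>t. t \<in> {u..v} \<Longrightarrow> m \<le> Q x t) \<Longrightarrow> Y x u + m * (v - u) \<le> Y x v"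
  using derivative_lower_bound[of u v "Y x" "\<lambda>t. max (Q x t) 0" m] dY' by (smt (verit))

lemma Y_hits:
  assumes "0 \<le> u" "u \<le> v" "Y x u \<le> l" "l \<le> Y x v"
  obtains t where "t \<in> {u..v}" "Y x t = l"
  using IVT'[of "Y x" u l v] contYQ assms by auto

section \<open>One wave from its start to its peak\<close>

context
  fixes x :: "real \<times> real"
  assumes adm: "admissible x"
begin

definition "twice_h = (snd x)\<^sup>2 - pot (fst x)"

lemma start: "0 \<le> fst x" "fst x \<le> c0" "0 \<le> snd x" "snd x \<le> c0" "fst x + snd x \<le> 1" "0 < fst x + snd x"
  using adm levels by (auto simp: admissible_def)

lemma Y_nonneg: "0 \<le> t \<Longrightarrow> 0 \<le> Y x t"
  using Y_mono[of 0 t x] start init by simp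

lemma abs_twice_h: "\<bar>twice_h\<bar> \<le> (fst x + snd x)\<^sup>2"
proof -
  have "0 \<le> pot (fst x)" "pot (fst x) \<le> (fst x)\<^sup>2"
    using pot_nonneg[of "fst x"] pot_le start levels by auto
  moreover have "(fst x)\<^sup>2 \<le> (fst x + snd x)\<^sup>2" "(snd x)\<^sup>2 \<le> (fst x + snd x)\<^sup>2"
    using start by (auto intro: power_mono)
  ultimately show ?thesis unfolding twice_h_def by (smt (verit) zero_le_power2)
qed

lemma twice_h_small: "\<bar>twice_h\<bar> \<le> c0\<^sup>2 / 9"
proof -
  have "(fst x + snd x)\<^sup>2 \<le> (c0 / 3)\<^sup>2" using adm start by (intro power_mono) (auto simp: admissible_def)
  then show ?thesis using abs_twice_h by (simp add: power_divide)
qed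

text \<open>The bound by \<open>beta\<close> is the level at which the force is truncated;
  \<open>Y_less_beta\<close> then removes it.\<close>

lemma energy_conserved_aux:
  assumes "0 \<le> t" "Y x t \<le> beta"
  shows "(max (Q x t) 0)\<^sup>2 = pot (Y x t) + twice_h"
proof (cases "t = 0")
  case True
  then show ?thesis using start init by (simp add: twice_h_def)
next
  case False
  have der: "((\<lambda>u. (max (Q x u) 0)\<^sup>2 - pot (Y x u)) has_real_derivative 0) (at u within {0..t})" if u: "u \<in> {0..t}" for u
  proof -
    have Yu: "0 \<le> Y x u" "Y x u \<le> beta" using u Y_nonneg Y_mono[of u t x] assms by auto
    have 1: "((\<lambda>u. (max (Q x u) 0)\<^sup>2) has_real_derivative 2 * max (Q x u) 0 * force p beta (Y x u)) (at u within {0..t})"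
      using DERIV_chain[OF has_real_derivative_max_0_squared dQ[OF u]] by (simp add: o_def)
    have 2: "((\<lambda>u. Y x u powr p) has_real_derivative p * Y x u powr (p - 1) * max (Q x u) 0) (at u within {0..t})"
      by (rule has_real_derivative_powr_nonneg_chain[OF dY[OF u]]) (use u Y_nonneg p_gt in auto)
    have 3: "((\<lambda>u. (Y x u)\<^sup>2) has_real_derivative 2 * Y x u * max (Q x u) 0) (at u within {0..t})"
      using DERIV_power[OF dY[OF u], of x 2] by (simp add: mult_ac)
    show ?thesis unfolding pot_def
      by (rule DERIV_cong[OF DERIV_diff[OF 1 DERIV_diff[OF 3 DERIV_cmult[OF 2, of "2 / p"]]]])
        (use p_gt in \<open>simp add: force_eq[OF Yu] field_simps\<close>)
  qed
  have "(max (Q x t) 0)\<^sup>2 - pot (Y x t) \<le> (max (Q x 0) 0)\<^sup>2 - pot (Y x 0) + 0 * (t - 0)"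
    by (rule derivative_upper_bound[OF assms(1) der]) auto
  moreover have "(max (Q x 0) 0)\<^sup>2 - pot (Y x 0) + 0 * (t - 0) \<le> (max (Q x t) 0)\<^sup>2 - pot (Y x t)"
    by (rule derivative_lower_bound[OF assms(1) der]) auto
  ultimately show ?thesis using start init by (simp add: twice_h_def)
qed

text \<open>At the level \<open>beta\<close> the first integral would make a square equal to
  \<open>- beta\<^sup>2 + twice_h\<close>, which is negative.\<close>

lemma Y_less_beta: "0 \<le> t \<Longrightarrow> Y x t < beta"
proof (rule ccontr)
  assume t: "0 \<le> t" "\<not> Y x t < beta"
  then obtain u where u: "u \<in> {0..t}" "Y x u = beta"
    using Y_hits[of 0 t x beta] start init levels by auto
  have "0 \<le> (max (Q x u) 0)\<^sup>2" by simp
  also have "... = - beta\<^sup>2 + twice_h" using energy_conserved_aux[of u] u by (simp add: pot_beta)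
  also have "... < 0"
  proof -
    have "c0\<^sup>2 \<le> 1" "1 \<le> beta\<^sup>2" using levels by (auto simp: power_le_one)
    then show ?thesis using twice_h_small by linarith
  qed
  finally show False by simp
qed

lemma energy_conserved: "0 \<le> t \<Longrightarrow> (max (Q x t) 0)\<^sup>2 = pot (Y x t) + twice_h"
  using energy_conserved_aux Y_less_beta less_imp_le by blast

lemma Q_le: "0 \<le> t \<Longrightarrow> Q x t \<le> qmax"
proof -
  assume t: "0 \<le> t"
  have "(max (Q x t) 0)\<^sup>2 \<le> (Y x t)\<^sup>2 + twice_h" using energy_conserved[OF t] pot_le by simp
  also have "... \<le> beta\<^sup>2 + 1"
  proof -
    have "c0\<^sup>2 \<le> 1" using levels by (auto simp: power_le_one)
    moreover have "(Y x t)\<^sup>2 \<le> beta\<^sup>2" using Y_nonneg[OF t] Y_less_beta[OF t] by (intro power_mono) auto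
    ultimately show ?thesis using twice_h_small by linarith
  qed
  also have "... \<le> qmax\<^sup>2" using levels by (simp add: qmax_def power2_eq_square algebra_simps)
  finally have "max (Q x t) 0 \<le> qmax"
    by (rule power2_le_imp_le) (rule less_imp_le[OF const_pos(1)])
  then show ?thesis by simp
qed

lemma Q_low: 
  assumes "0 \<le> t" "Y x t \<le> 1"
  shows "snd x \<le> Q x t"
proof -
  have "Q x 0 + 0 * (t - 0) \<le> Q x t"
  proof (rule derivative_lower_bound[OF assms(1) dQ'])
    fix u assume "u \<in> {0..t}"
    then show "0 \<le> force p beta (Y x u)" using assms Y_mono[of u t x] Y_nonneg[of u]
      by (intro force_beta_nonneg) auto
  qed auto
  then show ?thesis using init by simp
qed

lemma Q_mid:
  assumes "0 \<le> t" "c0 \<le> Y x t" "Y x t \<le> b1"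
  shows "kmin \<le> Q x t"
proof -
  have "kmin\<^sup>2 = c0\<^sup>2 / 9" by (simp add: kmin_def power_divide)
  also have "... \<le> (max (Q x t) 0)\<^sup>2"
    using energy_conserved[OF assms(1)] pot_mid[OF assms(2,3)] twice_h_small by simp
  finally have "kmin \<le> max (Q x t) 0" by (rule power2_le_imp_le) simp
  then show ?thesis using const_pos by linarith
qed

text \<open>While \<open>Y <= c0\<close>, the derivative of \<open>Y + Q\<close> is at least
  \<open>Q + Y / 2\<close>, so \<open>Y + Q\<close> grows at least like \<open>exp (t / 2)\<close>.
  The resulting logarithmic bound is weakened to a reciprocal one, which suffices for the energy
  estimate.\<close>

lemma low_time:
  assumes "0 \<le> t" "Y x t \<le> c0"
  shows "t \<le> 2 * (c0 + qmax) / (fst x + snd x)"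
proof -
  have "exp (- 0 / 2) * (Y x 0 + Q x 0) + 0 * (t - 0) \<le> exp (- t / 2) * (Y x t + Q x t)"
  proof (rule derivative_lower_bound[OF assms(1), of "\<lambda>u. exp (- u / 2) * (Y x u + Q x u)"
      "\<lambda>u. exp (- u / 2) * (max (Q x u) 0 + force p beta (Y x u) - (Y x u + Q x u) / 2)"])
    fix u assume u: "u \<in> {0..t}"
    have e: "((\<lambda>u. exp (- u / 2)) has_real_derivative - exp (- u / 2) / 2) (at u within {0..t})"
      by (auto intro!: derivative_eq_intros)
    show "((\<lambda>u. exp (- u / 2) * (Y x u + Q x u)) has_real_derivative
        exp (- u / 2) * (max (Q x u) 0 + force p beta (Y x u) - (Y x u + Q x u) / 2)) (at u within {0..t})"
      by (rule DERIV_cong[OF DERIV_mult[OF e DERIV_add[OF dY[OF u] dQ[OF u]]]]) (simp add: algebra_simps)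
    have Yu: "0 \<le> Y x u" "Y x u \<le> c0" using u assms Y_mono[of u t x] Y_nonneg[of u] by auto
    then have "0 \<le> Q x u" using Q_low[of u] u levels start by auto
    then show "0 \<le> exp (- u / 2) * (max (Q x u) 0 + force p beta (Y x u) - (Y x u + Q x u) / 2)"
      using force_beta_half[OF Yu] by (intro mult_nonneg_nonneg) auto
  qed
  then have "exp (t / 2) * (fst x + snd x) \<le> exp (t / 2) * (exp (- t / 2) * (Y x t + Q x t))"
    using init by (intro mult_left_mono) auto
  also have "... = Y x t + Q x t" by (simp flip: mult.assoc exp_add)
  also have "... \<le> c0 + qmax" using assms Q_le by (intro add_mono) auto
  finally have 1: "exp (t / 2) * (fst x + snd x) \<le> c0 + qmax" .
  have "t / 2 \<le> exp (t / 2)" using exp_ge_add_one_self[of "t / 2"] by linarith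
  then have "t / 2 * (fst x + snd x) \<le> c0 + qmax"
    using 1 start by (smt (verit) mult_right_mono)
  then show ?thesis using start by (simp add: field_simps)
qed

text \<open>Escape from small values until \<open>tc\<close>, crossing of the middle range at speed
  at least \<open>kmin\<close> until \<open>tb\<close>, then decay of the slope until
  \<open>tp\<close>.\<close>

lemma phases:
  obtains tc tb tp where "0 \<le> tc" "tc \<le> 2 * (c0 + qmax) / (fst x + snd x)" "Y x tc = c0"
    "tc \<le> tb" "tb - tc \<le> (b1 - c0) / kmin" "Y x tb = b1"
    "tb \<le> tp" "tp - tb \<le> qmax" "Q x tp = 0"
proof -
  \<comment> \<open>The added 1 puts \<open>t1\<close> strictly past the bound of
    \<open>low_time\<close>.\<close>
  define t1 where "t1 = 2 * (c0 + qmax) / (fst x + snd x) + 1"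
  have t1: "t1 \<ge> 0" using start levels const_pos by (auto simp: t1_def intro!: add_nonneg_nonneg divide_nonneg_pos)
  have "\<not> Y x t1 \<le> c0" using low_time[OF t1] by (auto simp: t1_def)
  then obtain tc where tc: "tc \<in> {0..t1}" "Y x tc = c0"
    using Y_hits[of 0 t1 x c0] t1 start init by auto
  have tc_le: "tc \<le> 2 * (c0 + qmax) / (fst x + snd x)" using low_time[of tc] tc by auto
  define t2 where "t2 = tc + (b1 - c0) / kmin"
  have t2: "tc \<le> t2" using levels const_pos by (auto simp: t2_def)
  have "b1 \<le> Y x t2"
  proof (rule ccontr)
    assume neg: "\<not> ?thesis"
    then have "kmin \<le> Q x t" if "t \<in> {tc..t2}" for t
      using that tc Y_mono[of tc t x] Y_mono[of t t2 x] by (intro Q_mid) auto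
    from Y_growth[OF _ t2 this] tc have "c0 + kmin * (t2 - tc) \<le> Y x t2" by simp
    moreover have "kmin * (t2 - tc) = b1 - c0" using const_pos by (simp add: t2_def)
    ultimately show False using neg by linarith
  qed
  then obtain tb where tb: "tb \<in> {tc..t2}" "Y x tb = b1"
    using Y_hits[of tc t2 x b1] t2 tc levels by auto
  have tb0: "0 \<le> tb" using tb tc by auto
  have "kmin \<le> Q x tb" by (rule Q_mid) (use tb tb0 levels in auto)
  \<comment> \<open>The slope starts at most at \<open>qmax\<close> and loses at least 1 per unit of
    time, so it has a zero within time \<open>qmax\<close>.\<close>
  moreover have "Q x (tb + qmax) \<le> Q x tb + - 1 * (tb + qmax - tb)"
  proof (rule derivative_upper_bound[OF _ dQ'])
    fix u assume u: "u \<in> {tb..tb + qmax}"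
    then have "0 \<le> u" "b1 \<le> Y x u" using tb0 tb Y_mono[of tb u x] by auto
    then show "force p beta (Y x u) \<le> - 1" using Y_less_beta[of u] by (intro force_beta_high) auto
  qed (use tb0 const_pos in auto)
  ultimately obtain tp where tp: "tb \<le> tp" "tp \<le> tb + qmax" "Q x tp = 0"
    using IVT2'[of "Q x" "tb + qmax" 0 tb] contYQ const_pos Q_le[OF tb0] by auto
  show ?thesis
    by (rule that[of tc tb tp]) (use tc tc_le tb tp t2_def in auto)
qed

text \<open>The condition \<open>b1 \<le> Y x t\<close> discards the zero of the slope at time 0
  that occurs when \<open>snd x = 0\<close>.\<close>

definition "peak = (THE t. 0 \<le> t \<and> b1 \<le> Y x t \<and> Q x t = 0)"

lemma Q_decay:
  assumes "0 \<le> u" "u \<le> v" "b1 \<le> Y x u"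
  shows "Q x v \<le> Q x u - (v - u)"
proof -
  have "Q x v \<le> Q x u + - 1 * (v - u)"
  proof (rule derivative_upper_bound[OF assms(2) dQ'])
    fix t assume t: "t \<in> {u..v}"
    then have "0 \<le> t" "b1 \<le> Y x t" using assms Y_mono[of u t x] by auto
    then show "force p beta (Y x t) \<le> - 1" using Y_less_beta[of t] by (intro force_beta_high) auto
  qed (use assms in auto)
  then show ?thesis by simp
qed

lemma peak_unique:
  assumes "0 \<le> u" "b1 \<le> Y x u" "Q x u = 0" "0 \<le> v" "b1 \<le> Y x v" "Q x v = 0"
  shows "u = v"
  using Q_decay[of u v] Q_decay[of v u] assms by (cases u v rule: linorder_cases) auto

lemma peak: "0 \<le> peak" "b1 \<le> Y x peak" "Q x peak = 0"
proof -
  obtain tc tb tp where "0 \<le> tc" "tc \<le> tb" "tb \<le> tp" "Y x tb = b1" "Q x tp = 0"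
    using phases by metis
  then have tp: "0 \<le> tp \<and> b1 \<le> Y x tp \<and> Q x tp = 0" using Y_mono[of tb tp x] by auto
  then have "0 \<le> peak \<and> b1 \<le> Y x peak \<and> Q x peak = 0"
    unfolding peak_def by (rule theI) (use peak_unique[of _ tp] tp in blast)
  then show "0 \<le> peak" "b1 \<le> Y x peak" "Q x peak = 0" by auto
qed

lemma peak_eqI: "0 \<le> t \<Longrightarrow> b1 \<le> Y x t \<Longrightarrow> Q x t = 0 \<Longrightarrow> t = peak"
  using peak_unique peak by blast

text \<open>The lower bound on \<open>tb - tc\<close>, from the speed limit \<open>qmax\<close>,
  guarantees a fixed time above \<open>c0\<close> and hence the lower bounds on mass and
  power.\<close>

lemma peak_phases:
  obtains tc tb where "0 \<le> tc" "tc \<le> 2 * (c0 + qmax) / (fst x + snd x)" "Y x tc = c0"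
    "tc \<le> tb" "Y x tb = b1" "tb \<le> peak" "peak - tc \<le> phase_time" "(b1 - c0) / qmax \<le> tb - tc"
proof -
  obtain tc tb tp where *: "0 \<le> tc" "tc \<le> 2 * (c0 + qmax) / (fst x + snd x)" "Y x tc = c0"
    "tc \<le> tb" "tb - tc \<le> (b1 - c0) / kmin" "Y x tb = b1"
    "tb \<le> tp" "tp - tb \<le> qmax" "Q x tp = 0" using phases by metis
  have "tp = peak" using * Y_mono[of tb tp x] by (intro peak_eqI) auto
  moreover have "Y x tb \<le> Y x tc + qmax * (tb - tc)"
  proof (rule derivative_upper_bound[OF _ dY'])
    fix t assume "t \<in> {tc..tb}"
    then show "max (Q x t) 0 \<le> qmax" using Q_le[of t] const_pos * by auto
  qed (use * in auto)
  then have "(b1 - c0) / qmax \<le> tb - tc" using * const_pos by (simp add: field_simps)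
  ultimately show ?thesis using * by (intro that[of tc tb]) (auto simp: phase_time_def)
qed

lemma peak_le: "peak \<le> peak_bound / (fst x + snd x)"
proof -
  obtain tc tb where *: "tc \<le> 2 * (c0 + qmax) / (fst x + snd x)" "peak - tc \<le> phase_time"
    using peak_phases by metis
  have "phase_time \<le> phase_time / (fst x + snd x)"
    using const_pos start by (simp add: le_divide_eq mult_left_le)
  then show ?thesis using * by (simp add: peak_bound_def add_divide_distrib)
qed

text \<open>The ranges up to 1, from \<open>c0\<close> to \<open>b1\<close>, and above
  \<open>b1\<close> cover everything; in the last the slope decreases towards its zero at the peak.
  So the \<open>max\<close> in the velocity is invisible up to the peak.\<close>

lemma Q_nonneg:
  assumes "0 \<le> t" "t \<le> peak"
  shows "0 \<le> Q x t"
proof (cases "b1 \<le> Y x t")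
  case True
  then show ?thesis using Q_decay[OF assms] peak assms by auto
next
  case False
  then show ?thesis
    using Q_low[OF assms(1)] Q_mid[OF assms(1)] start const_pos levels
    by (cases "Y x t \<le> 1") auto
qed

text \<open>Counterpart of \<open>low_time\<close>: the force is at most \<open>Y\<close>, so
  \<open>Y + Q\<close> grows at most like \<open>exp t\<close>, yet it exceeds 1 at the peak. A
  small start peaks late, which makes the dilation large.\<close>

lemma peak_ge: "1 \<le> (fst x + snd x) * exp peak"
proof -
  have "exp (- peak) * (Y x peak + Q x peak) \<le> exp (- 0) * (Y x 0 + Q x 0) + 0 * (peak - 0)"
  proof (rule derivative_upper_bound[OF peak(1), of "\<lambda>u. exp (- u) * (Y x u + Q x u)"
      "\<lambda>u. exp (- u) * (max (Q x u) 0 + force p beta (Y x u) - (Y x u + Q x u))"])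
    fix u assume u: "u \<in> {0..peak}"
    have e: "((\<lambda>u. exp (- u)) has_real_derivative - exp (- u)) (at u within {0..peak})"
      by (auto intro!: derivative_eq_intros)
    show "((\<lambda>u. exp (- u) * (Y x u + Q x u)) has_real_derivative
        exp (- u) * (max (Q x u) 0 + force p beta (Y x u) - (Y x u + Q x u))) (at u within {0..peak})"
      by (rule DERIV_cong[OF DERIV_mult[OF e DERIV_add[OF dY[OF u] dQ[OF u]]]]) (simp add: algebra_simps)
    have "0 \<le> Q x u" "force p beta (Y x u) \<le> Y x u"
      using Q_nonneg u force_le Y_nonneg[of u] levels by auto
    then show "exp (- u) * (max (Q x u) 0 + force p beta (Y x u) - (Y x u + Q x u)) \<le> 0"
      by (intro mult_nonneg_nonpos) auto
  qed
  then have "exp peak * (exp (- peak) * Y x peak) \<le> exp peak * (fst x + snd x)"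
    using peak init by (intro mult_left_mono) auto
  moreover have "exp peak * (exp (- peak) * Y x peak) = Y x peak" by (simp flip: mult.assoc exp_add)
  ultimately show ?thesis using peak levels by (simp add: mult.commute)
qed

end

end

subsection \<open>Mass and energy of the wave\<close>

lemma integral_unit_scale:
  fixes f :: "real \<Rightarrow> real"
  assumes "T \<ge> 0" "f integrable_on {0..T}"
  shows "integral {0..T} f = T * integral {0..1} (\<lambda>sg. f (T * sg))"
proof (cases "T = 0")
  case False
  have "(f has_integral integral {0..T} f) {0..T}" using assms by (rule_tac integrable_integral)
  from has_integral_stretch_real[OF this False]
  have "((\<lambda>sg. f (T * sg)) has_integral (1 / T) *\<^sub>R integral {0..T} f) {0..1}"
    using False assms by (simp add: image_divide_atLeastAtMost)
  from integral_unique[OF this] show ?thesis using False assms by simp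
qed simp

text \<open>Stretching to the unit interval moves the variable bound into the integrand.\<close>

lemma continuous_on_integral_variable_bound:
  fixes F :: "'b::topological_space \<Rightarrow> real \<Rightarrow> real" and T :: "'a::topological_space \<Rightarrow> real"
  assumes F: "continuous_on UNIV (\<lambda>(z, t). F z t)" and "continuous_on S g" "continuous_on S T"
    and nonneg: "\<And>x. x \<in> S \<Longrightarrow> 0 \<le> T x"
  shows "continuous_on S (\<lambda>x. integral {0..T x} (F (g x)))"
proof -
  have int: "F z integrable_on {a..b}" for z a b
    using continuous_on_compose2[OF F, of "{a..b}" "\<lambda>t. (z, t)"]
    by (intro integrable_continuous_real) (auto simp: continuous_on_Pair)
  have "continuous_on (S \<times> cbox 0 1) (\<lambda>w. (g (fst w), T (fst w) * snd w))"
    using assms(2,3)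
    by (auto intro!: continuous_on_Pair continuous_on_mult continuous_on_compose2[of S g] continuous_on_compose2[of S T]
        continuous_on_fst continuous_on_snd continuous_on_id)
  from continuous_on_compose2[OF F this]
  have "continuous_on (S \<times> cbox 0 1) (\<lambda>(x, sg). F (g x) (T x * sg))" by (simp add: case_prod_unfold)
  from integral_continuous_on_param[OF this]
  have "continuous_on S (\<lambda>x. T x * integral {0..1} (\<lambda>sg. F (g x) (T x * sg)))"
    using assms(3) by (auto intro: continuous_intros)
  then show ?thesis
    by (rule continuous_on_eq) (use integral_unit_scale[OF nonneg int] in auto)
qed

lemma integral_ge_on_subinterval:
  fixes f :: "real \<Rightarrow> real"
  assumes cont: "continuous_on {0..T} f" and nonneg: "\<And>t. t \<in> {0..T} \<Longrightarrow> 0 \<le> f t"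
    and ab: "0 \<le> a" "a \<le> b" "b \<le> T" and m: "\<And>t. t \<in> {a..b} \<Longrightarrow> m \<le> f t"
  shows "m * (b - a) \<le> integral {0..T} f"
proof -
  have "m * (b - a) = integral {a..b} (\<lambda>_. m)" using ab by simp
  also have "... \<le> integral {a..b} f"
    using ab m by (intro integral_le integrable_continuous_real continuous_on_subset[OF cont]) auto
  also have "... \<le> integral {0..T} f"
    using ab nonneg by (intro integral_subset_le integrable_continuous_real continuous_on_subset[OF cont]) auto
  finally show ?thesis .
qed

context peak_flow
begin

definition "wave_mass x = integral {0..peak x} (\<lambda>t. (Y x t)\<^sup>2)"
definition "wave_power x = integral {0..peak x} (\<lambda>t. Y x t powr p)"
text \<open>\<open>(b1 - c0) / qmax\<close> is the least time from the level \<open>c0\<close> to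
  the level \<open>b1\<close>. The two summands of \<open>mass_high\<close> bound the mass below and
  above the level \<open>c0\<close>.\<close>

definition "mass_low = c0\<^sup>2 * ((b1 - c0) / qmax)"
definition "power_low = c0 powr p * ((b1 - c0) / qmax)"
definition "mass_high = 2 * qmax + beta\<^sup>2 * phase_time"

lemma mass_consts_pos: "mass_low > 0" "power_low > 0" "mass_high > 0"
  using levels const_pos by (auto simp: mass_low_def power_low_def mass_high_def intro!: mult_pos_pos add_pos_pos divide_pos_pos)

lemma cont_squares: "continuous_on S (\<lambda>t. (Y x t)\<^sup>2)" "continuous_on S (\<lambda>t. (Q x t)\<^sup>2)"
  by (rule continuous_on_power[OF contYQ(1)], rule continuous_on_power[OF contYQ(2)])

lemma cont_powr:
  assumes "admissible x"
  shows "continuous_on {0..t} (\<lambda>t. Y x t powr p)"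
  by (rule continuous_on_powr'[OF contYQ(1) continuous_on_const]) (use Y_nonneg[OF assms] p_gt in auto)

lemma wave_mass_ge:
  assumes "admissible x"
  shows "mass_low \<le> wave_mass x"
proof -
  obtain tc tb where *: "0 \<le> tc" "Y x tc = c0" "tc \<le> tb" "tb \<le> peak x" "(b1 - c0) / qmax \<le> tb - tc"
    using peak_phases[OF assms] by metis
  have "mass_low \<le> c0\<^sup>2 * (tb - tc)" unfolding mass_low_def using * by (intro mult_left_mono) auto
  also have "... \<le> wave_mass x" unfolding wave_mass_def
  proof (rule integral_ge_on_subinterval)
    show "c0\<^sup>2 \<le> (Y x t)\<^sup>2" if "t \<in> {tc..tb}" for t
      using that * Y_mono[of tc t x] levels by (intro power_mono) auto
  qed (use * cont_squares cont_powr[OF assms] in auto)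
  finally show ?thesis .
qed

lemma wave_power_ge:
  assumes "admissible x"
  shows "power_low \<le> wave_power x"
proof -
  obtain tc tb where *: "0 \<le> tc" "Y x tc = c0" "tc \<le> tb" "tb \<le> peak x" "(b1 - c0) / qmax \<le> tb - tc"
    using peak_phases[OF assms] by metis
  have "power_low \<le> c0 powr p * (tb - tc)" unfolding power_low_def using * by (intro mult_left_mono) auto
  also have "... \<le> wave_power x" unfolding wave_power_def
  proof (rule integral_ge_on_subinterval)
    show "c0 powr p \<le> Y x t powr p" if "t \<in> {tc..tb}" for t
      using that * Y_mono[of tc t x] levels p_gt by (intro powr_mono2) auto
  qed (use * cont_squares cont_powr[OF assms] in auto)
  finally show ?thesis .
qed

text \<open>The time spent below \<open>c0\<close> is unbounded as the start tends to 0. There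
  \<open>Y^2\<close> is at most \<open>2 * c0\<close> times the force, which is the derivative of
  \<open>Q\<close>, so this part of the mass is controlled by the gain in slope.\<close>

lemma wave_mass_le:
  assumes adm: "admissible x"
  shows "wave_mass x \<le> mass_high"
proof -
  obtain tc tb where *: "0 \<le> tc" "Y x tc = c0" "tc \<le> tb" "tb \<le> peak x" "peak x - tc \<le> phase_time"
    using peak_phases[OF adm] by metis
  have int: "(\<lambda>t. (Y x t)\<^sup>2) integrable_on {a..b}" for a b
    by (intro integrable_continuous_real cont_squares)
  have "integral {0..tc} (\<lambda>t. (Y x t)\<^sup>2) \<le> integral {0..tc} (\<lambda>t. 2 * c0 * force p beta (Y x t))"
  proof (rule integral_le[OF int])
    show "(\<lambda>t. 2 * c0 * force p beta (Y x t)) integrable_on {0..tc}"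
      using p_gt levels by (intro integrable_continuous_real continuous_on_mult continuous_on_const continuous_force contYQ) auto
    fix t assume t: "t \<in> {0..tc}"
    then have Yt: "0 \<le> Y x t" "Y x t \<le> c0" using Y_nonneg[OF adm] Y_mono[of t tc x] * by auto
    have "(Y x t)\<^sup>2 \<le> c0 * Y x t" unfolding power2_eq_square using Yt by (intro mult_right_mono) auto
    also have "... \<le> 2 * c0 * force p beta (Y x t)"
      using force_beta_half[OF Yt] levels by auto
    finally show "(Y x t)\<^sup>2 \<le> 2 * c0 * force p beta (Y x t)" .
  qed
  also have "((\<lambda>t. 2 * c0 * force p beta (Y x t)) has_integral 2 * c0 * Q x tc - 2 * c0 * Q x 0) {0..tc}"
    by (rule fundamental_theorem_of_calculus[OF *(1)])
      (auto intro!: DERIV_cmult dQ simp flip: has_real_derivative_iff_has_vector_derivative)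
  hence "integral {0..tc} (\<lambda>t. 2 * c0 * force p beta (Y x t)) = 2 * c0 * Q x tc - 2 * c0 * Q x 0"
    by (rule integral_unique)
  also have "... \<le> 2 * 1 * qmax"
  proof -
    have "2 * c0 * Q x tc \<le> 2 * c0 * qmax" using Q_le[OF adm *(1)] levels by (intro mult_left_mono) auto
    also have "... \<le> 2 * 1 * qmax" using levels const_pos by (intro mult_right_mono) auto
    finally show ?thesis using start[OF adm] init levels by (simp add: mult_nonneg_nonneg add_increasing2 diff_le_eq)
  qed
  finally have 1: "integral {0..tc} (\<lambda>t. (Y x t)\<^sup>2) \<le> 2 * qmax" by simp
  have "integral {tc..peak x} (\<lambda>t. (Y x t)\<^sup>2) \<le> integral {tc..peak x} (\<lambda>t. beta\<^sup>2)"
  proof (rule integral_le[OF int])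
    fix t assume t: "t \<in> {tc..peak x}"
    then show "(Y x t)\<^sup>2 \<le> beta\<^sup>2"
      using Y_less_beta[OF adm, of t] Y_nonneg[OF adm, of t] * by (intro power_mono) auto
  qed (rule integrable_const_ivl)
  also have "... = beta\<^sup>2 * (peak x - tc)" using * by simp
  also have "... \<le> beta\<^sup>2 * phase_time" using * by (intro mult_left_mono) auto
  finally have 2: "integral {tc..peak x} (\<lambda>t. (Y x t)\<^sup>2) \<le> beta\<^sup>2 * phase_time" .
  have "wave_mass x = integral {0..tc} (\<lambda>t. (Y x t)\<^sup>2) + integral {tc..peak x} (\<lambda>t. (Y x t)\<^sup>2)"
    unfolding wave_mass_def using * int by (intro Henstock_Kurzweil_Integration.integral_combine[symmetric]) auto
  then show ?thesis using 1 2 by (simp add: mass_high_def)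
qed

text \<open>Three integrals combined with weights \<open>1 / 4\<close>, \<open>1 / 4\<close> and
  \<open>(p - 6) / (4 * p)\<close>: the derivative of \<open>Y * Q\<close>, the constant first
  integral, and the power. The third weight is where \<open>p > 6\<close> decides the sign of the
  energy.\<close>

lemma wave_energy:
  assumes adm: "admissible x"
  shows "1 / 2 * integral {0..peak x} (\<lambda>t. (Q x t)\<^sup>2) - 1 / p * wave_power x =
    - (fst x * snd x) / 4 + twice_h x * peak x / 4 + (p - 6) / (4 * p) * wave_power x"
proof -
  let ?I = "{0..peak x}"
  have "((\<lambda>t. (Q x t)\<^sup>2 + Y x t * force p beta (Y x t)) has_integral Y x (peak x) * Q x (peak x) - Y x 0 * Q x 0) ?I"
  proof (rule fundamental_theorem_of_calculus[OF peak(1)[OF adm]])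
    fix t assume t: "t \<in> ?I"
    have "(Y x has_real_derivative Q x t) (at t within ?I)"
      using dY[OF t, of x] Q_nonneg[OF adm] t by (simp add: max_absorb1)
    from DERIV_mult[OF this dQ[OF t]]
    show "((\<lambda>t. Y x t * Q x t) has_vector_derivative (Q x t)\<^sup>2 + Y x t * force p beta (Y x t)) (at t within ?I)"
      by (simp add: has_real_derivative_iff_has_vector_derivative[symmetric] power2_eq_square mult_ac add_ac)
  qed
  then have A: "((\<lambda>t. (Q x t)\<^sup>2 + Y x t * force p beta (Y x t)) has_integral - (fst x * snd x)) ?I"
    using peak[OF adm] init by simp
  have B: "((\<lambda>t. twice_h x) has_integral twice_h x * peak x) ?I"
    using has_integral_const_real[of "twice_h x" 0 "peak x"] peak(1)[OF adm] by (simp add: mult.commute)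
  have C: "((\<lambda>t. Y x t powr p) has_integral wave_power x) ?I"
    unfolding wave_power_def by (intro integrable_integral integrable_continuous_real cont_powr adm)
  have D: "((\<lambda>t. (Q x t)\<^sup>2) has_integral integral ?I (\<lambda>t. (Q x t)\<^sup>2)) ?I"
    by (intro integrable_integral integrable_continuous_real cont_squares)
  have "((\<lambda>t. 1 / 4 * ((Q x t)\<^sup>2 + Y x t * force p beta (Y x t)) + 1 / 4 * twice_h x + (p - 6) / (4 * p) * Y x t powr p)
     has_integral 1 / 4 * - (fst x * snd x) + 1 / 4 * (twice_h x * peak x) + (p - 6) / (4 * p) * wave_power x) ?I"
    by (intro has_integral_add has_integral_mult_right A B C)
  moreover have "1 / 4 * ((Q x t)\<^sup>2 + Y x t * force p beta (Y x t)) + 1 / 4 * twice_h x + (p - 6) / (4 * p) * Y x t powr p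
     = 1 / 2 * (Q x t)\<^sup>2 - 1 / p * Y x t powr p" if t: "t \<in> ?I" for t
  proof -
    have Yt: "0 \<le> Y x t" "Y x t \<le> beta" using Y_nonneg[OF adm] Y_less_beta[OF adm, of t] t by auto
    have h: "twice_h x = (Q x t)\<^sup>2 - pot (Y x t)"
      using energy_conserved[OF adm, of t] Q_nonneg[OF adm, of t] t by (simp add: max_absorb1)
    have yf: "Y x t * force p beta (Y x t) = (Y x t)\<^sup>2 - Y x t powr p"
      using Yt by (simp add: force_eq right_diff_distrib powr_mult_base power2_eq_square)
    show ?thesis unfolding h yf pot_def using p_gt by (simp add: field_simps)
  qed
  ultimately have "((\<lambda>t. 1 / 2 * (Q x t)\<^sup>2 - 1 / p * Y x t powr p) has_integral
     1 / 4 * - (fst x * snd x) + 1 / 4 * (twice_h x * peak x) + (p - 6) / (4 * p) * wave_power x) ?I"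
    by (rule has_integral_eq[rotated]) auto
  moreover have "((\<lambda>t. 1 / 2 * (Q x t)\<^sup>2 - 1 / p * Y x t powr p) has_integral
     1 / 2 * integral ?I (\<lambda>t. (Q x t)\<^sup>2) - 1 / p * wave_power x) ?I"
    by (intro has_integral_diff has_integral_mult_right C D)
  ultimately show ?thesis by (auto dest: has_integral_unique)
qed

text \<open>The term \<open>twice_h x * peak x\<close> is of first order in the size of the start:
  \<open>abs_twice_h\<close> is quadratic and \<open>peak_le\<close> reciprocal.\<close>

lemma wave_energy_ge:
  assumes adm: "admissible x"
  shows "(p - 6) / (4 * p) * power_low - (1 + peak_bound) * (fst x + snd x) / 4
    \<le> 1 / 2 * integral {0..peak x} (\<lambda>t. (Q x t)\<^sup>2) - 1 / p * wave_power x"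
proof -
  let ?e = "fst x + snd x"
  have "fst x * snd x \<le> ?e * 1" using start[OF adm] levels by (intro mult_mono) auto
  moreover have "- twice_h x * peak x \<le> ?e\<^sup>2 * (peak_bound / ?e)"
    using abs_twice_h[OF adm] peak_le[OF adm] peak(1)[OF adm] by (intro mult_mono) auto
  moreover have "?e\<^sup>2 * (peak_bound / ?e) = peak_bound * ?e" using start[OF adm] by (simp add: power2_eq_square)
  moreover have "(p - 6) / (4 * p) * power_low \<le> (p - 6) / (4 * p) * wave_power x"
    using wave_power_ge[OF adm] p_gt by (intro mult_left_mono) auto
  moreover have "- twice_h x * peak x = - (twice_h x * peak x)"
    "(1 + peak_bound) * ?e / 4 = ?e / 4 + peak_bound * ?e / 4"
    by (simp_all add: algebra_simps add_divide_distrib)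
  ultimately show ?thesis unfolding wave_energy[OF adm] by linarith
qed

text \<open>For starts of size at least \<open>eps1\<close> the peak time is bounded, and it is the
  unique solution of closed conditions.\<close>

lemma continuous_on_peak:
  assumes "eps1 > 0"
  shows "continuous_on {x. admissible x \<and> eps1 \<le> fst x + snd x} peak"
proof (rule continuous_on_unique_solution)
  let ?X = "{x. admissible x \<and> eps1 \<le> fst x + snd x}"
  have Xeq: "?X = {x. 0 \<le> fst x \<and> 0 \<le> snd x \<and> eps1 \<le> fst x + snd x \<and> fst x + snd x \<le> c0 / 3}"
    using assms by (auto simp: admissible_def)
  show clX: "closed ?X" unfolding Xeq
    by (intro closed_Collect_conj closed_Collect_le continuous_intros)
  have "closed ((?X \<times> {0..peak_bound / eps1}) \<inter> ({z. b1 \<le> (\<lambda>(x, t). Y x t) z} \<inter> {z. (\<lambda>(x, t). Q x t) z = 0}))"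
    by (intro closed_Int closed_Times clX closed_Collect_le closed_Collect_eq contY contQ continuous_intros)
  also have "(?X \<times> {0..peak_bound / eps1}) \<inter> ({z. b1 \<le> (\<lambda>(x, t). Y x t) z} \<inter> {z. (\<lambda>(x, t). Q x t) z = 0})
     = {(x, t). x \<in> ?X \<and> t \<in> {0..peak_bound / eps1} \<and> (b1 \<le> Y x t \<and> Q x t = 0)}"
    by auto
  finally show "closed {(x, t). x \<in> ?X \<and> t \<in> {0..peak_bound / eps1} \<and> (b1 \<le> Y x t \<and> Q x t = 0)}" .
  fix x assume x: "x \<in> ?X"
  then have adm: "admissible x" by simp
  have "peak x \<le> peak_bound / (fst x + snd x)" by (rule peak_le[OF adm])
  also have "... \<le> peak_bound / eps1" using x assms const_pos by (intro divide_left_mono) auto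
  finally show "peak x \<in> {0..peak_bound / eps1} \<and> b1 \<le> Y x (peak x) \<and> Q x (peak x) = 0"
    using peak[OF adm] by auto
  show "t = peak x" if "t \<in> {0..peak_bound / eps1}" "b1 \<le> Y x t \<and> Q x t = 0" for t
    using peak_eqI[OF adm, of t] that by auto
qed

lemma continuous_on_wave_mass:
  assumes "eps1 > 0"
  shows "continuous_on {x. admissible x \<and> eps1 \<le> fst x + snd x} wave_mass"
  unfolding wave_mass_def
proof (rule continuous_on_integral_variable_bound[where g = "\<lambda>x. x" and F = "\<lambda>x t. (Y x t)\<^sup>2"])
  show "continuous_on UNIV (\<lambda>(x, t). (Y x t)\<^sup>2)"
    using contY by (auto simp: case_prod_unfold intro!: continuous_intros)
qed (use continuous_on_peak[OF assms] peak in auto)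

end

theorem (in nls) peak_flow_exists: "\<exists>Y Q. peak_flow p Y Q"
proof -
  have "2 \<le> p" "0 \<le> beta" "\<And>x y :: real. \<bar>max x 0 - max y 0\<bar> \<le> \<bar>x - y\<bar>"
    using p_gt levels by auto
  from force_flow_exists[where h = "\<lambda>x. max x 0", OF this] show ?thesis
    unfolding peak_flow_def peak_flow_axioms_def using nls_axioms by (metis (no_types, lifting))
qed

subsection \<open>Small solutions on bounded edges\<close>

locale edge_flow = nls +
  fixes U V :: "real \<times> real \<Rightarrow> real \<Rightarrow> real"
  assumes init: "U x 0 = fst x" "V x 0 = snd x"
    and dU: "t \<in> {0..X} \<Longrightarrow> (U x has_real_derivative V x t) (at t within {0..X})"
    and dV: "t \<in> {0..X} \<Longrightarrow> (V x has_real_derivative force p c0 (U x t)) (at t within {0..X})"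
    and contU: "continuous_on UNIV (\<lambda>(x, t). U x t)"
    and contV: "continuous_on UNIV (\<lambda>(x, t). V x t)"

context nls
begin

text \<open>\<open>(p - 1) * c0 powr (p - 2)\<close> is less than 1, so the power grows more slowly
  than the linear term. A monotone force is what makes the Dirichlet problem uniquely
  solvable.\<close>

lemma force_c0_mono: "x \<le> y \<Longrightarrow> force p c0 x \<le> force p c0 y"
proof -
  assume "x \<le> y"
  define u where "u = max 0 (min x c0)"
  define v where "v = max 0 (min y c0)"
  have uv: "0 \<le> u" "u \<le> v" "v \<le> c0" using \<open>x \<le> y\<close> levels by (auto simp: u_def v_def)
  have "v powr (p - 1) - u powr (p - 1) \<le> (p - 1) * c0 powr (p - 2) * (v - u)"
    using powr_diff_le[of u v c0 "p - 1"] uv p_gt by simp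
  also have "... \<le> 1 * (v - u)"
    unfolding levels_powr(1) using uv p_gt by (intro mult_right_mono) (auto simp: field_simps)
  finally show ?thesis
    unfolding force_def Let_def u_def[symmetric] v_def[symmetric] by simp
qed

lemma force_c0_neg: "x \<le> 0 \<Longrightarrow> force p c0 x = 0"
  using levels by (simp add: force_def)

lemma force_c0_nonneg: "0 \<le> force p c0 x"
  using force_c0_mono[of 0 x] force_c0_mono[of x 0] force_c0_neg[of x] force_c0_neg[of 0] by (cases "0 \<le> x") auto

lemma force_c0_le: "force p c0 x \<le> c0"
proof -
  have "max 0 (min x c0) \<le> c0" using levels by auto
  then show ?thesis
    unfolding force_def Let_def using powr_ge_zero[of "max 0 (min x c0)" "p - 1"] by linarith
qed

lemma force_c0_half: "0 \<le> y \<Longrightarrow> y \<le> c0 \<Longrightarrow> y / 2 \<le> force p c0 y"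
  using force_beta_half[of y] levels by (simp add: force_eq)

end

section \<open>Comparison of solutions and points of rest\<close>

context edge_flow
begin

lemma dU': "0 \<le> u \<Longrightarrow> t \<in> {u..v} \<Longrightarrow> (U x has_real_derivative V x t) (at t within {u..v})"
  by (rule has_field_derivative_subset[OF dU[of t v x]]) auto

lemma dV': "0 \<le> u \<Longrightarrow> t \<in> {u..v} \<Longrightarrow> (V x has_real_derivative force p c0 (U x t)) (at t within {u..v})"
  by (rule has_field_derivative_subset[OF dV[of t v x]]) auto

lemma contUV: "continuous_on S (U x)" "continuous_on S (V x)"
  using continuous_on_compose2[OF contU, of S "\<lambda>t. (x, t)"] continuous_on_compose2[OF contV, of S "\<lambda>t. (x, t)"]
  by (auto simp: continuous_on_Pair)

lemma V_mono: "0 \<le> u \<Longrightarrow> u \<le> v \<Longrightarrow> V x u \<le> V x v"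
  using derivative_lower_bound[OF _ dV', of u v 0 x] force_c0_nonneg by auto

lemma V_upper: "0 \<le> u \<Longrightarrow> u \<le> v \<Longrightarrow> V x v \<le> V x u + c0 * (v - u)"
  using derivative_upper_bound[OF _ dV', of u v x c0] force_c0_le by auto

lemma U_lower: "0 \<le> u \<Longrightarrow> u \<le> v \<Longrightarrow> U x u + V x u * (v - u) \<le> U x v"
  using derivative_lower_bound[OF _ dU', of u v "V x u" x] V_mono by auto

lemma U_upper: "0 \<le> u \<Longrightarrow> u \<le> v \<Longrightarrow> U x v \<le> U x u + V x v * (v - u)"
  using derivative_upper_bound[OF _ dU', of u v x "V x v"] V_mono by auto

text \<open>Since the force is nondecreasing, the squared difference of two solutions is convex
  along the flow: a solution started strictly above in slope stays above.\<close>

lemma flow_compare: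
  assumes "U x 0 \<le> U x' 0" "V x 0 < V x' 0" "0 \<le> t"
  shows "U x t + (V x' 0 - V x 0) * t \<le> U x' t"
proof -
  define z where "z t = U x' t - U x t" for t
  define z1 where "z1 t = V x' t - V x t" for t
  define g where "g t = force p c0 (U x' t) - force p c0 (U x t)" for t
  have dz: "(z has_real_derivative z1 t) (at t within {u..v})" if "0 \<le> u" "t \<in> {u..v}" for u v t
    unfolding z_def z1_def by (intro DERIV_diff dU' that)
  have dz1: "(z1 has_real_derivative g t) (at t within {u..v})" if "0 \<le> u" "t \<in> {u..v}" for u v t
    unfolding z1_def g_def by (intro DERIV_diff dV' that)
  have gz: "0 \<le> z t * g t" for t
    unfolding z_def g_def using force_c0_mono[of "U x t" "U x' t"] force_c0_mono[of "U x' t" "U x t"]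
    by (cases "U x t \<le> U x' t") (auto intro: mult_nonneg_nonneg mult_nonpos_nonpos)
  have zz1: "0 \<le> z t * z1 t" if "0 \<le> t" for t
  proof -
    have "z 0 * z1 0 + 0 * (t - 0) \<le> z t * z1 t"
    proof (rule derivative_lower_bound[OF that])
      fix s assume s: "s \<in> {0..t}"
      show "((\<lambda>t. z t * z1 t) has_real_derivative z1 s * z1 s + g s * z s) (at s within {0..t})"
        by (rule DERIV_mult[OF dz[OF order.refl s] dz1[OF order.refl s]])
      show "0 \<le> z1 s * z1 s + g s * z s" using gz[of s] by (simp add: mult.commute)
    qed
    moreover have "0 \<le> z 0 * z1 0" using assms by (simp add: z_def z1_def)
    ultimately show ?thesis by simp
  qed
  have zsq: "(z u)\<^sup>2 \<le> (z v)\<^sup>2" if "0 \<le> u" "u \<le> v" for u v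
  proof -
    have "(z u)\<^sup>2 + 0 * (v - u) \<le> (z v)\<^sup>2"
    proof (rule derivative_lower_bound[OF that(2)])
      fix s assume s: "s \<in> {u..v}"
      show "((\<lambda>t. (z t)\<^sup>2) has_real_derivative 2 * (z s * z1 s)) (at s within {u..v})"
        using DERIV_power[OF dz[OF that(1) s], of 2] by (simp add: mult_ac)
      show "0 \<le> 2 * (z s * z1 s)" using zz1[of s] s that by auto
    qed
    then show ?thesis by simp
  qed
  have z_nonneg: "0 \<le> z t" if t: "0 \<le> t" for t
  proof (rule ccontr)
    assume neg: "\<not> 0 \<le> z t"
    have z0: "0 \<le> z 0" "0 < z1 0" using assms by (auto simp: z_def z1_def)
    then have t_pos: "0 < t" using neg t by (cases "t = 0") auto
    \<comment> \<open>Right after 0 the difference \<open>z\<close> is positive, and since its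
      square is nondecreasing it cannot come back to 0.\<close>
    obtain d where d: "d > 0" "\<And>h. 0 < h \<Longrightarrow> 0 + h \<in> {0..t} \<Longrightarrow> h < d \<Longrightarrow> z 0 < z (0 + h)"
      using has_real_derivative_pos_inc_right[OF dz[OF order.refl, of 0 t] z0(2)] t_pos by auto
    define h where "h = min (d / 2) t"
    have h: "0 < h" "h \<le> t" "h < d" using d(1) t_pos by (auto simp: h_def min_def)
    then have zh: "0 < z h" using d(2)[of h] z0 by auto
    have "continuous_on {h..t} z" unfolding z_def by (intro continuous_on_diff contUV)
    then obtain s where s: "h \<le> s" "s \<le> t" "z s = 0"
      using IVT2'[of z t 0 h] neg h zh by auto
    have "(z h)\<^sup>2 \<le> (z s)\<^sup>2" using zsq[of h s] h s by simp
    then show False using s zh by simp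
  qed
  have z1_lower: "z1 0 \<le> z1 t" if t: "0 \<le> t" for t
  proof -
    have "z1 0 + 0 * (t - 0) \<le> z1 t"
    proof (rule derivative_lower_bound[OF t dz1])
      fix s assume s: "s \<in> {0..t}"
      then show "0 \<le> g s" unfolding g_def using force_c0_mono z_nonneg[of s] by (auto simp: z_def)
    qed auto
    then show ?thesis by simp
  qed
  have "z 0 + z1 0 * (t - 0) \<le> z t"
    by (rule derivative_lower_bound[OF assms(3) dz]) (use z1_lower in auto)
  then show ?thesis using assms by (simp add: z_def z1_def algebra_simps)
qed

text \<open>Uniqueness at a point of rest with vanishing force: the increment of \<open>U\<close>
  and the slope \<open>V\<close> stay nonnegative, while their sum times \<open>exp (- t)\<close>
  does not increase and starts at 0.\<close>

lemma rest_point: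
  assumes "0 \<le> u" "u \<le> v" "U x u \<le> 0" "V x u = 0"
  shows "U x v = U x u"
proof -
  have ge: "U x u \<le> U x t" "0 \<le> V x t" if "t \<in> {u..v}" for t
    using that U_lower[of u t x] V_mono[of u t x] assms by auto
  have "exp (- v) * (U x v - U x u + V x v) \<le> exp (- u) * (U x u - U x u + V x u) + 0 * (v - u)"
  proof (rule derivative_upper_bound[OF assms(2), of "\<lambda>t. exp (- t) * (U x t - U x u + V x t)"
      "\<lambda>t. exp (- t) * (V x t + force p c0 (U x t) - (U x t - U x u + V x t))"])
    fix t assume t: "t \<in> {u..v}"
    have e: "((\<lambda>u. exp (- u)) has_real_derivative - exp (- t)) (at t within {u..v})"
      by (auto intro!: derivative_eq_intros)
    show "((\<lambda>t. exp (- t) * (U x t - U x u + V x t)) has_real_derivative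
       exp (- t) * (V x t + force p c0 (U x t) - (U x t - U x u + V x t))) (at t within {u..v})"
      by (rule DERIV_cong[OF DERIV_mult[OF e DERIV_add[OF DERIV_diff[OF dU'[OF assms(1) t] DERIV_const] dV'[OF assms(1) t]]]])
         (simp add: algebra_simps)
    have "force p c0 (U x t) \<le> U x t - U x u"
      using force_le[of "U x t" c0 p] force_c0_neg[of "U x t"] ge[OF t] assms levels by (cases "0 \<le> U x t") auto
    then show "exp (- t) * (V x t + force p c0 (U x t) - (U x t - U x u + V x t)) \<le> 0"
      by (intro mult_nonneg_nonpos) auto
  qed
  then have "U x v - U x u + V x v \<le> 0"
    using assms by (simp add: mult_le_0_iff)
  then show ?thesis using ge[of v] assms by auto
qed

text \<open>The same idea backwards in time: \<open>exp t * (U - V)\<close> is nondecreasing and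
  ends at 0, so \<open>U <= V <= 0\<close> at the start.\<close>

lemma backward_rest_point:
  assumes "0 \<le> v" "U x v = 0" "V x v = 0" "\<And>t. t \<in> {0..v} \<Longrightarrow> 0 \<le> U x t"
  shows "U x 0 = 0"
proof -
  have "exp 0 * (U x 0 - V x 0) + 0 * (v - 0) \<le> exp v * (U x v - V x v)"
  proof (rule derivative_lower_bound[OF assms(1), of "\<lambda>t. exp t * (U x t - V x t)"
      "\<lambda>t. exp t * (V x t - force p c0 (U x t) + (U x t - V x t))"])
    fix t assume t: "t \<in> {0..v}"
    have e: "(exp has_real_derivative exp t) (at t within {0..v})"
      by (auto intro!: derivative_eq_intros)
    show "((\<lambda>t. exp t * (U x t - V x t)) has_real_derivative
       exp t * (V x t - force p c0 (U x t) + (U x t - V x t))) (at t within {0..v})"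
      by (rule DERIV_cong[OF DERIV_mult[OF e DERIV_diff[OF dU[OF t] dV[OF t]]]])
         (simp add: algebra_simps)
    show "0 \<le> exp t * (V x t - force p c0 (U x t) + (U x t - V x t))"
      using force_le[of "U x t" c0 p] assms(4)[OF t] levels by (intro mult_nonneg_nonneg) auto
  qed
  moreover have "V x 0 \<le> 0" using V_mono[of 0 v x] assms by simp
  ultimately show ?thesis using assms(2,3) assms(4)[of 0] assms(1) by simp
qed

section \<open>The small Dirichlet problem, solved by shooting\<close>

definition box :: "real \<times> real \<times> real \<Rightarrow> bool" where
  "box w \<longleftrightarrow> (case w of (a, b, l) \<Rightarrow> 0 \<le> a \<and> a \<le> c0 \<and> 0 \<le> b \<and> b \<le> c0 \<and> 1 \<le> l)"

lemma slope_unique: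
  assumes "U (a, d) l = U (a, d') l" "0 < l"
  shows "d = d'"
proof -
  have "U (a, d) l < U (a, d') l" if "d < d'" for d d'
  proof -
    have "U (a, d) l + (d' - d) * l \<le> U (a, d') l"
      using flow_compare[of "(a, d)" "(a, d')" l] that assms by (simp add: init)
    moreover have "0 < (d' - d) * l" using that assms by simp
    ultimately show ?thesis by linarith
  qed
  then show ?thesis using assms by (metis linorder_less_linear less_irrefl)
qed

lemma slope_exists:
  assumes "box (a, b, l)"
  shows "\<exists>d. U (a, d) l = b"
proof -
  have w: "0 \<le> a" "a \<le> c0" "0 \<le> b" "b \<le> c0" "1 \<le> l" using assms by (auto simp: box_def)
  \<comment> \<open>The slope grows by at most \<open>c0 * l\<close>, so from \<open>-K\<close> it
    stays at most \<open>-c0\<close> and \<open>U\<close> ends at most at \<open>a - c0 * l\<close>,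
    hence below 0. From the slope \<open>c0\<close> the end value is at least
    \<open>c0\<close>.\<close>
  define K where "K = c0 * l + c0"
  have "U (a, - K) l \<le> 0"
  proof -
    have "V (a, - K) l \<le> - c0" using V_upper[of 0 l "(a, -K)"] w by (simp add: init K_def)
    then have "V (a, - K) l * l \<le> - c0 * l" using w by (intro mult_right_mono) auto
    moreover have "c0 * 1 \<le> c0 * l" using w levels by (intro mult_left_mono) auto
    ultimately show ?thesis using U_upper[of 0 l "(a, -K)"] w by (simp add: init)
  qed
  moreover have "b \<le> U (a, c0) l"
  proof -
    have "c0 * 1 \<le> c0 * l" using w levels by (intro mult_left_mono) auto
    then show ?thesis using U_lower[of 0 l "(a, c0)"] w by (simp add: init)
  qed
  moreover have "continuous_on {-K..c0} (\<lambda>d. U (a, d) l)"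
    using continuous_on_compose2[OF contU, of "{-K..c0}" "\<lambda>d. ((a, d), l)"] by (auto simp: continuous_on_Pair)
  moreover have "- K \<le> c0"
  proof -
    have "0 \<le> c0 * l" using w levels by (intro mult_nonneg_nonneg) auto
    then show ?thesis using levels by (simp add: K_def)
  qed
  ultimately show ?thesis
    using IVT'[of "\<lambda>d. U (a, d) l" "-K" b c0] w by auto
qed

definition "slope w = (case w of (a, b, l) \<Rightarrow> THE d. U (a, d) l = b)"

lemma slope: "box (a, b, l) \<Longrightarrow> U (a, slope (a, b, l)) l = b"
  unfolding slope_def prod.case
proof (rule theI')
  assume "box (a, b, l)"
  then show "\<exists>!d. U (a, d) l = b"
    using slope_exists[of a b l] slope_unique[of a _ l] by (auto simp: box_def)
qed

lemma slope_eqI: "box (a, b, l) \<Longrightarrow> U (a, d) l = b \<Longrightarrow> d = slope (a, b, l)"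
  using slope[of a b l] by (intro slope_unique[of a d l]) (auto simp: box_def)

context
  fixes a b l :: real
  assumes box: "box (a, b, l)"
begin

definition "x0 = (a, slope (a, b, l))"

lemma box_bounds: "0 \<le> a" "a \<le> c0" "0 \<le> b" "b \<le> c0" "1 \<le> l"
  using box by (auto simp: box_def)

lemma ends: "U x0 0 = a" "U x0 l = b" "V x0 0 = slope (a, b, l)"
  using slope[OF box] by (auto simp: x0_def init)

text \<open>A nonpositive interior minimum is a point of rest, so the solution stays constant up to
  its end value \<open>b\<close>. Both nonnegativity and strict positivity follow from this.\<close>

lemma interior_min:
  assumes tm: "tm \<in> {0<..<l}" "\<And>t. t \<in> {0..l} \<Longrightarrow> U x0 tm \<le> U x0 t" and "U x0 tm \<le> 0"
  shows "U x0 tm = b"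
proof -
  have "(U x0 has_real_derivative V x0 tm) (at tm)"
    using dU[of tm l x0] tm(1) at_within_Icc_at[of 0 tm l] by auto
  moreover have "0 < min tm (l - tm)" using tm(1) by auto
  moreover have "\<forall>y. \<bar>tm - y\<bar> < min tm (l - tm) \<longrightarrow> U x0 tm \<le> U x0 y"
    by (intro allI impI tm(2)) (auto simp: abs_less_iff)
  ultimately have "V x0 tm = 0" by (rule DERIV_local_min)
  then show ?thesis using rest_point[of tm l x0] tm(1) assms(3) ends by simp
qed

lemma U_min:
  obtains tm where "tm \<in> {0..l}" "\<And>t. t \<in> {0..l} \<Longrightarrow> U x0 tm \<le> U x0 t"
  using continuous_attains_inf[of "{0..l}" "U x0"] contUV box_bounds by auto

lemma U_nonneg: 
  assumes "t \<in> {0..l}"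
  shows "0 \<le> U x0 t"
proof -
  obtain tm where tm: "tm \<in> {0..l}" "\<And>t. t \<in> {0..l} \<Longrightarrow> U x0 tm \<le> U x0 t"
    using U_min by blast
  have "0 \<le> U x0 tm"
  proof (rule ccontr)
    assume neg: "\<not> 0 \<le> U x0 tm"
    then have "tm \<noteq> 0" "tm \<noteq> l" using ends box_bounds by auto
    then have "tm \<in> {0<..<l}" using tm(1) by auto
    from interior_min[OF this tm(2)] show False using neg box_bounds by simp
  qed
  then show ?thesis using tm(2)[OF assms] by simp
qed

lemma U_pos: 
  assumes "t \<in> {0..l}" "0 < a" "0 < b"
  shows "0 < U x0 t"
proof -
  obtain tm where tm: "tm \<in> {0..l}" "\<And>t. t \<in> {0..l} \<Longrightarrow> U x0 tm \<le> U x0 t"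
    using U_min by blast
  have "0 < U x0 tm"
  proof (rule ccontr)
    assume neg: "\<not> 0 < U x0 tm"
    then have "tm \<noteq> 0" "tm \<noteq> l" using ends assms by auto
    then have "tm \<in> {0<..<l}" using tm(1) by auto
    from interior_min[OF this tm(2)] show False using neg assms by simp
  qed
  then show ?thesis using tm(2)[OF assms(1)] by simp
qed

text \<open>\<open>U\<close> is convex because the force is nonnegative.\<close>

lemma U_le_max:
  assumes "t \<in> {0..l}"
  shows "U x0 t \<le> max a b"
proof (rule ccontr)
  assume neg: "\<not> ?thesis"
  then have "t \<noteq> 0" using ends by auto
  have "0 < V x0 t"
  proof (rule ccontr)
    assume "\<not> 0 < V x0 t"
    then have "V x0 t * (t - 0) \<le> 0" using assms by (auto intro: mult_nonpos_nonneg)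
    then show False using U_upper[of 0 t x0] assms neg ends by simp
  qed
  then have "0 \<le> V x0 t * (l - t)" using assms by (intro mult_nonneg_nonneg) auto
  then show False using U_lower[of t l x0] assms neg ends by simp
qed

lemma U_le: "t \<in> {0..l} \<Longrightarrow> U x0 t \<le> c0" "t \<in> {0..l} \<Longrightarrow> U x0 t \<le> 1"
  using U_le_max[of t] box_bounds levels by auto

text \<open>Independent of \<open>l\<close>: an initial slope below \<open>- 2 * c0\<close> would
  take \<open>U\<close> below 0 within one unit of length, and \<open>box\<close> provides that
  unit. The bounded range is what \<open>continuous_on_slope\<close> relies on.\<close>

lemma slope_bounds: "slope (a, b, l) \<in> {- 2 * c0..c0}"
proof -
  have "V x0 1 \<le> slope (a, b, l) + c0" using V_upper[of 0 1 x0] by (simp add: ends)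
  then have "0 \<le> a + (slope (a, b, l) + c0)"
    using U_upper[of 0 1 x0] U_nonneg[of 1] box_bounds ends by simp
  moreover have "slope (a, b, l) \<le> c0"
  proof (cases "0 \<le> slope (a, b, l)")
    case True
    then have "slope (a, b, l) * 1 \<le> slope (a, b, l) * l" using box_bounds by (intro mult_left_mono) auto
    then show ?thesis using U_lower[of 0 l x0] box_bounds ends by simp
  qed (use levels in auto)
  ultimately show ?thesis using box_bounds by auto
qed

lemma end_slope_le: "V x0 l \<le> 2 * c0"
proof -
  have "V x0 l \<le> V x0 (l - 1) + c0" using V_upper[of "l - 1" l x0] box_bounds by simp
  moreover have "U x0 (l - 1) + V x0 (l - 1) \<le> U x0 l" using U_lower[of "l - 1" l x0] box_bounds by simp
  ultimately show ?thesis using U_nonneg[of "l - 1"] box_bounds ends by simp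
qed

text \<open>From here to \<open>end_slope_zero\<close> the slopes get their signs, at an end with
  the larger value by convexity, at an end with value 0 because it is a minimum.
  \<open>slope_zero\<close> and \<open>end_slope_zero\<close> are the rigid cases, by uniqueness at
  a point of rest.\<close>

lemma slope_nonpos: "b \<le> a \<Longrightarrow> slope (a, b, l) \<le> 0"
proof (rule ccontr)
  assume *: "b \<le> a" "\<not> slope (a, b, l) \<le> 0"
  then have "0 < slope (a, b, l) * l" using box_bounds by simp
  moreover have "a + slope (a, b, l) * l \<le> b" using U_lower[of 0 l x0] box_bounds ends by simp
  ultimately show False using * by linarith
qed

lemma slope_nonneg: "a = 0 \<Longrightarrow> 0 \<le> slope (a, b, l)"
proof (rule ccontr)
  assume *: "a = 0" "\<not> 0 \<le> slope (a, b, l)"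
  then obtain d where d: "d > 0" "\<And>h. 0 < h \<Longrightarrow> 0 + h \<in> {0..l} \<Longrightarrow> h < d \<Longrightarrow> U x0 (0 + h) < U x0 0"
    using has_real_derivative_neg_dec_right[OF dU[of 0 l x0]] box_bounds ends by auto
  define h where "h = min (d / 2) l"
  have h: "0 < h" "h \<le> l" "h < d" using d(1) box_bounds by (auto simp: h_def min_def)
  then show False using d(2)[of h] U_nonneg[of h] ends * by auto
qed

lemma slope_zero: "a = 0 \<Longrightarrow> slope (a, b, l) = 0 \<Longrightarrow> b = 0"
  using rest_point[of 0 l x0] box_bounds ends by simp

lemma end_slope_nonneg: "a \<le> b \<Longrightarrow> 0 \<le> V x0 l"
proof (rule ccontr)
  assume *: "a \<le> b" "\<not> 0 \<le> V x0 l"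
  then have "V x0 l * l < 0" using box_bounds by (simp add: mult_neg_pos)
  then show False using U_upper[of 0 l x0] box_bounds ends * by simp
qed

lemma end_slope_nonpos: "b = 0 \<Longrightarrow> V x0 l \<le> 0"
proof (rule ccontr)
  assume *: "b = 0" "\<not> V x0 l \<le> 0"
  then obtain d where d: "d > 0" "\<And>h. 0 < h \<Longrightarrow> l - h \<in> {0..l} \<Longrightarrow> h < d \<Longrightarrow> U x0 (l - h) < U x0 l"
    using has_real_derivative_pos_inc_left[OF dU[of l l x0]] box_bounds by auto
  define h where "h = min (d / 2) l"
  have h: "0 < h" "h \<le> l" "h < d" using d(1) box_bounds by (auto simp: h_def min_def)
  then show False using d(2)[of h] U_nonneg[of "l - h"] ends * by auto
qed

lemma end_slope_zero: "b = 0 \<Longrightarrow> V x0 l = 0 \<Longrightarrow> a = 0"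
  using backward_rest_point[of l x0] box_bounds ends U_nonneg by simp

lemma integrable_edge:
  "(\<lambda>t. (U x0 t)\<^sup>2) integrable_on {0..l}" "(\<lambda>t. (V x0 t)\<^sup>2) integrable_on {0..l}"
  "(\<lambda>t. U x0 t powr p) integrable_on {0..l}"
proof -
  show "(\<lambda>t. (U x0 t)\<^sup>2) integrable_on {0..l}" "(\<lambda>t. (V x0 t)\<^sup>2) integrable_on {0..l}"
    by (rule integrable_continuous_real[OF continuous_on_power[OF contUV(1)]],
        rule integrable_continuous_real[OF continuous_on_power[OF contUV(2)]])
  show "(\<lambda>t. U x0 t powr p) integrable_on {0..l}"
    by (rule integrable_continuous_real, rule continuous_on_powr'[OF contUV(1) continuous_on_const])
       (use U_nonneg p_gt in auto)
qed

text \<open>\<open>U^2\<close> is at most \<open>2 * max a b\<close> times the derivative of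
  \<open>V\<close>, and the end slopes differ by at most \<open>4 * c0\<close>. The bound does not
  see the length \<open>l\<close>.\<close>

lemma edge_mass_le:
  "integral {0..l} (\<lambda>t. (U x0 t)\<^sup>2) \<le> 8 * max a b"
proof -
  let ?m = "max a b"
  have m: "0 \<le> ?m" using box_bounds by auto
  have "integral {0..l} (\<lambda>t. (U x0 t)\<^sup>2) \<le> integral {0..l} (\<lambda>t. 2 * ?m * force p c0 (U x0 t))"
  proof (rule integral_le[OF integrable_edge(1)])
    show "(\<lambda>t. 2 * ?m * force p c0 (U x0 t)) integrable_on {0..l}"
      using p_gt levels by (intro integrable_continuous_real continuous_on_mult continuous_on_const continuous_force contUV) auto
    fix t assume t: "t \<in> {0..l}"
    have "(U x0 t)\<^sup>2 \<le> ?m * U x0 t"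
      unfolding power2_eq_square using U_le_max[OF t] U_nonneg[OF t] by (intro mult_right_mono) auto
    also have "... \<le> ?m * (2 * force p c0 (U x0 t))"
      using force_c0_half[OF U_nonneg[OF t] U_le(1)[OF t]] m by (intro mult_left_mono) auto
    finally show "(U x0 t)\<^sup>2 \<le> 2 * ?m * force p c0 (U x0 t)" by (simp add: mult_ac)
  qed
  also have "((\<lambda>t. 2 * ?m * force p c0 (U x0 t)) has_integral 2 * ?m * V x0 l - 2 * ?m * V x0 0) {0..l}"
    by (rule fundamental_theorem_of_calculus)
      (use box_bounds in \<open>auto intro!: DERIV_cmult dV simp flip: has_real_derivative_iff_has_vector_derivative\<close>)
  hence "integral {0..l} (\<lambda>t. 2 * ?m * force p c0 (U x0 t)) = 2 * ?m * (V x0 l - V x0 0)"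
    by (simp only: integral_unique right_diff_distrib)
  also have "... \<le> 2 * ?m * 4"
    using end_slope_le slope_bounds ends levels m by (intro mult_left_mono) auto
  finally show ?thesis by simp
qed

lemma edge_power_le:
  "integral {0..l} (\<lambda>t. U x0 t powr p) \<le> 8 * max a b"
proof -
  have "integral {0..l} (\<lambda>t. U x0 t powr p) \<le> integral {0..l} (\<lambda>t. (U x0 t)\<^sup>2)"
  proof (rule integral_le[OF integrable_edge(3,1)])
    fix t assume t: "t \<in> {0..l}"
    have "U x0 t powr p \<le> U x0 t powr 2"
      using U_nonneg[OF t] U_le(2)[OF t] p_gt by (intro powr_mono') auto
    then show "U x0 t powr p \<le> (U x0 t)\<^sup>2" using U_nonneg[OF t] by (simp add: powr_numeral)
  qed
  then show ?thesis using edge_mass_le by linarith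
qed

end

lemma closed_box: "closed {w. box w}"
proof -
  have "{w. box w} = {w. 0 \<le> fst w \<and> fst w \<le> c0 \<and> 0 \<le> fst (snd w) \<and> fst (snd w) \<le> c0 \<and> 1 \<le> snd (snd w)}"
    by (auto simp: box_def)
  then show ?thesis by (simp only:) (intro closed_Collect_conj closed_Collect_le continuous_intros)
qed

lemma continuous_on_slope: "continuous_on {w. box w} slope"
proof (rule continuous_on_unique_solution[where R = "\<lambda>w d. U (fst w, d) (snd (snd w)) = fst (snd w)"])
  show "closed {w. box w}" by (rule closed_box)
  have "continuous_on UNIV (\<lambda>z :: (real \<times> real \<times> real) \<times> real. U (fst (fst z), snd z) (snd (snd (fst z))))"
  proof -
    have "continuous_on UNIV (\<lambda>z :: (real \<times> real \<times> real) \<times> real. ((fst (fst z), snd z), snd (snd (fst z))))"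
      by (intro continuous_intros)
    from continuous_on_compose2[OF contU this] show ?thesis by simp
  qed
  then have "closed (({w. box w} \<times> {-2 * c0..c0}) \<inter> {z. U (fst (fst z), snd z) (snd (snd (fst z))) = fst (snd (fst z))})"
    by (intro closed_Int closed_Times closed_box closed_Collect_eq continuous_intros closed_atLeastAtMost)
  also have "({w. box w} \<times> {-2 * c0..c0}) \<inter> {z. U (fst (fst z), snd z) (snd (snd (fst z))) = fst (snd (fst z))} =
    {(w, d). w \<in> {w. box w} \<and> d \<in> {-2 * c0..c0} \<and> U (fst w, d) (snd (snd w)) = fst (snd w)}" by auto
  finally show "closed {(w, d). w \<in> {w. box w} \<and> d \<in> {-2 * c0..c0} \<and> U (fst w, d) (snd (snd w)) = fst (snd w)}" .
  show "slope w \<in> {-2 * c0..c0} \<and> U (fst w, slope w) (snd (snd w)) = fst (snd w)" if "w \<in> {w. box w}" for w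
    using that slope slope_bounds by (cases w) auto
  show "d = slope w" if "w \<in> {w. box w}" "U (fst w, d) (snd (snd w)) = fst (snd w)" for w d
    using that slope_eqI by (cases w) auto
qed

definition "end_slope w = (case w of (a, b, l) \<Rightarrow> V (a, slope w) l)"
definition "edge_mass w = (case w of (a, b, l) \<Rightarrow> integral {0..l} (\<lambda>t. (U (a, slope w) t)\<^sup>2))"

lemma continuous_on_end_slope: "continuous_on {w. box w} end_slope"
proof -
  have "continuous_on {w. box w} (\<lambda>w. ((fst w, slope w), snd (snd w)))"
    by (intro continuous_intros continuous_on_slope)
  from continuous_on_compose2[OF contV this] show ?thesis
    by (simp add: end_slope_def[abs_def] case_prod_unfold)
qed

lemma continuous_on_edge_mass: "continuous_on {w. box w} edge_mass"
proof -
  have "continuous_on {w. box w} (\<lambda>w. integral {0..snd (snd w)} (\<lambda>t. (U (fst w, slope w) t)\<^sup>2))"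
  proof (rule continuous_on_integral_variable_bound[where g = "\<lambda>w. (fst w, slope w)" and F = "\<lambda>x t. (U x t)\<^sup>2"])
    show "continuous_on UNIV (\<lambda>(x, t). (U x t)\<^sup>2)"
      using contU by (auto simp: case_prod_unfold intro!: continuous_intros)
    show "continuous_on {w. box w} (\<lambda>w. (fst w, slope w))" by (intro continuous_intros continuous_on_slope)
    show "continuous_on {w. box w} (\<lambda>w. snd (snd w))" by (intro continuous_intros)
  qed (auto simp: box_def)
  then show ?thesis by (simp add: edge_mass_def[abs_def] case_prod_unfold)
qed

end

theorem (in nls) edge_flow_exists: "\<exists>U V. edge_flow p U V"
proof -
  have "2 \<le> p" "0 \<le> c0" "\<And>x y :: real. \<bar>x - y\<bar> \<le> \<bar>x - y\<bar>"
    using p_gt levels by auto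
  from force_flow_exists[where h = "\<lambda>x. x", OF this] show ?thesis
    unfolding edge_flow_def edge_flow_axioms_def using nls_axioms by (metis (no_types, lifting))
qed

subsection \<open>The soliton tail on half-lines\<close>

context nls
begin

text \<open>The homoclinic solution, a power of sech, parametrised by its boundary value \<^term>\<open>a\<close>.\<close>

definition "cosine a = sqrt (1 - 2 / p * a powr (p - 2))"
text \<open>For \<open>a > 0\<close>, let \<open>t0\<close> be the distance from the centre at which
  the soliton has the value \<open>a\<close>. Then \<open>ratio a\<close> is
  \<open>exp (- (p - 2) * t0)\<close>, and \<open>cosine a\<close> is
  \<open>tanh ((p - 2) * t0 / 2)\<close>, minus the logarithmic derivative of the soliton
  there.\<close>

definition "ratio a = (1 - cosine a) / (1 + cosine a)"
definition "tail a t = a * exp (- t) *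
  ((1 + ratio a) / (1 + ratio a * exp (- (p - 2) * t))) powr (2 / (p - 2))"
definition "tail1 a t = - tail a t * ((1 - ratio a * exp (- (p - 2) * t)) / (1 + ratio a * exp (- (p - 2) * t)))"

context
  fixes a :: real
  assumes a: "0 \<le> a" "a \<le> c0"
begin

lemma cosine: "0 < cosine a" "cosine a \<le> 1" "(cosine a)\<^sup>2 = 1 - 2 / p * a powr (p - 2)"
proof -
  have "a powr (p - 2) \<le> 1 / (2 * p)" using powr_p2_le_iff[of a c0] a levels levels_powr by auto
  also have "... < p / 2"
  proof -
    have "1 * 1 < p * p" using p_gt by (intro mult_strict_mono) auto
    then show ?thesis using p_gt by (simp add: field_simps)
  qed
  finally have "2 / p * a powr (p - 2) < 1" using p_gt by (simp add: field_simps)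
  then show "0 < cosine a" "cosine a \<le> 1" "(cosine a)\<^sup>2 = 1 - 2 / p * a powr (p - 2)"
    using p_gt by (auto simp: cosine_def)
qed

lemma ratio: "0 \<le> ratio a" "ratio a \<le> 1"
  using cosine by (auto simp: ratio_def)

text \<open>Eliminates the power of \<open>a\<close>: \<open>tail a t powr (p - 2)\<close> becomes
  rational in \<open>Z t\<close>, and the equation a rational identity.\<close>

lemma ratio_powr: "a powr (p - 2) * (1 + ratio a)\<^sup>2 = 2 * p * ratio a"
proof -
  have "a powr (p - 2) = p / 2 * (1 - (cosine a)\<^sup>2)" using cosine(3) p_gt by (simp add: field_simps)
  moreover have "1 + ratio a = 2 / (1 + cosine a)" using cosine by (simp add: ratio_def field_simps)
  moreover have "p / 2 * (1 - c\<^sup>2) * (2 / (1 + c))\<^sup>2 = 2 * p * ((1 - c) / (1 + c))" if "0 < c" for c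
  proof -
    have "1 - c\<^sup>2 = (1 - c) * (1 + c)" by (simp add: power2_eq_square algebra_simps)
    then show ?thesis using that by (simp add: power2_eq_square divide_simps)
  qed
  ultimately show ?thesis using cosine(1) unfolding ratio_def by metis
qed

lemma tail_0: "tail a 0 = a" "tail1 a 0 = - a * cosine a"
proof -
  show 1: "tail a 0 = a" using ratio by (simp add: tail_def)
  have "(1 - ratio a) / (1 + ratio a) = cosine a"
    using cosine(1) by (simp add: ratio_def divide_simps)
  then show "tail1 a 0 = - a * cosine a" using 1 by (simp add: tail1_def)
qed

abbreviation "Z t \<equiv> ratio a * exp (- (p - 2) * t)"

lemma Z: "0 \<le> Z t" "0 \<le> t \<Longrightarrow> Z t \<le> 1" "0 < 1 + Z t"
proof -
  show 1: "0 \<le> Z t" using ratio by simp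
  then show "0 < 1 + Z t" by linarith
  show "Z t \<le> 1" if "0 \<le> t"
  proof -
    have "exp (- (p - 2) * t) \<le> 1" using that p_gt by (simp add: mult_le_0_iff)
    then have "ratio a * exp (- (p - 2) * t) \<le> 1 * 1" using ratio by (intro mult_mono) auto
    then show ?thesis by simp
  qed
qed

lemma dZ: "((\<lambda>t. Z t) has_real_derivative - (p - 2) * Z t) (at t within S)"
  by (auto intro!: derivative_eq_intros)

lemma tail_has_derivative: "(tail a has_real_derivative tail1 a t) (at t within S)"
proof -
  let ?B = "(1 + ratio a) / (1 + Z t)"
  have B: "0 < ?B" using Z ratio by (auto intro!: divide_pos_pos add_pos_nonneg)
  have dB: "((\<lambda>t. (1 + ratio a) / (1 + Z t)) has_real_derivative ?B * ((p - 2) * Z t / (1 + Z t))) (at t)"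
    by (rule DERIV_cong[OF DERIV_divide[OF DERIV_const DERIV_add[OF DERIV_const dZ]]])
       (use Z(3)[of t] in \<open>auto simp: field_simps power2_eq_square\<close>)
  have dP: "((\<lambda>t. ((1 + ratio a) / (1 + Z t)) powr (2 / (p - 2))) has_real_derivative
     2 / (p - 2) * ?B powr (2 / (p - 2) - 1) * (?B * ((p - 2) * Z t / (1 + Z t)))) (at t)"
    using DERIV_chain[OF has_real_derivative_powr[OF B, of "2 / (p - 2)"] dB] by (simp add: o_def)
  have eq: "2 / (p - 2) * ?B powr (2 / (p - 2) - 1) * (?B * ((p - 2) * Z t / (1 + Z t)))
     = ?B powr (2 / (p - 2)) * (2 * Z t / (1 + Z t))"
  proof -
    have "?B powr (2 / (p - 2) - 1) * ?B = ?B powr (2 / (p - 2))"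
      using powr_mult_base[of ?B "2 / (p - 2) - 1"] B by (simp add: mult.commute)
    moreover have "2 / q * x * (y * (q * z / w)) = r * (2 * z / w)" if "x * y = r" "q \<noteq> 0" for q r x y z w :: real
      using that(2) unfolding that(1)[symmetric] by simp
    moreover have "p - 2 \<noteq> 0" using p_gt by simp
    ultimately show ?thesis by blast
  qed
  have dE: "((\<lambda>t. a * exp (- t)) has_real_derivative - (a * exp (- t))) (at t)"
    by (auto intro!: derivative_eq_intros)
  have "(tail a has_real_derivative
     (- (a * exp (- t))) * ?B powr (2 / (p - 2)) + ?B powr (2 / (p - 2)) * (2 * Z t / (1 + Z t)) * (a * exp (- t))) (at t)"
    unfolding tail_def[abs_def] using DERIV_mult[OF dE dP[unfolded eq]] .
  also have "(- (a * exp (- t))) * ?B powr (2 / (p - 2)) + ?B powr (2 / (p - 2)) * (2 * Z t / (1 + Z t)) * (a * exp (- t))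
     = - (a * exp (- t) * ?B powr (2 / (p - 2))) * (1 - 2 * Z t / (1 + Z t))"
    by (simp add: algebra_simps)
  also have "1 - 2 * Z t / (1 + Z t) = (1 - Z t) / (1 + Z t)"
    using Z(3)[of t] by (simp add: field_simps)
  finally show ?thesis unfolding tail1_def tail_def[of a t] by (rule has_field_derivative_at_within)
qed

lemma tail_nonneg: "0 \<le> tail a t"
  using a by (simp add: tail_def)

lemma tail_pos: "0 < a \<Longrightarrow> 0 < tail a t"
  using Z(3)[of t] ratio by (auto simp: tail_def intro!: mult_pos_pos)

lemma tail_powr: "tail a t powr (p - 1) = tail a t * (2 * p * Z t / (1 + Z t)\<^sup>2)"
proof -
  have B: "0 \<le> (1 + ratio a) / (1 + Z t)" using Z(3)[of t] ratio by auto
  have "tail a t powr (p - 2) = a powr (p - 2) * exp (- t) powr (p - 2) * (((1 + ratio a) / (1 + Z t)) powr (2 / (p - 2))) powr (p - 2)"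
    using a unfolding tail_def by (simp add: powr_mult)
  also have "(((1 + ratio a) / (1 + Z t)) powr (2 / (p - 2))) powr (p - 2) = ((1 + ratio a) / (1 + Z t))\<^sup>2"
  proof -
    have "2 / q * q = 2" if "q \<noteq> 0" for q :: real using that by simp
    moreover have "p - 2 \<noteq> 0" using p_gt by simp
    ultimately have "2 / (p - 2) * (p - 2) = 2" by blast
    then show ?thesis using B by (simp only: powr_powr) (simp add: powr_numeral)
  qed
  also have "exp (- t) powr (p - 2) = exp (- (p - 2) * t)" by (simp add: powr_def algebra_simps)
  also have "a powr (p - 2) * exp (- (p - 2) * t) * ((1 + ratio a) / (1 + Z t))\<^sup>2
     = (a powr (p - 2) * (1 + ratio a)\<^sup>2) * exp (- (p - 2) * t) / (1 + Z t)\<^sup>2"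
    by (simp add: power_divide mult_ac)
  also have "... = 2 * p * Z t / (1 + Z t)\<^sup>2" unfolding ratio_powr by (simp add: mult_ac)
  finally show ?thesis using powr_p1_split[OF tail_nonneg, of t p] by simp
qed

lemma tail1_has_derivative: "(tail1 a has_real_derivative tail a t - tail a t powr (p - 1)) (at t within S)"
proof -
  let ?q = "\<lambda>t. (1 - Z t) / (1 + Z t)"
  have dq: "(?q has_real_derivative 2 * (p - 2) * Z t / (1 + Z t)\<^sup>2) (at t)"
    by (rule DERIV_cong[OF DERIV_divide[OF DERIV_diff[OF DERIV_const dZ] DERIV_add[OF DERIV_const dZ]]])
       (use Z(3)[of t] in \<open>auto simp: field_simps power2_eq_square\<close>)
  have "(tail1 a has_real_derivative - tail1 a t * ?q t + 2 * (p - 2) * Z t / (1 + Z t)\<^sup>2 * - tail a t) (at t)"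
    unfolding tail1_def[abs_def] using DERIV_mult[OF DERIV_minus[OF tail_has_derivative] dq] by (simp add: tail1_def)
  also have "- tail1 a t * ?q t + 2 * (p - 2) * Z t / (1 + Z t)\<^sup>2 * - tail a t
     = tail a t * ((1 - Z t)\<^sup>2 / (1 + Z t)\<^sup>2 - 2 * (p - 2) * Z t / (1 + Z t)\<^sup>2)"
  proof -
    have "- (- T * q) * q + D * - T = T * (q\<^sup>2 - D)" for T q D :: real
      by (simp add: power2_eq_square algebra_simps)
    then show ?thesis unfolding tail1_def power_divide[symmetric] .
  qed
  also have "(1 - Z t)\<^sup>2 / (1 + Z t)\<^sup>2 - 2 * (p - 2) * Z t / (1 + Z t)\<^sup>2 = 1 - 2 * p * Z t / (1 + Z t)\<^sup>2"
  proof -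
    have "(1 - z)\<^sup>2 / (1 + z)\<^sup>2 - 2 * (p - 2) * z / (1 + z)\<^sup>2 = 1 - 2 * p * z / (1 + z)\<^sup>2" if "0 < 1 + z" for z :: real
    proof -
      have "(1 - z)\<^sup>2 - 2 * (p - 2) * z = (1 + z)\<^sup>2 - 2 * p * z"
        by (simp add: power2_eq_square algebra_simps)
      then have "((1 - z)\<^sup>2 - 2 * (p - 2) * z) / (1 + z)\<^sup>2 = ((1 + z)\<^sup>2 - 2 * p * z) / (1 + z)\<^sup>2"
        by (rule arg_cong)
      then show ?thesis using that by (simp only: diff_divide_distrib) simp
    qed
    from this[OF Z(3)] show ?thesis .
  qed
  also have "tail a t * (1 - 2 * p * Z t / (1 + Z t)\<^sup>2) = tail a t - tail a t powr (p - 1)"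
    unfolding tail_powr by (simp add: right_diff_distrib)
  finally show ?thesis by (rule has_field_derivative_at_within)
qed

lemma tail_le: 
  assumes "0 \<le> t"
  shows "tail a t \<le> 2 * a * exp (- t)"
proof -
  have "(1 + ratio a) / (1 + Z t) \<le> 2 / 1"
    using Z[of t] ratio by (intro frac_le) auto
  then have "((1 + ratio a) / (1 + Z t)) powr (2 / (p - 2)) \<le> 2 powr (2 / (p - 2))"
    using p_gt Z(3)[of t] ratio by (intro powr_mono2) auto
  also have "... \<le> 2 powr 1" using p_gt by (intro powr_mono) (auto simp: field_simps)
  finally have "a * exp (- t) * ((1 + ratio a) / (1 + Z t)) powr (2 / (p - 2)) \<le> a * exp (- t) * 2"
    using a by (intro mult_left_mono) auto
  then show ?thesis by (simp add: tail_def mult_ac)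
qed

lemma abs_tail1_le:
  assumes "0 \<le> t"
  shows "\<bar>tail1 a t\<bar> \<le> tail a t"
proof -
  have "\<bar>(1 - Z t) / (1 + Z t)\<bar> \<le> 1" using Z[of t] assms by (auto simp: abs_if field_simps)
  then have "tail a t * \<bar>(1 - Z t) / (1 + Z t)\<bar> \<le> tail a t * 1" using tail_nonneg by (intro mult_left_mono)
  then show ?thesis unfolding tail1_def abs_mult abs_minus_cancel using tail_nonneg[of t] by simp
qed

end

lemma exp_square_has_integral: "((\<lambda>t. (2 * a * exp (- t))\<^sup>2) has_integral 2 * a\<^sup>2) {0..}" for a :: real
proof -
  have "((\<lambda>t. 4 * a\<^sup>2 * exp (- (2 * t))) has_integral 4 * a\<^sup>2 * (exp (- (2 * 0)) / 2)) {0..}"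
    using has_integral_exp_minus_to_infinity[of 2 0] by (intro has_integral_mult_right) auto
  moreover have "(2 * a * exp (- t))\<^sup>2 = 4 * a\<^sup>2 * exp (- (2 * t))" for t
    by (simp add: power_mult_distrib exp_double[symmetric] flip: exp_of_nat_mult)
  ultimately show ?thesis by simp
qed

lemma dominated_integrable_halfline:
  fixes f :: "real \<Rightarrow> real"
  assumes "continuous_on {0..} f" "\<And>t. 0 \<le> t \<Longrightarrow> \<bar>f t\<bar> \<le> (2 * a * exp (- t))\<^sup>2"
  shows "f integrable_on {0..}"
proof (rule measurable_bounded_by_integrable_imp_integrable_real)
  show "f \<in> borel_measurable (lebesgue_on {0..})"
    using assms(1) by (intro continuous_imp_measurable_on_sets_lebesgue) auto
  show "(\<lambda>t. (2 * a * exp (- t))\<^sup>2) integrable_on {0..}" using exp_square_has_integral by blast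
qed (use assms in auto)

context
  fixes a :: real
  assumes a: "0 \<le> a" "a \<le> c0 / 3"
begin

lemma a': "0 \<le> a" "a \<le> c0" using a levels by auto

lemma tail_le_1: "0 \<le> t \<Longrightarrow> tail a t \<le> 1"
proof -
  assume t: "0 \<le> t"
  have "2 * a * exp (- t) \<le> 1 * 1" using a levels t by (intro mult_mono) auto
  then show ?thesis using tail_le[OF a' t] by simp
qed

lemma cont_tail: "continuous_on S (tail a)" "continuous_on S (tail1 a)"
  by (rule DERIV_continuous_on[OF tail_has_derivative[OF a']], rule DERIV_continuous_on[OF tail1_has_derivative[OF a']])

lemma tail_sq_le: "0 \<le> t \<Longrightarrow> (tail a t)\<^sup>2 \<le> (2 * a * exp (- t))\<^sup>2"
  using tail_le[OF a'] tail_nonneg[OF a'] by (intro power_mono) auto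

lemma tail_powr_le: "0 \<le> t \<Longrightarrow> tail a t powr p \<le> (tail a t)\<^sup>2"
proof -
  assume t: "0 \<le> t"
  have "tail a t powr p \<le> tail a t powr 2"
    using tail_nonneg[OF a'] tail_le_1[OF t] p_gt by (intro powr_mono') auto
  then show ?thesis using tail_nonneg[OF a'] by (simp add: powr_numeral)
qed

lemma integrable_tail:
  "(\<lambda>t. (tail a t)\<^sup>2) integrable_on {0..}" "(\<lambda>t. (tail1 a t)\<^sup>2) integrable_on {0..}"
  "(\<lambda>t. tail a t powr p) integrable_on {0..}"
proof -
  show "(\<lambda>t. (tail a t)\<^sup>2) integrable_on {0..}"
    by (rule dominated_integrable_halfline[of _ a]) (auto intro!: continuous_on_power cont_tail tail_sq_le)
  show "(\<lambda>t. (tail1 a t)\<^sup>2) integrable_on {0..}"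
  proof (rule dominated_integrable_halfline[of _ a])
    fix t :: real assume t: "0 \<le> t"
    have "(tail1 a t)\<^sup>2 \<le> (tail a t)\<^sup>2"
      using abs_tail1_le[OF a' t] tail_nonneg[OF a', of t] by (simp add: abs_le_square_iff[symmetric])
    then show "\<bar>(tail1 a t)\<^sup>2\<bar> \<le> (2 * a * exp (- t))\<^sup>2" using tail_sq_le[OF t] by simp
  qed (auto intro!: continuous_on_power cont_tail)
  show "(\<lambda>t. tail a t powr p) integrable_on {0..}"
  proof (rule dominated_integrable_halfline[of _ a])
    show "continuous_on {0..} (\<lambda>t. tail a t powr p)"
      by (rule continuous_on_powr'[OF cont_tail(1) continuous_on_const]) (use tail_nonneg[OF a'] p_gt in auto)
    fix t :: real assume t: "0 \<le> t"
    show "\<bar>tail a t powr p\<bar> \<le> (2 * a * exp (- t))\<^sup>2"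
      using tail_sq_le[OF t] tail_powr_le[OF t] by simp
  qed
qed

lemma tail_mass_le: "integral {0..} (\<lambda>t. (tail a t)\<^sup>2) \<le> 2 * a\<^sup>2"
proof -
  have "integral {0..} (\<lambda>t. (tail a t)\<^sup>2) \<le> integral {0..} (\<lambda>t. (2 * a * exp (- t))\<^sup>2)"
    using exp_square_has_integral[of a] by (intro integral_le integrable_tail) (auto intro: tail_sq_le)
  then show ?thesis using exp_square_has_integral[of a] by (simp add: integral_unique)
qed

lemma tail_power_le: "integral {0..} (\<lambda>t. tail a t powr p) \<le> 2 * a\<^sup>2"
proof -
  have "integral {0..} (\<lambda>t. tail a t powr p) \<le> integral {0..} (\<lambda>t. (tail a t)\<^sup>2)"
    by (intro integral_le integrable_tail) (auto intro: tail_powr_le)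
  then show ?thesis using tail_mass_le by linarith
qed

end

definition "tail_mass a = integral {0..} (\<lambda>t. (tail a t)\<^sup>2)"

lemma continuous_on_cosine: "continuous_on {0..c0} cosine"
  unfolding cosine_def[abs_def] using p_gt by (intro continuous_intros continuous_on_powr') auto

text \<open>Dominated convergence along sequences; the majorant is the exponential envelope of the
  largest boundary value.\<close>

lemma continuous_on_tail_mass: "continuous_on {0..c0 / 3} tail_mass"
  unfolding continuous_on_sequentially
proof (intro allI ballI impI)
  fix a and x :: "nat \<Rightarrow> real"
  assume aa: "a \<in> {0..c0 / 3}" and "(\<forall>n. x n \<in> {0..c0 / 3}) \<and> x \<longlonglongrightarrow> a"
  then have x: "\<And>n. x n \<in> {0..c0 / 3}" "x \<longlonglongrightarrow> a" by auto
  have cont_a: "continuous_on {0..c0 / 3} (\<lambda>a. tail a t)" for t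
  proof -
    have c: "continuous_on {0..c0 / 3} cosine"
      by (rule continuous_on_subset[OF continuous_on_cosine]) (use levels in auto)
    have c0: "0 < cosine a" if "a \<in> {0..c0 / 3}" for a using cosine(1)[of a] that levels by auto
    have r: "continuous_on {0..c0 / 3} ratio"
      unfolding ratio_def[abs_def] using c c0 by (intro continuous_intros) (auto simp: add_pos_pos less_imp_neq[symmetric] dest: c0)
    have pos: "0 < 1 + ratio a * exp (- (p - 2) * t)" "0 < 1 + ratio a" if "a \<in> {0..c0 / 3}" for a
      using Z(3)[of a t] ratio[of a] that levels by auto
    show ?thesis unfolding tail_def[abs_def]
      by (intro continuous_intros r) (use pos in \<open>fastforce dest: less_imp_neq\<close>)+
  qed
  have "(\<lambda>n. integral {0..} (\<lambda>t. (tail (x n) t)\<^sup>2)) \<longlonglongrightarrow> integral {0..} (\<lambda>t. (tail a t)\<^sup>2)"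
  proof (rule dominated_convergence(2))
    show "(\<lambda>t. (tail (x n) t)\<^sup>2) integrable_on {0..}" for n using integrable_tail[of "x n"] x(1)[of n] by auto
    show "(\<lambda>t. (2 * (c0 / 3) * exp (- t))\<^sup>2) integrable_on {0..}" using exp_square_has_integral by blast
    show "norm ((tail (x n) t)\<^sup>2) \<le> (2 * (c0 / 3) * exp (- t))\<^sup>2" if "t \<in> {0..}" for n t
    proof -
      have "(2 * x n * exp (- t))\<^sup>2 \<le> (2 * (c0 / 3) * exp (- t))\<^sup>2"
        using x(1)[of n] by (intro power_mono mult_right_mono) auto
      moreover have "(tail (x n) t)\<^sup>2 \<le> (2 * x n * exp (- t))\<^sup>2"
        using tail_sq_le[of "x n" t] x(1)[of n] that by simp
      ultimately show ?thesis unfolding real_norm_def abs_power2 by (rule order_trans[rotated])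
    qed
    show "(\<lambda>n. (tail (x n) t)\<^sup>2) \<longlonglongrightarrow> (tail a t)\<^sup>2" if "t \<in> {0..}" for t
      by (intro tendsto_power continuous_on_tendsto_compose[OF cont_a x(2)] aa always_eventually allI x)
  qed
  then show "(tail_mass \<circ> x) \<longlonglongrightarrow> tail_mass a" by (simp add: tail_mass_def o_def)
qed

end

subsection \<open>Rescaling\<close>

text \<open>Nonnegativity turns integrability into absolute integrability, so one change of
  variables serves bounded edges and half-lines alike.\<close>

lemma has_integral_scaled:
  fixes f :: "real \<Rightarrow> real"
  assumes T: "T > 0" and S: "S \<in> sets lebesgue" "(*) T ` S = S'"
    and f: "f integrable_on S'" "\<And>x. x \<in> S' \<Longrightarrow> 0 \<le> f x"
  shows "((\<lambda>x. f (T * x)) has_integral (integral S' f / T)) S"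
proof -
  have "f absolutely_integrable_on S'" by (rule nonnegative_absolutely_integrable_1[OF f])
  moreover have "((*) T has_field_derivative T) (at x within S)" for x
    by (auto intro!: derivative_eq_intros)
  moreover have "inj_on ((*) T) S" using T by (auto intro: inj_onI)
  ultimately have "(\<lambda>x. \<bar>T\<bar> * f (T * x)) absolutely_integrable_on S \<and> integral S (\<lambda>x. \<bar>T\<bar> * f (T * x)) = integral S' f"
    using has_absolute_integral_change_of_variables_1'[OF S(1), of "(*) T" "\<lambda>_. T" f "integral S' f"] S(2) by simp
  then have "((\<lambda>x. \<bar>T\<bar> * f (T * x)) has_integral integral S' f) S"
    by (auto simp: has_integral_iff dest: set_lebesgue_integral_eq_integral(1))
  from has_integral_mult_right[OF this, of "1 / T"] show ?thesis using T by simp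
qed

lemma scaled_edom:
  assumes "T > 0"
  shows "(*) T ` edom H L e = edom H (\<lambda>e. T * L e) e"
proof (cases "e \<in> H")
  case True
  have "x \<in> (*) T ` {0..}" if "0 \<le> x" for x
    using that assms by (intro image_eqI[of _ _ "x / T"]) auto
  then show ?thesis using True assms by (auto simp: edom_def)
next
  case False
  then show ?thesis using assms image_mult_atLeastAtMost[of T 0 "L e"] by (simp add: edom_def)
qed

text \<open>The equation with \<open>lam = T\<^sup>2\<close> on the graph is the equation with \<open>lam = 1\<close> on the graph
  dilated by \<^term>\<open>T\<close>.\<close>

lemma kirchhoff_solution_rescale:
  fixes E H :: "'e set" and src tgt :: "'e \<Rightarrow> 'v"
    and w w1 :: "'e \<Rightarrow> real \<Rightarrow> real" and L :: "'e \<Rightarrow> real" and Wf :: "'v \<Rightarrow> real" and T p :: real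
  defines "D \<equiv> edom H (\<lambda>e. T * L e)" and "k \<equiv> 2 / (p - 2)"
  assumes T: "T > 0" and p: "p > 2"
    and der: "\<And>e x. e \<in> E \<Longrightarrow> x \<in> D e \<Longrightarrow> (w e has_real_derivative w1 e x) (at x within D e)"
    and pos: "\<And>e x. e \<in> E \<Longrightarrow> x \<in> D e \<Longrightarrow> 0 < w e x"
    and der1: "\<And>e x. e \<in> E \<Longrightarrow> x \<in> interior (D e) \<Longrightarrow>
        (w1 e has_real_derivative w e x - w e x powr (p - 1)) (at x)"
    and int: "\<And>e. e \<in> E \<Longrightarrow> (\<lambda>x. (w e x)\<^sup>2) integrable_on D e"
        "\<And>e. e \<in> E \<Longrightarrow> (\<lambda>x. (w1 e x)\<^sup>2) integrable_on D e"
        "\<And>e. e \<in> E \<Longrightarrow> (\<lambda>x. w e x powr p) integrable_on D e"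
    and val: "\<And>e. e \<in> E \<Longrightarrow> w e 0 = Wf (src e)" "\<And>e. e \<in> E - H \<Longrightarrow> w e (T * L e) = Wf (tgt e)"
    and kirch: "\<And>v. v \<in> vertices E H src tgt \<Longrightarrow>
        (\<Sum>e\<in>{e \<in> E. src e = v}. w1 e 0) - (\<Sum>e\<in>{e \<in> E - H. tgt e = v}. w1 e (T * L e)) = 0"
  defines "u \<equiv> \<lambda>e x. T powr k * w e (T * x)" and "u1 \<equiv> \<lambda>e x. T powr (k + 1) * w1 e (T * x)"
  shows "kirchhoff_solution p E H L src tgt u u1 (T\<^sup>2)"
    and "mass E H L u = T powr (2 * k - 1) * (\<Sum>e\<in>E. integral (D e) (\<lambda>x. (w e x)\<^sup>2))"
    and "energy p E H L u u1 = T powr (2 * k + 1) *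
       (1/2 * (\<Sum>e\<in>E. integral (D e) (\<lambda>x. (w1 e x)\<^sup>2)) - 1/p * (\<Sum>e\<in>E. integral (D e) (\<lambda>x. w e x powr p)))"
proof -
  have img: "(*) T ` edom H L e = D e" for e unfolding D_def by (rule scaled_edom[OF T])
  have inD: "T * x \<in> D e" if "x \<in> edom H L e" for x e using img that by blast
  have Sleb: "edom H L e \<in> sets lebesgue" for e by (simp add: edom_def)
  \<comment> \<open>This choice of \<open>k\<close> lets the power term and the second derivative
    both scale like \<open>T powr (k + 2)\<close>, and the two parts of the energy both like
    \<open>T powr (2 * k + 1)\<close>.\<close>
  have kp: "k * p = 2 * k + 2" "k * (p - 1) = k + 2" using p by (auto simp: k_def field_simps)
  have T1: "T powr (k + 1) = T powr k * T" "T powr (k + 2) = T powr k * T\<^sup>2"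
    using T by (simp_all add: powr_add powr_numeral)
  have derT: "((*) T has_real_derivative T) (at x within S)" for x S by (auto intro!: derivative_eq_intros)
  have der_u: "(u e has_real_derivative u1 e x) (at x within edom H L e)" if "e \<in> E" "x \<in> edom H L e" for e x
  proof -
    have "((\<lambda>x. w e (T * x)) has_real_derivative w1 e (T * x) * T) (at x within edom H L e)"
      using DERIV_image_chain[OF der[OF that(1) inD[OF that(2)], unfolded img[of e, symmetric]] derT] by (simp add: o_def)
    from DERIV_cmult[OF this, of "T powr k"] show ?thesis by (simp add: u_def u1_def T1 mult_ac)
  qed
  have pos_u: "0 < u e x" if "e \<in> E" "x \<in> edom H L e" for e x
    using pos[OF that(1) inD[OF that(2)]] T by (simp add: u_def)
  have ode: "(u1 e has_real_derivative T\<^sup>2 * u e x - u e x powr (p - 1)) (at x)"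
    if e: "e \<in> E" and x: "x \<in> interior (edom H L e)" for e x
  proof -
    have "interior (D e) = (*) T ` interior (edom H L e)"
      unfolding img[symmetric] using T interior_surjective_linear_image[of "(*) T" "edom H L e"]
      by (simp add: linear_scale_real surj_def)
    then have xi: "T * x \<in> interior (D e)" using x by auto
    then have xD: "T * x \<in> D e" using interior_subset by blast
    have "((\<lambda>x. w1 e (T * x)) has_real_derivative (w e (T * x) - w e (T * x) powr (p - 1)) * T) (at x)"
      using DERIV_chain[OF der1[OF e xi] derT] by (simp add: o_def)
    from DERIV_cmult[OF this, of "T powr (k + 1)"]
    have der: "(u1 e has_real_derivative T powr (k + 1) * ((w e (T * x) - w e (T * x) powr (p - 1)) * T)) (at x)"
      by (simp add: u1_def)
    have pw: "u e x powr (p - 1) = T powr (k + 2) * w e (T * x) powr (p - 1)"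
      using T pos[OF e xD] by (simp add: u_def powr_mult powr_powr kp)
    show ?thesis unfolding pw
      by (rule DERIV_cong[OF der]) (unfold u_def T1, simp add: power2_eq_square algebra_simps)
  qed
  have intu: "((\<lambda>x. (u e x)\<^sup>2) has_integral T powr (2 * k - 1) * integral (D e) (\<lambda>x. (w e x)\<^sup>2)) (edom H L e)"
    "((\<lambda>x. (u1 e x)\<^sup>2) has_integral T powr (2 * k + 1) * integral (D e) (\<lambda>x. (w1 e x)\<^sup>2)) (edom H L e)"
    "((\<lambda>x. \<bar>u e x\<bar> powr p) has_integral T powr (2 * k + 1) * integral (D e) (\<lambda>x. w e x powr p)) (edom H L e)"
    if e: "e \<in> E" for e
  proof -
    have sc: "T powr (2 * k - 1) = (T powr k)\<^sup>2 / T" "T powr (2 * k + 1) = (T powr (k + 1))\<^sup>2 / T"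
      "T powr (2 * k + 1) = T powr (k * p) / T"
      using T by (simp_all add: powr_diff powr_add kp power2_eq_square powr_numeral flip: powr_add powr_mult_base)
        (simp_all add: powr_add power2_eq_square field_simps)
    show "((\<lambda>x. (u e x)\<^sup>2) has_integral T powr (2 * k - 1) * integral (D e) (\<lambda>x. (w e x)\<^sup>2)) (edom H L e)"
      using has_integral_mult_right[OF has_integral_scaled[OF T Sleb img int(1)[OF e]], of "(T powr k)\<^sup>2"]
      by (simp add: u_def power_mult_distrib sc)
    show "((\<lambda>x. (u1 e x)\<^sup>2) has_integral T powr (2 * k + 1) * integral (D e) (\<lambda>x. (w1 e x)\<^sup>2)) (edom H L e)"
      using has_integral_mult_right[OF has_integral_scaled[OF T Sleb img int(2)[OF e]], of "(T powr (k + 1))\<^sup>2"]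
      by (simp add: u1_def power_mult_distrib sc(2))
    have "((\<lambda>x. T powr (k * p) * w e (T * x) powr p) has_integral T powr (k * p) * (integral (D e) (\<lambda>x. w e x powr p) / T)) (edom H L e)"
      by (rule has_integral_mult_right[OF has_integral_scaled[OF T Sleb img int(3)[OF e]]]) simp
    then have "((\<lambda>x. T powr (k * p) * w e (T * x) powr p) has_integral T powr (2 * k + 1) * integral (D e) (\<lambda>x. w e x powr p)) (edom H L e)"
      by (simp add: sc(3))
    then show "((\<lambda>x. \<bar>u e x\<bar> powr p) has_integral T powr (2 * k + 1) * integral (D e) (\<lambda>x. w e x powr p)) (edom H L e)"
    proof (rule has_integral_eq[rotated])
      fix x assume x: "x \<in> edom H L e"
      have "\<bar>u e x\<bar> = T powr k * w e (T * x)" using pos_u[OF e x] by (simp add: u_def)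
      then show "T powr (k * p) * w e (T * x) powr p = \<bar>u e x\<bar> powr p"
        using T pos[OF e inD[OF x]] by (simp add: powr_mult powr_powr)
    qed
  qed
  show "kirchhoff_solution p E H L src tgt u u1 (T\<^sup>2)"
    unfolding kirchhoff_solution_def
  proof (intro conjI ballI)
    fix v assume v: "v \<in> vertices E H src tgt"
    have "(\<Sum>e\<in>{e \<in> E. src e = v}. u1 e 0) - (\<Sum>e\<in>{e \<in> E - H. tgt e = v}. u1 e (L e))
      = T powr (k + 1) * ((\<Sum>e\<in>{e \<in> E. src e = v}. w1 e 0) - (\<Sum>e\<in>{e \<in> E - H. tgt e = v}. w1 e (T * L e)))"
      by (simp add: u1_def right_diff_distrib sum_distrib_left)
    then show "(\<Sum>e\<in>{e \<in> E. src e = v}. u1 e 0) - (\<Sum>e\<in>{e \<in> E - H. tgt e = v}. u1 e (L e)) = 0"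
      using kirch[OF v] by simp
  next
    fix e x assume "e \<in> E" "x \<in> interior (edom H L e)"
    from ode[OF this] show "\<exists>u2. (u1 e has_real_derivative u2) (at x) \<and> u2 + u e x powr (p - 1) = T\<^sup>2 * u e x"
      by (intro exI conjI) auto
  next
    fix e e' assume "e \<in> E" "e' \<in> E"
    then show "src e = src e' \<longrightarrow> u e 0 = u e' 0"
      and "e' \<notin> H \<and> src e = tgt e' \<longrightarrow> u e 0 = u e' (L e')"
      and "e \<notin> H \<and> e' \<notin> H \<and> tgt e = tgt e' \<longrightarrow> u e (L e) = u e' (L e')"
      using val by (auto simp: u_def)
  qed (use der_u pos_u intu[THEN has_integral_integrable] in auto)
  show "mass E H L u = T powr (2 * k - 1) * (\<Sum>e\<in>E. integral (D e) (\<lambda>x. (w e x)\<^sup>2))"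
    unfolding mass_def sum_distrib_left by (intro sum.cong refl integral_unique intu)
  have "(\<Sum>e\<in>E. integral (edom H L e) (\<lambda>x. (u1 e x)\<^sup>2)) = T powr (2 * k + 1) * (\<Sum>e\<in>E. integral (D e) (\<lambda>x. (w1 e x)\<^sup>2))"
    "(\<Sum>e\<in>E. integral (edom H L e) (\<lambda>x. \<bar>u e x\<bar> powr p)) = T powr (2 * k + 1) * (\<Sum>e\<in>E. integral (D e) (\<lambda>x. w e x powr p))"
    unfolding sum_distrib_left by (intro sum.cong refl integral_unique intu; assumption)+
  then show "energy p E H L u u1 = T powr (2 * k + 1) *
       (1/2 * (\<Sum>e\<in>E. integral (D e) (\<lambda>x. (w1 e x)\<^sup>2)) - 1/p * (\<Sum>e\<in>E. integral (D e) (\<lambda>x. w e x powr p)))"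
    unfolding energy_def by (simp add: algebra_simps)
qed

subsection \<open>Solving the vertex conditions\<close>

lemma integral_square_nonneg: "0 \<le> integral S (\<lambda>t. (f t)\<^sup>2)" for f :: "real \<Rightarrow> real"
  by (cases "(\<lambda>t. (f t)\<^sup>2) integrable_on S") (auto intro: integral_nonneg simp: not_integrable_integral)

text \<open>\<open>F\<close> are the edges outside the special one, which hangs at \<open>v0\<close>; \<open>m\<close> counts its branches
  leaving \<open>v0\<close> (one for a pendant, two for a loop cut at its midpoint) and \<open>L0\<close> is the length of a
  branch.\<close>

locale rest_graph = peak_flow p Y Q + edge: edge_flow p U V
  for p :: real and Y Q U V +
  fixes F H :: "'e set" and L :: "'e \<Rightarrow> real" and src tgt :: "'e \<Rightarrow> 'v"
    and v0 :: 'v and R :: "'v set" and m L0 len0 :: real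
  assumes finF: "finite F" and finR: "finite R" and v0R: "v0 \<notin> R"
    and src_in: "e \<in> F \<Longrightarrow> src e \<in> insert v0 R"
    and tgt_in: "e \<in> F - H \<Longrightarrow> tgt e \<in> insert v0 R"
    and m_ge: "m \<ge> 1" and L0: "L0 > 0" and delta: "len0 > 0"
    and delta_le: "e \<in> F - H \<Longrightarrow> len0 \<le> L e"
    and connected: "Zs \<subseteq> R \<Longrightarrow> Zs \<noteq> {} \<Longrightarrow> \<exists>e\<in>F - H. (src e \<in> Zs) \<noteq> (tgt e \<in> Zs)"
begin

section \<open>Fluxes out of the rest of the graph and their signs\<close>

definition "triple T W e = (W (src e), W (tgt e), T * L e)"
definition "out_slope T W e = (if e \<in> H then - W (src e) * cosine (W (src e)) else edge.slope (triple T W e))"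
definition "flux T W v = (\<Sum>e\<in>{e \<in> F. src e = v}. out_slope T W e)
   - (\<Sum>e\<in>{e \<in> F - H. tgt e = v}. edge.end_slope (triple T W e))"
definition "edge_masses T W e = (if e \<in> H then tail_mass (W (src e)) else edge.edge_mass (triple T W e))"
definition "rest_mass T W = (\<Sum>e\<in>F. edge_masses T W e)"

text \<open>\<open>1 \<le> T * len0\<close> makes every dilated bounded edge long enough for
  \<open>edge.box\<close>; \<open>eps\<close> will be the size \<open>fst x + snd x\<close> of the
  start.\<close>

definition "bounded_data T W eps \<longleftrightarrow> 1 \<le> T * len0 \<and> eps \<le> c0 / 3 \<and> (\<forall>v\<in>insert v0 R. 0 \<le> W v \<and> W v \<le> eps)"

context
  fixes T eps :: real and W :: "'v \<Rightarrow> real"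
  assumes bd: "bounded_data T W eps"
begin

lemma T_pos: "0 < T"
proof -
  have "0 < T * len0" using bd by (auto simp: bounded_data_def)
  then show ?thesis using delta by (simp add: zero_less_mult_iff)
qed

lemma length_ge: "e \<in> F - H \<Longrightarrow> 1 \<le> T * L e"
proof -
  assume "e \<in> F - H"
  then have "T * len0 \<le> T * L e" using delta_le[of e] T_pos by (intro mult_left_mono) auto
  then show ?thesis using bd by (simp add: bounded_data_def)
qed

lemma W_vertex: "v \<in> insert v0 R \<Longrightarrow> 0 \<le> W v" "v \<in> insert v0 R \<Longrightarrow> W v \<le> eps"
  using bd unfolding bounded_data_def by blast+

lemma eps_le: "eps \<le> c0 / 3" "eps \<le> c0" "eps \<le> 1"
  using bd levels by (auto simp: bounded_data_def)

lemma W_src: "e \<in> F \<Longrightarrow> 0 \<le> W (src e)" "e \<in> F \<Longrightarrow> W (src e) \<le> eps" "e \<in> F \<Longrightarrow> W (src e) \<le> c0 / 3" "e \<in> F \<Longrightarrow> W (src e) \<le> c0"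
  using W_vertex[OF src_in] eps_le by (blast intro: order_trans)+

lemma W_tgt: "e \<in> F - H \<Longrightarrow> 0 \<le> W (tgt e)" "e \<in> F - H \<Longrightarrow> W (tgt e) \<le> eps" "e \<in> F - H \<Longrightarrow> W (tgt e) \<le> c0"
  using W_vertex[OF tgt_in] eps_le by (blast intro: order_trans)+

lemma box: "e \<in> F - H \<Longrightarrow> edge.box (triple T W e)"
  using W_src[of e] W_tgt[of e] length_ge[of e] by (auto simp: edge.box_def triple_def)

lemma end_slope_eq:
  assumes "e \<in> F - H"
  shows "edge.end_slope (triple T W e) = V (edge.x0 (W (src e)) (W (tgt e)) (T * L e)) (T * L e)"
  using edge.x0_def[OF box[OF assms, unfolded triple_def]] by (simp add: edge.end_slope_def triple_def)

lemma flux_terms: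
  assumes "W v = 0"
  shows "e \<in> {e \<in> F. src e = v} \<Longrightarrow> 0 \<le> out_slope T W e"
    and "e \<in> {e \<in> F - H. tgt e = v} \<Longrightarrow> edge.end_slope (triple T W e) \<le> 0"
proof -
  show "0 \<le> out_slope T W e" if "e \<in> {e \<in> F. src e = v}"
    using that assms edge.slope_nonneg[of "W (src e)" "W (tgt e)" "T * L e"] box[of e]
    by (auto simp: out_slope_def triple_def)
  show "edge.end_slope (triple T W e) \<le> 0" if "e \<in> {e \<in> F - H. tgt e = v}"
    using that assms edge.end_slope_nonpos[of "W (src e)" "W (tgt e)" "T * L e"] box[of e] end_slope_eq[of e]
    by (auto simp: triple_def)
qed

lemma flux_nonneg:
  assumes "W v = 0"
  shows "0 \<le> flux T W v"
proof -
  have "0 \<le> (\<Sum>e\<in>{e \<in> F. src e = v}. out_slope T W e)"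
    by (intro sum_nonneg flux_terms(1)[OF assms])
  moreover have "(\<Sum>e\<in>{e \<in> F - H. tgt e = v}. edge.end_slope (triple T W e)) \<le> 0"
    by (intro sum_nonpos flux_terms(2)[OF assms])
  ultimately show ?thesis unfolding flux_def by linarith
qed

text \<open>The terms of the flux have one sign, so each slope vanishes; a zero value with a zero
  slope spreads along the edge to the neighbouring vertex.\<close>

lemma flux_zero:
  assumes "W v = 0" "flux T W v = 0" "e \<in> F - H"
  shows "src e = v \<Longrightarrow> W (tgt e) = 0" "tgt e = v \<Longrightarrow> W (src e) = 0"
proof -
  let ?A = "{e \<in> F. src e = v}" and ?B = "{e \<in> F - H. tgt e = v}"
  have fin: "finite ?A" "finite ?B" using finF by auto
  have s: "0 \<le> (\<Sum>e\<in>?A. out_slope T W e)" "(\<Sum>e\<in>?B. edge.end_slope (triple T W e)) \<le> 0"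
    by (intro sum_nonneg flux_terms(1)[OF assms(1)], assumption) (intro sum_nonpos flux_terms(2)[OF assms(1)])
  then have s0: "(\<Sum>e\<in>?A. out_slope T W e) = 0" "(\<Sum>e\<in>?B. edge.end_slope (triple T W e)) = 0"
    using assms(2) unfolding flux_def by linarith+
  have A: "\<forall>e\<in>?A. out_slope T W e = 0"
    using sum_nonneg_eq_0_iff[OF fin(1), of "out_slope T W"] flux_terms(1)[OF assms(1)] s0(1) by blast
  have B: "\<forall>e\<in>?B. edge.end_slope (triple T W e) = 0"
    using sum_nonneg_eq_0_iff[OF fin(2), of "\<lambda>e. - edge.end_slope (triple T W e)"] flux_terms(2)[OF assms(1)] s0(2)
    unfolding sum_negf neg_equal_0_iff_equal neg_0_le_iff_le by blast
  show "W (tgt e) = 0" if "src e = v"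
    using A that assms edge.slope_zero[of "W (src e)" "W (tgt e)" "T * L e"] box[of e]
    by (auto simp: out_slope_def triple_def)
  show "W (src e) = 0" if "tgt e = v"
    using B that assms edge.end_slope_zero[of "W (src e)" "W (tgt e)" "T * L e"] box[of e] end_slope_eq[of e]
    by (auto simp: triple_def)
qed

text \<open>Maximum principle: from a vertex of largest value no edge starts upwards, by convexity
  on bounded edges and by decay on half-lines.\<close>

lemma flux_nonpos:
  assumes "\<And>v'. v' \<in> insert v0 R \<Longrightarrow> W v' \<le> W v"
  shows "flux T W v \<le> 0"
proof -
  have "out_slope T W e \<le> 0" if "e \<in> {e \<in> F. src e = v}" for e
  proof (cases "e \<in> H")
    case True
    then show ?thesis using W_src[of e] that cosine(1)[of "W (src e)"] by (auto simp: out_slope_def intro!: mult_nonneg_nonneg)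
  next
    case False
    then show ?thesis
      using that assms[OF tgt_in[of e]] edge.slope_nonpos[of "W (src e)" "W (tgt e)" "T * L e"] box[of e]
      by (auto simp: out_slope_def triple_def)
  qed
  moreover have "0 \<le> edge.end_slope (triple T W e)" if "e \<in> {e \<in> F - H. tgt e = v}" for e
    using that assms[OF src_in[of e]] edge.end_slope_nonneg[of "W (src e)" "W (tgt e)" "T * L e"] box[of e] end_slope_eq[of e]
    by (auto simp: triple_def)
  ultimately have "(\<Sum>e\<in>{e \<in> F. src e = v}. out_slope T W e) \<le> 0"
    "0 \<le> (\<Sum>e\<in>{e \<in> F - H. tgt e = v}. edge.end_slope (triple T W e))"
    by (blast intro: sum_nonpos sum_nonneg)+
  then show ?thesis unfolding flux_def by linarith
qed

lemma edge_masses_bounds: "e \<in> F \<Longrightarrow> 0 \<le> edge_masses T W e" "e \<in> F \<Longrightarrow> edge_masses T W e \<le> 8 * eps"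
proof -
  assume e: "e \<in> F"
  have "eps \<le> 1" by (rule eps_le)
  show "edge_masses T W e \<le> 8 * eps"
  proof (cases "e \<in> H")
    case True
    have "tail_mass (W (src e)) \<le> 2 * (W (src e))\<^sup>2" unfolding tail_mass_def using W_src[OF e] by (intro tail_mass_le)
    also have "... \<le> 2 * (eps * 1)" unfolding power2_eq_square using W_src[OF e] \<open>eps \<le> 1\<close> by (intro mult_left_mono mult_mono) auto
    also have "... \<le> 8 * eps" using W_src[OF e] by simp
    finally show ?thesis using True by (simp add: edge_masses_def)
  next
    case False
    then have "edge.edge_mass (triple T W e) \<le> 8 * max (W (src e)) (W (tgt e))"
      using edge.edge_mass_le[of "W (src e)" "W (tgt e)" "T * L e"] edge.x0_def[of "W (src e)" "W (tgt e)" "T * L e"] box[of e] e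
      by (simp add: edge.edge_mass_def triple_def)
    also have "... \<le> 8 * eps" using W_src[of e] W_tgt[of e] e False by auto
    finally show ?thesis using False by (simp add: edge_masses_def)
  qed
  show "0 \<le> edge_masses T W e"
    by (simp add: edge_masses_def tail_mass_def edge.edge_mass_def triple_def integral_square_nonneg)
qed

lemma rest_mass_bounds: "0 \<le> rest_mass T W" "rest_mass T W \<le> 8 * card F"
proof -
  have "eps \<le> 1" by (rule eps_le)
  then have "edge_masses T W e \<le> 8" if "e \<in> F" for e using edge_masses_bounds(2)[OF that] by linarith
  then show "rest_mass T W \<le> 8 * card F"
    unfolding rest_mass_def using sum_bounded_above[of F "edge_masses T W" 8] by (simp add: mult.commute)
  show "0 \<le> rest_mass T W" unfolding rest_mass_def by (intro sum_nonneg edge_masses_bounds)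
qed

text \<open>The vertices where \<^term>\<open>W\<close> vanishes form a union of components of the rest graph.\<close>

lemma W_positive:
  assumes v0: "W v0 = 0 \<Longrightarrow> flux T W v0 < 0" and R: "\<And>v. v \<in> R \<Longrightarrow> flux T W v = 0"
    and v: "v \<in> insert v0 R"
  shows "0 < W v"
proof -
  have W0: "W v0 \<noteq> 0" using v0 flux_nonneg[of v0] by auto
  define Zs where "Zs = {v \<in> R. W v = 0}"
  have "Zs = {}"
  proof (rule ccontr)
    assume "Zs \<noteq> {}"
    then obtain e where e: "e \<in> F - H" "(src e \<in> Zs) \<noteq> (tgt e \<in> Zs)"
      using connected[of Zs] by (auto simp: Zs_def)
    have iff: "W (src e) = 0 \<longleftrightarrow> src e \<in> Zs" "W (tgt e) = 0 \<longleftrightarrow> tgt e \<in> Zs"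
      using e src_in[of e] tgt_in[of e] W0 by (auto simp: Zs_def)
    have flux0: "flux T W v = 0" if "v \<in> Zs" for v using that R by (simp add: Zs_def)
    show False
    proof (cases "src e \<in> Zs")
      case True
      then have "W (tgt e) = 0" using iff(1) by (intro flux_zero(1)[OF _ flux0[OF True] e(1) refl]) simp
      then show False using iff(2) e(2) True by simp
    next
      case False
      then have tgt: "tgt e \<in> Zs" using e(2) by simp
      then have "W (src e) = 0" using iff(2) by (intro flux_zero(2)[OF _ flux0[OF tgt] e(1) refl]) simp
      then show False using iff(1) False by simp
    qed
  qed
  then show ?thesis using W0 v bd by (auto simp: Zs_def bounded_data_def less_le)
qed

end

section \<open>The mass as a function of the start\<close>

definition "dilation x = peak x / L0"
text \<open>The mass exponent \<open>2 * k - 1\<close> of \<open>kirchhoff_solution_rescale\<close>,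
  that is \<open>(6 - p) / (p - 2)\<close>.\<close>

definition "expo = 2 * (2 / (p - 2)) - 1"
definition "total_mass x W = dilation x powr expo * (m * wave_mass x + rest_mass (dilation x) W)"

text \<open>The last condition yields \<open>1 \<le> T * len0\<close> through
  \<open>dilation_ge\<close>.\<close>

definition "small eps0 \<longleftrightarrow> 0 < eps0 \<and> eps0 \<le> c0 / 3 \<and> eps0 * exp (L0 / len0) \<le> 1"

lemma expo_neg: "expo < 0"
  using p_gt by (simp add: expo_def field_simps)

lemma dilation_ge:
  assumes "admissible x" "(fst x + snd x) * exp (L0 * t) \<le> 1"
  shows "t \<le> dilation x"
proof -
  have "(fst x + snd x) * exp (L0 * t) \<le> (fst x + snd x) * exp (peak x)"
    using peak_ge[OF assms(1)] assms(2) by linarith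
  then have "L0 * t \<le> peak x" using start(6)[OF assms(1)] by (simp add: mult_le_cancel_left)
  then show ?thesis using L0 by (simp add: dilation_def field_simps)
qed

lemma bounded_data_intro:
  assumes "admissible x" "small eps0" "fst x + snd x \<le> eps0" 
    "\<And>v. v \<in> insert v0 R \<Longrightarrow> 0 \<le> W v \<and> W v \<le> fst x + snd x"
  shows "bounded_data (dilation x) W (fst x + snd x)"
proof -
  have "(fst x + snd x) * exp (L0 * (1 / len0)) \<le> eps0 * exp (L0 * (1 / len0))"
    using assms by (intro mult_right_mono) auto
  also have "... \<le> 1" using assms(2) by (simp add: small_def)
  finally have "1 / len0 \<le> dilation x" by (rule dilation_ge[OF assms(1)])
  then show ?thesis using assms delta by (auto simp: bounded_data_def small_def field_simps)
qed

text \<open>A start of size at most \<open>exp (- (L0 * t))\<close> has dilation at least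
  \<open>t\<close>, and the mass exponent is negative.\<close>

lemma total_mass_le:
  assumes "admissible x" "bounded_data (dilation x) W (fst x + snd x)" "t > 0" "(fst x + snd x) * exp (L0 * t) \<le> 1"
  shows "total_mass x W \<le> t powr expo * (m * mass_high + 8 * card F)"
proof -
  have "dilation x powr expo \<le> t powr expo"
    using dilation_ge[OF assms(1,4)] assms(3) expo_neg by (intro powr_mono2') auto
  moreover have "m * wave_mass x \<le> m * mass_high"
    using wave_mass_le[OF assms(1)] m_ge by (intro mult_left_mono) auto
  moreover have "0 \<le> m * wave_mass x"
    using wave_mass_ge[OF assms(1)] mass_consts_pos m_ge by (intro mult_nonneg_nonneg) auto
  ultimately have "m * wave_mass x + rest_mass (dilation x) W \<le> m * mass_high + 8 * card F"
    "0 \<le> m * wave_mass x + rest_mass (dilation x) W" "dilation x powr expo \<le> t powr expo"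
    using rest_mass_bounds[OF assms(2)] by auto
  then show ?thesis unfolding total_mass_def by (intro mult_mono) auto
qed

text \<open>The reciprocal bound on the peak time limits the dilation from above; the mass of the
  rest is only used to be nonnegative.\<close>

lemma total_mass_ge:
  assumes "admissible x" "bounded_data (dilation x) W (fst x + snd x)"
  shows "(peak_bound / (fst x + snd x) / L0) powr expo * (m * mass_low) \<le> total_mass x W"
proof -
  have "(peak_bound / (fst x + snd x) / L0) powr expo \<le> dilation x powr expo"
  proof (rule powr_mono2')
    show "0 < dilation x" using T_pos[OF assms(2)] .
    show "dilation x \<le> peak_bound / (fst x + snd x) / L0"
      unfolding dilation_def using peak_le[OF assms(1)] L0 by (intro divide_right_mono) auto
  qed (use expo_neg in auto)
  moreover have "m * mass_low \<le> m * wave_mass x + rest_mass (dilation x) W"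
    using wave_mass_ge[OF assms(1)] m_ge rest_mass_bounds(1)[OF assms(2)]
      mult_left_mono[of mass_low "wave_mass x" m] by linarith
  ultimately show ?thesis unfolding total_mass_def
    using mass_consts_pos m_ge by (intro mult_mono) auto
qed

section \<open>The system for the Poincare-Miranda theorem\<close>

context
  fixes eps1 eps0 :: real
  assumes eps: "small eps0" "0 < eps1" "eps1 < eps0"
begin

definition "cube = {z :: 'v + bool \<Rightarrow> real. \<forall>j. 0 \<le> z j \<and> z j \<le> 1}"
text \<open>Coordinate \<open>Inr True\<close> places the size of the start in
  \<open>[eps1, eps0]\<close>, \<open>Inr False\<close> is the ratio of slope to size, and
  \<open>Inl v\<close> is a vertex value in units of the size. The value at \<open>v0\<close> is not
  free: it is the value of the start.\<close>

definition "eps_of z = eps1 + (eps0 - eps1) * z (Inr True)" for z :: "'v + bool \<Rightarrow> real"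
definition "start_of z = (eps_of z * (1 - z (Inr False)), eps_of z * z (Inr False))" for z :: "'v + bool \<Rightarrow> real"
definition "W_of z v = (if v = v0 then fst (start_of z) else eps_of z * z (Inl v))" for z :: "'v + bool \<Rightarrow> real"

lemma eps_of: "z \<in> cube \<Longrightarrow> eps1 \<le> eps_of z" "z \<in> cube \<Longrightarrow> eps_of z \<le> eps0" "z \<in> cube \<Longrightarrow> 0 < eps_of z"
proof -
  assume z: "z \<in> cube"
  have "0 \<le> (eps0 - eps1) * z (Inr True)" "(eps0 - eps1) * z (Inr True) \<le> eps0 - eps1"
    using z eps by (auto simp: cube_def mult_left_le intro!: mult_nonneg_nonneg)
  then show "eps1 \<le> eps_of z" "eps_of z \<le> eps0" "0 < eps_of z"
    using eps(2) unfolding eps_of_def by linarith+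
qed

lemma start_sum: "fst (start_of z) + snd (start_of z) = eps_of z"
  by (simp add: start_of_def algebra_simps)

lemma start_admissible:
  assumes z: "z \<in> cube"
  shows "admissible (start_of z)"
proof -
  have "0 \<le> fst (start_of z)" "0 \<le> snd (start_of z)"
    using eps_of(3)[OF z] z by (auto simp: start_of_def cube_def intro!: mult_nonneg_nonneg)
  moreover have "eps0 \<le> c0 / 3" using eps by (simp add: small_def)
  ultimately show ?thesis unfolding admissible_def start_sum using eps_of[OF z] by auto
qed

lemma W_of_bounds: "z \<in> cube \<Longrightarrow> 0 \<le> W_of z v \<and> W_of z v \<le> eps_of z"
  using eps_of(3)[of z] by (auto simp: W_of_def start_of_def cube_def intro!: mult_nonneg_nonneg mult_left_le)

lemma bounded_of: "z \<in> cube \<Longrightarrow> bounded_data (dilation (start_of z)) (W_of z) (eps_of z)"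
  using bounded_data_intro[OF start_admissible eps(1), of z "W_of z"] eps_of(2) W_of_bounds
  by (simp add: start_sum)

lemma cont_coord: "continuous_on cube (\<lambda>z. z i)"
  by (rule continuous_on_subset[OF continuous_on_product_coordinates]) auto

lemma cont_start: "continuous_on cube start_of" "continuous_on cube (\<lambda>z. W_of z v)"
proof -
  show "continuous_on cube start_of" unfolding start_of_def[abs_def] eps_of_def[abs_def] by (intro continuous_intros cont_coord)
  then show "continuous_on cube (\<lambda>z. W_of z v)"
    by (cases "v = v0") (auto simp: W_of_def eps_of_def intro!: continuous_intros cont_coord)
qed

lemma start_in: "start_of ` cube \<subseteq> {x. admissible x \<and> eps1 \<le> fst x + snd x}"
  using start_admissible eps_of by (auto simp: start_sum)

lemma cont_dilation: "continuous_on cube (\<lambda>z. dilation (start_of z))"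
  unfolding dilation_def
  by (rule continuous_on_divide[OF continuous_on_compose2[OF continuous_on_peak[OF eps(2)] cont_start(1) start_in] continuous_on_const])
     (use L0 in auto)

lemma cont_triple: "continuous_on cube (\<lambda>z. triple (dilation (start_of z)) (W_of z) e)"
  unfolding triple_def by (intro continuous_intros cont_start cont_dilation)

lemma triple_in: "e \<in> F - H \<Longrightarrow> (\<lambda>z. triple (dilation (start_of z)) (W_of z) e) ` cube \<subseteq> {w. edge.box w}"
  using box[OF bounded_of] by auto

lemma W_src_in: "e \<in> F \<Longrightarrow> (\<lambda>z. W_of z (src e)) ` cube \<subseteq> {0..c0 / 3}"
  using W_src[OF bounded_of] by auto

lemma cont_out_slope: "e \<in> F \<Longrightarrow> continuous_on cube (\<lambda>z. out_slope (dilation (start_of z)) (W_of z) e)"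
proof (cases "e \<in> H")
  case True
  assume e: "e \<in> F"
  have "continuous_on cube (\<lambda>z. cosine (W_of z (src e)))"
    by (rule continuous_on_compose2[OF continuous_on_cosine cont_start(2)]) (use W_src_in[OF e] levels in auto)
  then show ?thesis using True by (auto simp: out_slope_def intro!: continuous_intros cont_start)
next
  case False
  assume e: "e \<in> F"
  show ?thesis using False continuous_on_compose2[OF edge.continuous_on_slope cont_triple triple_in] e
    by (simp add: out_slope_def)
qed

lemma cont_flux: "continuous_on cube (\<lambda>z. flux (dilation (start_of z)) (W_of z) v)"
proof -
  have "continuous_on cube (\<lambda>z. edge.end_slope (triple (dilation (start_of z)) (W_of z) e))" if "e \<in> F - H" for e
    by (rule continuous_on_compose2[OF edge.continuous_on_end_slope cont_triple triple_in[OF that]])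
  then show ?thesis unfolding flux_def by (intro continuous_intros cont_out_slope) auto
qed

lemma cont_total_mass: "continuous_on cube (\<lambda>z. total_mass (start_of z) (W_of z))"
proof -
  have 1: "continuous_on cube (\<lambda>z. edge_masses (dilation (start_of z)) (W_of z) e)" if e: "e \<in> F" for e
  proof (cases "e \<in> H")
    case True
    then show ?thesis
      using continuous_on_compose2[OF continuous_on_tail_mass cont_start(2) W_src_in[OF e]] by (simp add: edge_masses_def)
  next
    case False
    then show ?thesis using continuous_on_compose2[OF edge.continuous_on_edge_mass cont_triple triple_in] e
      by (simp add: edge_masses_def)
  qed
  have 2: "continuous_on cube (\<lambda>z. wave_mass (start_of z))"
    by (rule continuous_on_compose2[OF continuous_on_wave_mass[OF eps(2)] cont_start(1) start_in])
  have "\<forall>z\<in>cube. dilation (start_of z) \<noteq> 0" using T_pos[OF bounded_of] by fastforce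
  then show ?thesis unfolding total_mass_def rest_mass_def
    by (intro continuous_intros 1 2 cont_dilation continuous_on_powr) auto
qed

text \<open>Where a vertex fraction is 0 the vertex is a minimum of \<open>W\<close>, where it is 1
  a maximum; this fixes the sign of its flux. With ratio 0 the base is a maximum and the slope term
  vanishes; with ratio 1 its value is 0 and both terms are nonnegative.\<close>

lemma branch_point:
  assumes lo: "\<And>z. z \<in> cube \<Longrightarrow> z (Inr True) = 0 \<Longrightarrow> total_mass (start_of z) (W_of z) \<le> \<mu>"
    and hi: "\<And>z. z \<in> cube \<Longrightarrow> z (Inr True) = 1 \<Longrightarrow> \<mu> \<le> total_mass (start_of z) (W_of z)"
  obtains z where "z \<in> cube" "\<And>v. v \<in> R \<Longrightarrow> flux (dilation (start_of z)) (W_of z) v = 0"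
    "m * snd (start_of z) + flux (dilation (start_of z)) (W_of z) v0 = 0"
    "total_mass (start_of z) (W_of z) = \<mu>"
proof -
  \<comment> \<open>The flux is nonnegative where the vertex value is 0, hence the minus sign at
    \<open>Inl v\<close>. At the base the value decreases as the ratio increases, hence none
    there.\<close>
  define G where "G i z = (case i of Inl v \<Rightarrow> - flux (dilation (start_of z)) (W_of z) v
     | Inr b \<Rightarrow> if b then total_mass (start_of z) (W_of z) - \<mu>
        else m * snd (start_of z) + flux (dilation (start_of z)) (W_of z) v0)" for i and z
  have cube_iff: "(\<forall>j. 0 \<le> z j \<and> z j \<le> 1) \<longleftrightarrow> z \<in> cube" for z by (simp add: cube_def)
  obtain z where z: "\<And>j. 0 \<le> z j \<and> z j \<le> 1" "\<And>i. i \<in> Inl ` R \<union> {Inr True, Inr False} \<Longrightarrow> G i z = 0"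
  proof (rule poincare_miranda[of "Inl ` R \<union> {Inr True, Inr False}" G])
    show "finite (Inl ` R \<union> {Inr True, Inr False})" using finR by auto
    show "continuous_on {z. \<forall>j. 0 \<le> z j \<and> z j \<le> 1} (G i)" for i
      unfolding cube_def[symmetric]
    proof (cases i)
      case (Inl v)
      then show "continuous_on cube (G i)" by (auto simp: G_def[abs_def] intro!: continuous_intros cont_flux)
    next
      case (Inr b)
      then show "continuous_on cube (G i)"
        by (cases b) (auto simp: G_def[abs_def] intro!: continuous_intros cont_flux cont_total_mass cont_start)
    qed
    fix i and z :: "'v + bool \<Rightarrow> real"
    assume i: "i \<in> Inl ` R \<union> {Inr True, Inr False}" and "\<And>j. 0 \<le> z j \<and> z j \<le> 1"
    then have z: "z \<in> cube" by (simp add: cube_def)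
    note bd = bounded_of[OF z]
    consider (v) v where "i = Inl v" "v \<in> R" | "i = Inr True" | "i = Inr False" using i by auto
    note cases_i = this
    show "G i z \<le> 0" if zi: "z i = 0"
      using cases_i
    proof cases
      case v
      then have "W_of z v = 0" using zi v0R by (auto simp: W_of_def)
      then show ?thesis using v flux_nonneg[OF bd] by (simp add: G_def)
    next
      case 2
      then show ?thesis using lo[OF z] zi by (simp add: G_def)
    next
      case 3
      then have "W_of z v0 = eps_of z" "snd (start_of z) = 0" using zi by (auto simp: W_of_def start_of_def)
      moreover have "flux (dilation (start_of z)) (W_of z) v0 \<le> 0"
        by (rule flux_nonpos[OF bd]) (use W_of_bounds[OF z] calculation in auto)
      ultimately show ?thesis using 3 by (simp add: G_def)
    qed
    show "0 \<le> G i z" if zi: "z i = 1"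
      using cases_i
    proof cases
      case v
      then have "W_of z v = eps_of z" using zi v0R by (auto simp: W_of_def)
      then have "flux (dilation (start_of z)) (W_of z) v \<le> 0"
        by (intro flux_nonpos[OF bd]) (use W_of_bounds[OF z] in auto)
      then show ?thesis using v by (simp add: G_def)
    next
      case 2
      then show ?thesis using hi[OF z] zi by (simp add: G_def)
    next
      case 3
      then have "W_of z v0 = 0" "snd (start_of z) = eps_of z" using zi by (auto simp: W_of_def start_of_def)
      then show ?thesis using 3 flux_nonneg[OF bd, of v0] eps_of(3)[OF z] m_ge
        by (auto simp: G_def intro!: add_nonneg_nonneg mult_nonneg_nonneg)
    qed
  qed auto
  show ?thesis
  proof (rule that[of z])
    show "z \<in> cube" using z(1) by (simp add: cube_def)
    show "flux (dilation (start_of z)) (W_of z) v = 0" if "v \<in> R" for v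
      using z(2)[of "Inl v"] that by (simp add: G_def)
    show "m * snd (start_of z) + flux (dilation (start_of z)) (W_of z) v0 = 0"
      using z(2)[of "Inr False"] by (simp add: G_def)
    show "total_mass (start_of z) (W_of z) = \<mu>" using z(2)[of "Inr True"] by (simp add: G_def)
  qed
qed

end

definition "branch_solution eps0 \<mu> x W \<longleftrightarrow> admissible x \<and> fst x + snd x \<le> eps0 \<and>
     bounded_data (dilation x) W (fst x + snd x) \<and> W v0 = fst x \<and> (\<forall>v\<in>insert v0 R. 0 < W v) \<and>
     (\<forall>v\<in>R. flux (dilation x) W v = 0) \<and> m * snd x + flux (dilation x) W v0 = 0 \<and> total_mass x W = \<mu>"

text \<open>The range of masses is fixed by \<open>eps0\<close>, through the lower mass bound at
  that size; only the lower end \<open>eps1\<close> of the sizes depends on the prescribed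
  mass.\<close>

theorem branch:
  assumes small: "small eps0"
  shows "\<exists>\<mu>0>0. \<forall>\<mu>. 0 < \<mu> \<and> \<mu> \<le> \<mu>0 \<longrightarrow> (\<exists>x W. branch_solution eps0 \<mu> x W)"
proof (intro exI[of _ "(peak_bound / eps0 / L0) powr expo * (m * mass_low)"] conjI allI impI)
  show "0 < (peak_bound / eps0 / L0) powr expo * (m * mass_low)"
    using const_pos mass_consts_pos L0 m_ge small by (auto simp: small_def intro!: mult_pos_pos)
  fix \<mu> assume \<mu>: "0 < \<mu> \<and> \<mu> \<le> (peak_bound / eps0 / L0) powr expo * (m * mass_low)"
  define C where "C = m * mass_high + 8 * card F"
  have C: "C > 0" unfolding C_def using m_ge mass_consts_pos by (intro add_pos_nonneg mult_pos_pos) auto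
  \<comment> \<open>The dilation at which the upper bound of \<open>total_mass_le\<close> equals the
    prescribed mass.\<close>
  define t where "t = (\<mu> / C) powr (1 / expo)"
  have t: "t > 0" "t powr expo * C = \<mu>"
    using \<mu> C expo_neg by (auto simp: t_def powr_powr)
  \<comment> \<open>The exponential makes the dilation at size \<open>eps1\<close> at least
    \<open>t\<close>; \<open>eps0 / 2\<close> keeps the range of sizes nondegenerate.\<close>
  define eps1 where "eps1 = min (eps0 / 2) (exp (- (L0 * t)))"
  have eps1: "0 < eps1" "eps1 < eps0" "eps1 * exp (L0 * t) \<le> 1"
  proof -
    show "0 < eps1" "eps1 < eps0" using small by (auto simp: eps1_def small_def min_less_iff_disj)
    have "eps1 * exp (L0 * t) \<le> exp (- (L0 * t)) * exp (L0 * t)" by (intro mult_right_mono) (auto simp: eps1_def)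
    then show "eps1 * exp (L0 * t) \<le> 1" by (simp flip: exp_add)
  qed
  obtain z where z: "z \<in> cube" "\<And>v. v \<in> R \<Longrightarrow> flux (dilation (start_of eps1 eps0 z)) (W_of eps1 eps0 z) v = 0"
    "m * snd (start_of eps1 eps0 z) + flux (dilation (start_of eps1 eps0 z)) (W_of eps1 eps0 z) v0 = 0"
    "total_mass (start_of eps1 eps0 z) (W_of eps1 eps0 z) = \<mu>"
  proof (rule branch_point[OF small eps1(1,2), of \<mu>])
    fix z :: "'v + bool \<Rightarrow> real" assume z: "z \<in> cube"
    note adm = start_admissible[OF small eps1(1,2) z] and bd = bounded_of[OF small eps1(1,2) z]
    show "total_mass (start_of eps1 eps0 z) (W_of eps1 eps0 z) \<le> \<mu>" if "z (Inr True) = 0"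
    proof -
      have "eps_of eps1 eps0 z = eps1" using that by (simp add: eps_of_def[OF small eps1(1,2)])
      then show ?thesis using total_mass_le[OF adm, of "W_of eps1 eps0 z" t] bd t eps1(3)
        by (simp add: start_sum[OF small eps1(1,2)] C_def)
    qed
    show "\<mu> \<le> total_mass (start_of eps1 eps0 z) (W_of eps1 eps0 z)" if "z (Inr True) = 1"
    proof -
      have "eps_of eps1 eps0 z = eps0" using that by (simp add: eps_of_def[OF small eps1(1,2)])
      then show ?thesis using total_mass_ge[OF adm, of "W_of eps1 eps0 z"] bd \<mu>
        by (simp add: start_sum[OF small eps1(1,2)])
    qed
  qed auto
  let ?x = "start_of eps1 eps0 z" and ?W = "W_of eps1 eps0 z"
  have sum: "fst ?x + snd ?x = eps_of eps1 eps0 z" by (rule start_sum[OF small eps1(1,2)])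
  have eps: "0 < eps_of eps1 eps0 z" "eps_of eps1 eps0 z \<le> eps0" using eps_of[OF small eps1(1,2) z(1)] by auto
  have bd: "bounded_data (dilation ?x) ?W (fst ?x + snd ?x)"
    using bounded_of[OF small eps1(1,2) z(1)] sum by simp
  have Wv0: "?W v0 = fst ?x" by (simp add: W_of_def[OF small eps1(1,2)])
  \<comment> \<open>If the base value were 0, the whole size would sit in the slope, and the base
    equation would make the flux negative.\<close>
  have "flux (dilation ?x) ?W v0 < 0" if "?W v0 = 0"
  proof -
    have "0 < m * snd ?x" using that Wv0 sum eps m_ge by (intro mult_pos_pos) auto
    then show ?thesis using z(3) by linarith
  qed
  from W_positive[OF bd this z(2)]
  show "\<exists>x W. branch_solution eps0 \<mu> x W"
    using start_admissible[OF small eps1(1,2) z(1)] sum eps bd Wv0 z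
    unfolding branch_solution_def by (intro exI[of _ ?x] exI[of _ ?W]) auto
qed

end

subsection \<open>Assembling the solution\<close>

lemma has_real_derivative_reflect:
  fixes f :: "real \<Rightarrow> real"
  assumes "(f has_real_derivative D) (at (c - t) within {0..l})"
  shows "((\<lambda>t. f (c - t)) has_real_derivative - D) (at t within {c - l..c})"
proof -
  have img: "(\<lambda>t. c - t) ` {c - l..c} = {0..l}"
    by (auto simp: image_iff intro!: bexI[of _ "c - _"])
  have "((\<lambda>t. c - t) has_real_derivative - 1) (at t within {c - l..c})"
    by (auto intro!: derivative_eq_intros)
  from DERIV_image_chain[OF assms[folded img] this] show ?thesis by (simp add: o_def)
qed

lemma has_integral_reflect_shift:
  fixes f :: "real \<Rightarrow> real"
  assumes "(f has_integral i) {0..l}"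
  shows "((\<lambda>t. f (c - t)) has_integral i) {c - l..c}"
proof -
  have "((\<lambda>x. f ((- 1) *\<^sub>R x + c)) has_integral (1 / \<bar>- 1\<bar> ^ DIM(real)) *\<^sub>R i)
     ((\<lambda>x. (1 / (- 1)) *\<^sub>R x + - ((1 / (- 1)) *\<^sub>R c)) ` cbox 0 l)"
    by (rule has_integral_affinity) (use assms in auto)
  moreover have "(\<lambda>x::real. (1 / (- 1)) *\<^sub>R x + - ((1 / (- 1)) *\<^sub>R c)) ` cbox 0 l = {c - l..c}"
    by (auto simp: image_iff intro!: bexI[of _ "c - _"])
  ultimately show ?thesis by simp
qed

section \<open>The profile on the special edge\<close>

context peak_flow
begin

text \<open>\<open>profile m x l z z1\<close>: \<open>z\<close> (with derivative \<open>z1\<close>) solves the equation on \<^term>\<open>{0..l}\<close> and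
  consists of \<open>m\<close> copies of the wave started at \<open>x\<close> and followed up to its peak.\<close>

definition "profile m x l z z1 \<longleftrightarrow>
  (\<forall>t\<in>{0..l}. (z has_real_derivative z1 t) (at t within {0..l}) \<and>
     (z1 has_real_derivative z t - z t powr (p - 1)) (at t within {0..l}) \<and> (0 < fst x \<longrightarrow> 0 < z t)) \<and>
  ((\<lambda>t. (z t)\<^sup>2) has_integral m * wave_mass x) {0..l} \<and>
  ((\<lambda>t. (z1 t)\<^sup>2) has_integral m * integral {0..peak x} (\<lambda>t. (Q x t)\<^sup>2)) {0..l} \<and>
  ((\<lambda>t. z t powr p) has_integral m * wave_power x) {0..l}"

context
  fixes x :: "real \<times> real"
  assumes adm: "admissible x"
begin

lemma wave_derivatives:
  assumes t: "t \<in> {0..peak x}"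
  shows "(Y x has_real_derivative Q x t) (at t within {0..peak x})"
    and "(Q x has_real_derivative Y x t - Y x t powr (p - 1)) (at t within {0..peak x})"
  using dY[OF t, of x] dQ[OF t, of x] Q_nonneg[OF adm] t force_eq[of "Y x t" beta p] Y_nonneg[OF adm, of t] Y_less_beta[OF adm, of t]
  by (auto simp: max_absorb1)

lemma wave_integrals:
  "((\<lambda>t. (Y x t)\<^sup>2) has_integral wave_mass x) {0..peak x}"
  "((\<lambda>t. (Q x t)\<^sup>2) has_integral integral {0..peak x} (\<lambda>t. (Q x t)\<^sup>2)) {0..peak x}"
  "((\<lambda>t. Y x t powr p) has_integral wave_power x) {0..peak x}"
  unfolding wave_mass_def wave_power_def
  by (intro integrable_integral integrable_continuous_real cont_squares cont_powr[OF adm])+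

lemma wave_pos: "0 < fst x \<Longrightarrow> 0 \<le> t \<Longrightarrow> 0 < Y x t"
  using Y_mono[of 0 t x] init by simp

lemma profile_forward: "profile 1 x (peak x) (Y x) (Q x)"
  using wave_derivatives wave_integrals wave_pos by (simp add: profile_def)

lemma reflected_derivatives:
  assumes t: "t \<in> {c - peak x..c}"
  shows "((\<lambda>t. Y x (c - t)) has_real_derivative - Q x (c - t)) (at t within {c - peak x..c})"
    and "((\<lambda>t. - Q x (c - t)) has_real_derivative Y x (c - t) - Y x (c - t) powr (p - 1)) (at t within {c - peak x..c})"
proof -
  have ct: "c - t \<in> {0..peak x}" using t by auto
  show "((\<lambda>t. Y x (c - t)) has_real_derivative - Q x (c - t)) (at t within {c - peak x..c})"
    by (rule has_real_derivative_reflect[OF wave_derivatives(1)[OF ct]])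
  show "((\<lambda>t. - Q x (c - t)) has_real_derivative Y x (c - t) - Y x (c - t) powr (p - 1)) (at t within {c - peak x..c})"
    using DERIV_minus[OF has_real_derivative_reflect[OF wave_derivatives(2)[OF ct]]] by simp
qed

lemma reflected_integrals:
  "((\<lambda>t. (Y x (c - t))\<^sup>2) has_integral wave_mass x) {c - peak x..c}"
  "((\<lambda>t. (- Q x (c - t))\<^sup>2) has_integral integral {0..peak x} (\<lambda>t. (Q x t)\<^sup>2)) {c - peak x..c}"
  "((\<lambda>t. Y x (c - t) powr p) has_integral wave_power x) {c - peak x..c}"
  using wave_integrals[THEN has_integral_reflect_shift[of _ _ _ c]] by simp_all

lemma profile_backward: "profile 1 x (peak x) (\<lambda>t. Y x (peak x - t)) (\<lambda>t. - Q x (peak x - t))"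
  using reflected_derivatives[of _ "peak x"] reflected_integrals[of "peak x"] wave_pos by (simp add: profile_def)

text \<open>The wave is followed to its peak and reflected there. The slope vanishes at the peak, so
  values and slopes match, and the equation is invariant under reflection.\<close>

lemma profile_loop: "profile 2 x (2 * peak x)
  (\<lambda>t. if t \<le> peak x then Y x t else Y x (2 * peak x - t))
  (\<lambda>t. if t \<le> peak x then Q x t else - Q x (2 * peak x - t))"
proof -
  let ?c = "peak x" and ?l = "2 * peak x"
  let ?z = "\<lambda>t. if t \<le> ?c then Y x t else Y x (?l - t)"
  let ?z1 = "\<lambda>t. if t \<le> ?c then Q x t else - Q x (?l - t)"
  note pk = peak[OF adm]
  have cl: "?c \<le> ?l" "?l - ?c = ?c" using pk by auto
  have "(?z has_real_derivative ?z1 t) (at t within {0..?l})" if t: "t \<in> {0..?l}" for t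
    by (rule has_real_derivative_glue[OF pk(1) cl(1)])
       (use wave_derivatives reflected_derivatives(1)[of _ ?l] pk t cl in auto)
  moreover have "(?z1 has_real_derivative ?z t - ?z t powr (p - 1)) (at t within {0..?l})" if t: "t \<in> {0..?l}" for t
  proof -
    have "(?z1 has_real_derivative (if t \<le> ?c then Y x t - Y x t powr (p - 1) else Y x (?l - t) - Y x (?l - t) powr (p - 1))) (at t within {0..?l})"
      by (rule has_real_derivative_glue[OF pk(1) cl(1)])
         (use wave_derivatives reflected_derivatives(2)[of _ ?l] pk t cl in auto)
    then show ?thesis by (cases "t \<le> ?c") auto
  qed
  moreover have "0 < ?z t" if "0 < fst x" "t \<in> {0..?l}" for t
    using wave_pos[of t] wave_pos[of "?l - t"] that by auto
  moreover have comb: "((\<lambda>t. if t \<le> ?c then f t else g t) has_integral 2 * i) {0..?l}"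
    if "(f has_integral i) {0..?c}" "(g has_integral i) {?l - ?c..?l}" "f ?c = g ?c" for f g :: "real \<Rightarrow> real" and i
  proof -
    have "((\<lambda>t. if t \<le> ?c then f t else g t) has_integral i) {0..?c}"
      by (rule has_integral_eq[OF _ that(1)]) auto
    moreover have "((\<lambda>t. if t \<le> ?c then f t else g t) has_integral i) {?c..?l}"
      by (rule has_integral_eq[OF _ that(2)[unfolded cl(2)]]) (use that(3) in auto)
    ultimately show ?thesis using has_integral_combine[OF pk(1) cl(1), of "\<lambda>t. if t \<le> ?c then f t else g t" i i] by simp
  qed
  moreover have "((\<lambda>t. (?z t)\<^sup>2) has_integral 2 * wave_mass x) {0..?l}"
    using comb[OF wave_integrals(1) reflected_integrals(1)] cl by (simp add: if_distrib[of "\<lambda>a. a\<^sup>2"])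
  moreover have "((\<lambda>t. (?z1 t)\<^sup>2) has_integral 2 * integral {0..peak x} (\<lambda>t. (Q x t)\<^sup>2)) {0..?l}"
    using comb[OF wave_integrals(2) reflected_integrals(2)] cl by (simp add: if_distrib[of "\<lambda>a. a\<^sup>2"])
  moreover have "((\<lambda>t. ?z t powr p) has_integral 2 * wave_power x) {0..?l}"
    using comb[OF wave_integrals(3) reflected_integrals(3)] cl by (simp add: if_distrib[of "\<lambda>a. a powr p"])
  ultimately show ?thesis unfolding profile_def by blast
qed

end

end

section \<open>Gluing the profile to the rest of the graph\<close>

context rest_graph
begin

text \<open>The factor of \<open>eps0\<close> collects the error of \<open>wave_energy_ge\<close>
  and the power on the rest, at most \<open>8 * eps0\<close> per edge. The right-hand side is the
  positive part of the wave energy.\<close>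

definition "very_small eps0 \<longleftrightarrow> small eps0 \<and> ((1 + peak_bound) / 4 + 8 * card F) * eps0 < (p - 6) / (4 * p) * power_low"

lemma very_small_exists: "\<exists>eps0. very_small eps0"
proof -
  define A where "A = (p - 6) / (4 * p) * power_low"
  define C where "C = (1 + peak_bound) / 4 + 8 * card F"
  have A: "A > 0" unfolding A_def using p_gt mass_consts_pos by auto
  have C: "C > 0" unfolding C_def using const_pos by (intro add_pos_nonneg) auto
  define eps0 where "eps0 = min (c0 / 3) (min (exp (- (L0 / len0))) (A / (2 * C)))"
  have "eps0 * exp (L0 / len0) \<le> exp (- (L0 / len0)) * exp (L0 / len0)"
    by (intro mult_right_mono) (auto simp: eps0_def)
  then have "eps0 * exp (L0 / len0) \<le> 1" by (simp flip: exp_add)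
  moreover have "0 < eps0" "eps0 \<le> c0 / 3" using A C levels by (auto simp: eps0_def)
  moreover have "C * eps0 < A"
  proof -
    have "C * eps0 \<le> C * (A / (2 * C))" using C by (intro mult_left_mono) (auto simp: eps0_def)
    also have "... = A / 2" using C by simp
    finally show ?thesis using A by linarith
  qed
  ultimately show ?thesis unfolding very_small_def small_def A_def C_def by blast
qed

definition "rest_wave T W e = (if e \<in> H then tail (W (src e)) else U (W (src e), edge.slope (triple T W e)))"
definition "rest_wave1 T W e = (if e \<in> H then tail1 (W (src e)) else V (W (src e), edge.slope (triple T W e)))"

context
  fixes T eps :: real and W :: "'v \<Rightarrow> real" and e :: 'e
  assumes bd: "bounded_data T W eps" and pos: "\<forall>v\<in>insert v0 R. 0 < W v" and e: "e \<in> F"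
begin

lemma x0_eq: "e \<notin> H \<Longrightarrow> edge.x0 (W (src e)) (W (tgt e)) (T * L e) = (W (src e), edge.slope (triple T W e))"
  using edge.x0_def[OF box[OF bd, unfolded triple_def], of e] e by (simp add: triple_def)

lemma rest_wave_ends: "rest_wave T W e 0 = W (src e)" "rest_wave1 T W e 0 = out_slope T W e"
   "e \<notin> H \<Longrightarrow> rest_wave T W e (T * L e) = W (tgt e)"
   "e \<notin> H \<Longrightarrow> rest_wave1 T W e (T * L e) = edge.end_slope (triple T W e)"
proof -
  show "rest_wave T W e 0 = W (src e)" "rest_wave1 T W e 0 = out_slope T W e"
    using tail_0[of "W (src e)"] W_src[OF bd e] by (auto simp: rest_wave_def rest_wave1_def out_slope_def edge.init)
  assume "e \<notin> H"
  then show "rest_wave T W e (T * L e) = W (tgt e)" "rest_wave1 T W e (T * L e) = edge.end_slope (triple T W e)"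
    using edge.ends(2)[OF box[OF bd, unfolded triple_def], of e] e end_slope_eq[OF bd, of e] x0_eq
    by (auto simp: rest_wave_def rest_wave1_def)
qed

lemma rest_wave_solves:
  assumes t: "t \<in> edom H (\<lambda>e. T * L e) e"
  shows "(rest_wave T W e has_real_derivative rest_wave1 T W e t) (at t within edom H (\<lambda>e. T * L e) e)" (is ?A)
    and "(rest_wave1 T W e has_real_derivative rest_wave T W e t - rest_wave T W e t powr (p - 1)) (at t within edom H (\<lambda>e. T * L e) e)" (is ?B)
    and "0 < rest_wave T W e t" (is ?C)
proof -
  have "?A \<and> ?B \<and> ?C"
  proof (cases "e \<in> H")
    case True
    then show ?thesis
      using tail_has_derivative[of "W (src e)"] tail1_has_derivative[of "W (src e)"] tail_pos[of "W (src e)" t]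
        W_src[OF bd e] pos src_in[OF e] by (auto simp: rest_wave_def rest_wave1_def)
  next
    case False
    let ?x = "(W (src e), edge.slope (triple T W e))"
    have t': "t \<in> {0..T * L e}" using t False by (simp add: edom_def)
    have bx: "edge.box (W (src e), W (tgt e), T * L e)" using box[OF bd, unfolded triple_def, of e] e False by simp
    have U0: "0 < U ?x t" "U ?x t \<le> c0"
      using edge.U_pos[OF bx t'] edge.U_le(1)[OF bx t'] pos src_in[OF e] tgt_in[of e] e False x0_eq[OF False] by auto
    then show ?thesis
      using edge.dU[OF t', of ?x] edge.dV[OF t', of ?x] False force_eq[of "U ?x t" c0 p]
      by (simp add: rest_wave_def rest_wave1_def edom_def)
  qed
  then show ?A ?B ?C by auto
qed

lemma rest_wave_integrals:
  "(\<lambda>t. (rest_wave T W e t)\<^sup>2) integrable_on edom H (\<lambda>e. T * L e) e" (is ?A)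
  "(\<lambda>t. (rest_wave1 T W e t)\<^sup>2) integrable_on edom H (\<lambda>e. T * L e) e" (is ?B)
  "(\<lambda>t. rest_wave T W e t powr p) integrable_on edom H (\<lambda>e. T * L e) e" (is ?C)
  "integral (edom H (\<lambda>e. T * L e) e) (\<lambda>t. (rest_wave T W e t)\<^sup>2) = edge_masses T W e" (is ?D)
  "integral (edom H (\<lambda>e. T * L e) e) (\<lambda>t. rest_wave T W e t powr p) \<le> 8 * eps" (is ?F)
proof -
  have "?A \<and> ?B \<and> ?C \<and> ?D \<and> ?F"
  proof (cases "e \<in> H")
    case True
    have "integral {0..} (\<lambda>t. tail (W (src e)) t powr p) \<le> 2 * (W (src e))\<^sup>2"
      using W_src[OF bd e] by (intro tail_power_le)
    also have "... \<le> 2 * (eps * 1)"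
      unfolding power2_eq_square using W_src[OF bd e] eps_le[OF bd] by (intro mult_left_mono mult_mono) auto
    also have "... \<le> 8 * eps" using W_src[OF bd e] by simp
    finally show ?thesis
      using True integrable_tail[of "W (src e)"] W_src[OF bd e]
      by (simp add: rest_wave_def rest_wave1_def edom_def edge_masses_def tail_mass_def)
  next
    case False
    have bx: "edge.box (W (src e), W (tgt e), T * L e)" using box[OF bd, unfolded triple_def, of e] e False by simp
    have "integral {0..T * L e} (\<lambda>t. U (W (src e), edge.slope (triple T W e)) t powr p) \<le> 8 * max (W (src e)) (W (tgt e))"
      using edge.edge_power_le[OF bx] x0_eq[OF False] by simp
    also have "... \<le> 8 * eps" using W_src[OF bd e] W_tgt[OF bd, of e] e False by auto
    finally show ?thesis
      using False edge.integrable_edge[OF bx] x0_eq[OF False]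
      by (simp add: rest_wave_def rest_wave1_def edom_def edge_masses_def edge.edge_mass_def triple_def)
  qed
  then show ?A ?B ?C ?D ?F by auto
qed

end

text \<open>\<open>prof\<close> hides the configuration: at an end other than \<open>v0\<close> the
  profile is at its peak with slope 0, and the slopes leaving \<open>v0\<close> along the special
  edge add up to \<open>m * snd x\<close>. For a loop both ends are \<open>v0\<close>.\<close>

theorem solutions_of_small_mass:
  assumes E: "E = insert e0 F" "e0 \<notin> F" "e0 \<notin> H"
    and ends: "src e0 \<notin> R" "tgt e0 \<notin> R"
    and prof: "\<And>x. admissible x \<Longrightarrow> \<exists>z z1. profile m x (dilation x * L e0) z z1 \<and>
       z 0 = (if src e0 = v0 then fst x else Y x (peak x)) \<and>
       z (dilation x * L e0) = (if tgt e0 = v0 then fst x else Y x (peak x)) \<and>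
       (src e0 \<noteq> v0 \<longrightarrow> z1 0 = 0) \<and> (tgt e0 \<noteq> v0 \<longrightarrow> z1 (dilation x * L e0) = 0) \<and>
       (if src e0 = v0 then z1 0 else 0) - (if tgt e0 = v0 then z1 (dilation x * L e0) else 0) = m * snd x"
  shows "\<exists>\<mu>0 > 0. \<forall>\<mu>. 0 < \<mu> \<and> \<mu> \<le> \<mu>0 \<longrightarrow>
           (\<exists>u u1 lam. kirchhoff_solution p E H L src tgt u u1 lam \<and>
                      mass E H L u = \<mu> \<and> energy p E H L u u1 > 0 \<and> lam > 0)"
proof -
  obtain eps0 where vs: "very_small eps0" using very_small_exists by blast
  then have small: "small eps0" by (simp add: very_small_def)
  have sol: "\<exists>u u1 lam. kirchhoff_solution p E H L src tgt u u1 lam \<and> mass E H L u = \<mu> \<and> energy p E H L u u1 > 0 \<and> lam > 0"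
    if br: "branch_solution eps0 \<mu> x W" for x W \<mu>
  proof -
    have adm: "admissible x" and x_le: "fst x + snd x \<le> eps0" and bd: "bounded_data (dilation x) W (fst x + snd x)"
      and Wv0: "W v0 = fst x" and pos: "\<forall>v\<in>insert v0 R. 0 < W v"
      and flux: "\<forall>v\<in>R. flux (dilation x) W v = 0" "m * snd x + flux (dilation x) W v0 = 0"
      and \<mu>: "total_mass x W = \<mu>"
      using br unfolding branch_solution_def by blast+
    define T where "T = dilation x"
    have T: "0 < T" unfolding T_def by (rule T_pos[OF bd])
    obtain z z1 where pr: "profile m x (T * L e0) z z1"
      "z 0 = (if src e0 = v0 then fst x else Y x (peak x))"
      "z (T * L e0) = (if tgt e0 = v0 then fst x else Y x (peak x))"
      "src e0 \<noteq> v0 \<Longrightarrow> z1 0 = 0" "tgt e0 \<noteq> v0 \<Longrightarrow> z1 (T * L e0) = 0"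
      "(if src e0 = v0 then z1 0 else 0) - (if tgt e0 = v0 then z1 (T * L e0) else 0) = m * snd x"
      using prof[OF adm] unfolding T_def by blast
    define w where "w = (\<lambda>e. if e = e0 then z else rest_wave T W e)"
    define w1 where "w1 = (\<lambda>e. if e = e0 then z1 else rest_wave1 T W e)"
    \<comment> \<open>Outside \<open>insert v0 R\<close> the only vertex that can occur is the tip
      of a pendant, where the profile has its peak value.\<close>
    define Wf where "Wf v = (if v \<in> insert v0 R then W v else Y x (peak x))" for v
    let ?D = "edom H (\<lambda>e. T * L e)"
    note bd' = bd[folded T_def]
    have De0: "?D e0 = {0..T * L e0}" using E by (simp add: edom_def)
    have fst_pos: "0 < fst x" using pos Wv0 by auto
    have ne: "e \<noteq> e0" if "e \<in> F" for e using that E by auto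
    have solves: "(w e has_real_derivative w1 e t) (at t within ?D e) \<and>
        (w1 e has_real_derivative w e t - w e t powr (p - 1)) (at t within ?D e) \<and> 0 < w e t"
      if "e \<in> E" "t \<in> ?D e" for e t
      using that rest_wave_solves[OF bd' pos, of e t] pr(1) De0 fst_pos E
      by (cases "e = e0") (auto simp: w_def w1_def profile_def)
    have der: "(w e has_real_derivative w1 e t) (at t within ?D e)" and wpos: "0 < w e t"
      if "e \<in> E" "t \<in> ?D e" for e t
      using solves[OF that] by auto
    have der1: "(w1 e has_real_derivative w e t - w e t powr (p - 1)) (at t)"
      if "e \<in> E" "t \<in> interior (?D e)" for e t
      using solves[OF that(1), of t] that(2) interior_subset at_within_interior[OF that(2)] by force
    have int: "(\<lambda>t. (w e t)\<^sup>2) integrable_on ?D e" "(\<lambda>t. (w1 e t)\<^sup>2) integrable_on ?D e"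
        "(\<lambda>t. w e t powr p) integrable_on ?D e" if "e \<in> E" for e
      using that rest_wave_integrals[OF bd' pos, of e] pr(1) De0 E
      by (auto simp: w_def w1_def profile_def)
    have Wf: "Wf (src e) = W (src e)" "e \<notin> H \<Longrightarrow> Wf (tgt e) = W (tgt e)" if "e \<in> F" for e
      using src_in[OF that] tgt_in[of e] that by (auto simp: Wf_def)
    have val: "w e 0 = Wf (src e)" if "e \<in> E" for e
      using that rest_wave_ends(1)[OF bd' pos, of e] pr(2) Wf ends Wv0 E
      by (cases "e = e0") (auto simp: w_def Wf_def)
    have val': "w e (T * L e) = Wf (tgt e)" if "e \<in> E - H" for e
      using that rest_wave_ends(3)[OF bd' pos, of e] pr(3) Wf ends Wv0 E
      by (cases "e = e0") (auto simp: w_def Wf_def)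
    have kirch: "(\<Sum>e\<in>{e \<in> E. src e = v}. w1 e 0) - (\<Sum>e\<in>{e \<in> E - H. tgt e = v}. w1 e (T * L e)) = 0"
      if v: "v \<in> vertices E H src tgt" for v
    proof -
      let ?A = "{e \<in> F. src e = v}" and ?B = "{e \<in> F - H. tgt e = v}"
      have EA: "{e \<in> E. src e = v} = (if src e0 = v then insert e0 ?A else ?A)"
        "{e \<in> E - H. tgt e = v} = (if tgt e0 = v then insert e0 ?B else ?B)" using E by auto
      have fin: "finite ?A" "finite ?B" "e0 \<notin> ?A" "e0 \<notin> ?B" using finF E by auto
      have w10: "w1 e0 = z1" by (simp add: w1_def)
      have sA: "(\<Sum>e\<in>?A. w1 e 0) = (\<Sum>e\<in>?A. out_slope T W e)"
        by (intro sum.cong) (use rest_wave_ends(2)[OF bd' pos] ne in \<open>auto simp: w1_def\<close>)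
      have sB: "(\<Sum>e\<in>?B. w1 e (T * L e)) = (\<Sum>e\<in>?B. edge.end_slope (triple T W e))"
        by (intro sum.cong) (use rest_wave_ends(4)[OF bd' pos] ne in \<open>auto simp: w1_def\<close>)
      have "(\<Sum>e\<in>{e \<in> E. src e = v}. w1 e 0) - (\<Sum>e\<in>{e \<in> E - H. tgt e = v}. w1 e (T * L e))
         = (if src e0 = v then z1 0 else 0) - (if tgt e0 = v then z1 (T * L e0) else 0) + flux T W v"
      proof -
        have "(\<Sum>e\<in>{e \<in> E. src e = v}. w1 e 0) = (if src e0 = v then z1 0 else 0) + (\<Sum>e\<in>?A. out_slope T W e)"
          unfolding EA(1) by (cases "src e0 = v") (simp_all only: simp_thms if_True if_False sum.insert[OF fin(1,3)] sA w10 add_0)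
        moreover have "(\<Sum>e\<in>{e \<in> E - H. tgt e = v}. w1 e (T * L e))
            = (if tgt e0 = v then z1 (T * L e0) else 0) + (\<Sum>e\<in>?B. edge.end_slope (triple T W e))"
          unfolding EA(2) by (cases "tgt e0 = v") (simp_all only: simp_thms if_True if_False sum.insert[OF fin(2,4)] sB w10 add_0)
        ultimately show ?thesis unfolding flux_def by simp
      qed
      also have "... = 0"
      proof (cases "v \<in> insert v0 R")
        case True
        then show ?thesis using ends flux pr(6) by (cases "v = v0") (auto simp: T_def)
      next
        \<comment> \<open>No edge of the rest meets such a vertex, so only an end of the special
          edge can lie there, and its slope is 0.\<close>
        case False
        then have "?A = {}" "?B = {}" using src_in tgt_in by auto
        then have "flux T W v = 0" unfolding flux_def by (simp only: sum.empty)
        then show ?thesis using False pr(4,5) by auto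
      qed
      finally show ?thesis .
    qed
    have p2: "2 < p" using p_gt by simp
    note res = kirchhoff_solution_rescale[where E = E and H = H and src = src and tgt = tgt and L = L and w = w and ?w1.0 = w1 and Wf = Wf,
        OF T p2 der wpos der1 int val val' kirch]
    let ?I = "\<lambda>f. \<Sum>e\<in>E. integral (?D e) (f e)"
    have intz: "integral (?D e0) (\<lambda>t. (w e0 t)\<^sup>2) = m * wave_mass x"
      "integral (?D e0) (\<lambda>t. (w1 e0 t)\<^sup>2) = m * integral {0..peak x} (\<lambda>t. (Q x t)\<^sup>2)"
      "integral (?D e0) (\<lambda>t. w e0 t powr p) = m * wave_power x"
      using pr(1) De0 by (auto simp: w_def w1_def profile_def dest: integral_unique)
    have I_split: "?I f = integral (?D e0) (f e0) + (\<Sum>e\<in>F. integral (?D e) (f e))" for f :: "'e \<Rightarrow> real \<Rightarrow> real"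
      using E finF by simp
    have "?I (\<lambda>e t. (w e t)\<^sup>2) = m * wave_mass x + rest_mass T W"
      unfolding I_split intz rest_mass_def
      using rest_wave_integrals(4)[OF bd' pos] ne by (auto simp: w_def intro!: sum.cong)
    then have mass_eq: "T powr expo * ?I (\<lambda>e t. (w e t)\<^sup>2) = \<mu>"
      using \<mu> by (simp add: total_mass_def T_def)
    have "0 \<le> (\<Sum>e\<in>F. integral (?D e) (\<lambda>t. (w1 e t)\<^sup>2))"
      by (intro sum_nonneg integral_square_nonneg)
    then have en1: "m * integral {0..peak x} (\<lambda>t. (Q x t)\<^sup>2) \<le> ?I (\<lambda>e t. (w1 e t)\<^sup>2)"
      unfolding I_split intz by simp
    have e_nonneg: "0 \<le> fst x + snd x" using start(6)[OF adm] by simp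
    have "(\<Sum>e\<in>F. integral (?D e) (\<lambda>t. w e t powr p)) \<le> card F * (8 * (fst x + snd x))"
      by (rule sum_bounded_above) (use rest_wave_integrals(5)[OF bd' pos] ne in \<open>auto simp: w_def\<close>)
    also have "... \<le> card F * (8 * eps0)" using x_le by (intro mult_left_mono) auto
    finally have en2: "?I (\<lambda>e t. w e t powr p) \<le> m * wave_power x + card F * (8 * eps0)"
      unfolding I_split intz by simp
    have energy_pos: "0 < 1/2 * ?I (\<lambda>e t. (w1 e t)\<^sup>2) - 1/p * ?I (\<lambda>e t. w e t powr p)"
    proof -
      define X where "X = 1 / 2 * integral {0..peak x} (\<lambda>t. (Q x t)\<^sup>2) - 1 / p * wave_power x"
      define N where "N = card F * (8 * eps0)"
      have "(1 + peak_bound) * (fst x + snd x) / 4 \<le> (1 + peak_bound) * eps0 / 4"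
        using x_le const_pos by (intro divide_right_mono mult_left_mono) auto
      moreover have "(1 + peak_bound) * eps0 / 4 + N < (p - 6) / (4 * p) * power_low"
        using vs by (simp add: very_small_def N_def algebra_simps add_divide_distrib)
      ultimately have X: "N < X" using wave_energy_ge[OF adm] unfolding X_def by linarith
      have N0: "0 \<le> N" using small by (simp add: N_def small_def)
      \<comment> \<open>The wave energy \<open>X\<close> is positive, so \<open>m\<close> copies
        have at least the energy of one. The remaining loss is the power on the rest, below
        \<open>N\<close>.\<close>
      have "X \<le> m * X" using X N0 m_ge by (simp add: mult_le_cancel_right1)
      moreover have "1 / p * N \<le> 1 * N" using N0 p_gt by (intro mult_right_mono) auto
      moreover have "1/2 * ?I (\<lambda>e t. (w1 e t)\<^sup>2) - 1/p * ?I (\<lambda>e t. w e t powr p)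
         \<ge> 1/2 * (m * integral {0..peak x} (\<lambda>t. (Q x t)\<^sup>2)) - 1/p * (m * wave_power x + N)"
        using en1 en2 p_gt unfolding N_def by (intro diff_mono mult_left_mono) auto
      moreover have "1/2 * (m * integral {0..peak x} (\<lambda>t. (Q x t)\<^sup>2)) - 1/p * (m * wave_power x + N) = m * X - 1 / p * N"
        by (simp add: X_def algebra_simps)
      ultimately show ?thesis using X by linarith
    qed
    show ?thesis
    proof (intro exI conjI)
      show "kirchhoff_solution p E H L src tgt (\<lambda>e x. T powr (2 / (p - 2)) * w e (T * x))
         (\<lambda>e x. T powr (2 / (p - 2) + 1) * w1 e (T * x)) (T\<^sup>2)"
        by (rule res(1))
      have "mass E H L (\<lambda>e x. T powr (2 / (p - 2)) * w e (T * x)) = T powr (2 * (2 / (p - 2)) - 1) * ?I (\<lambda>e t. (w e t)\<^sup>2)"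
        by (rule res(2))
      then show "mass E H L (\<lambda>e x. T powr (2 / (p - 2)) * w e (T * x)) = \<mu>"
        using mass_eq by (simp add: expo_def)
      have "energy p E H L (\<lambda>e x. T powr (2 / (p - 2)) * w e (T * x)) (\<lambda>e x. T powr (2 / (p - 2) + 1) * w1 e (T * x))
         = T powr (2 * (2 / (p - 2)) + 1) * (1/2 * ?I (\<lambda>e t. (w1 e t)\<^sup>2) - 1/p * ?I (\<lambda>e t. w e t powr p))"
        by (rule res(3))
      then show "0 < energy p E H L (\<lambda>e x. T powr (2 / (p - 2)) * w e (T * x)) (\<lambda>e x. T powr (2 / (p - 2) + 1) * w1 e (T * x))"
        using energy_pos T by simp
      show "0 < T\<^sup>2" using T by simp
    qed
  qed
  obtain \<mu>0 where "\<mu>0 > 0" "\<forall>\<mu>. 0 < \<mu> \<and> \<mu> \<le> \<mu>0 \<longrightarrow> (\<exists>x W. branch_solution eps0 \<mu> x W)"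
    using branch[OF small] by blast
  then show ?thesis using sol by blast
qed

end

section \<open>Reduction of pendants and signposts to one special edge\<close>

lemma rtranclp_leaves_set:
  assumes "r\<^sup>*\<^sup>* a b" "a \<in> S" "b \<notin> S"
  shows "\<exists>c d. r c d \<and> c \<in> S \<and> d \<notin> S"
  using assms by (induction rule: converse_rtranclp_induct) auto

text \<open>The hypothesis \<open>tip\<close> says that an end of \<open>e0\<close> other than
  \<open>v0\<close> meets no other edge, as at the tip of a pendant; for a loop it is
  vacuous.\<close>

lemma solutions_from_special_edge:
  fixes E H :: "'e set" and L :: "'e \<Rightarrow> real" and src tgt :: "'e \<Rightarrow> 'v" and p m L0 :: real
  assumes G: "class_G E H L src tgt" "finite E" and p: "6 < p"
    and e0: "e0 \<in> E - H" and v0: "v0 \<in> {src e0, tgt e0}"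
    and tip: "\<And>e v. v \<in> {src e0, tgt e0} \<Longrightarrow> v \<noteq> v0 \<Longrightarrow> e \<in> E - {e0} \<Longrightarrow> src e \<noteq> v \<and> (e \<notin> H \<longrightarrow> tgt e \<noteq> v)"
    and m: "m = (if src e0 = tgt e0 then 2 else 1)" "L0 = L e0 / m"
  shows "\<exists>\<mu>0 > 0. \<forall>\<mu>. 0 < \<mu> \<and> \<mu> \<le> \<mu>0 \<longrightarrow>
           (\<exists>u u1 lam. kirchhoff_solution p E H L src tgt u u1 lam \<and>
                      mass E H L u = \<mu> \<and> energy p E H L u u1 > 0 \<and> lam > 0)"
proof -
  interpret nls p by unfold_locales (rule p)
  obtain Y Q where YQ: "peak_flow p Y Q" using peak_flow_exists by blast
  obtain U V where UV: "edge_flow p U V" using edge_flow_exists by blast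
  define F where "F = E - {e0}"
  define R where "R = vertices E H src tgt - {src e0, tgt e0}"
  have conn: "\<forall>v \<in> vertices E H src tgt. \<forall>w \<in> vertices E H src tgt. (adjacent E H src tgt)\<^sup>*\<^sup>* v w"
    and HE: "H \<subseteq> E" using G by (auto simp: class_G_def)
  obtain len0 where len0: "len0 > 0" "\<And>e. e \<in> E - H \<Longrightarrow> len0 \<le> L e" using G unfolding class_G_def by blast
  have in_R: "v \<in> insert v0 R" if "v \<in> vertices E H src tgt" "v \<noteq> v0 \<Longrightarrow> v \<notin> {src e0, tgt e0}" for v
    using that by (auto simp: R_def)
  interpret rest_graph p Y Q U V F H L src tgt v0 R m L0 len0
  proof (intro rest_graph.intro YQ UV rest_graph_axioms.intro)
    show "finite F" using G by (simp add: F_def)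
    show "finite R" using G by (simp add: R_def vertices_def)
    show "v0 \<notin> R" using v0 by (auto simp: R_def)
    show "src e \<in> insert v0 R" if "e \<in> F" for e
      using that tip[of "src e" e] by (intro in_R) (auto simp: F_def vertices_def)
    show "tgt e \<in> insert v0 R" if "e \<in> F - H" for e
      using that tip[of "tgt e" e] by (intro in_R) (auto simp: F_def vertices_def)
    show "1 \<le> m" using m by simp
    show "0 < L0" using m len0(2)[OF e0] len0(1) by simp
    show "0 < len0" by (rule len0)
    show "len0 \<le> L e" if "e \<in> F - H" for e using that len0(2)[of e] by (simp add: F_def)
    show "\<exists>e\<in>F - H. (src e \<in> Zs) \<noteq> (tgt e \<in> Zs)" if Zs: "Zs \<subseteq> R" "Zs \<noteq> {}" for Zs
    proof -
      obtain a where a: "a \<in> Zs" using Zs by auto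
      have v0V: "v0 \<in> vertices E H src tgt" using v0 e0 by (auto simp: vertices_def)
      have "a \<in> vertices E H src tgt" "v0 \<notin> Zs" using a Zs v0 by (auto simp: R_def)
      then obtain c d where cd: "adjacent E H src tgt c d" "c \<in> Zs" "d \<notin> Zs"
        using rtranclp_leaves_set[of "adjacent E H src tgt" a v0 Zs] conn v0V a by blast
      then obtain e where e: "e \<in> E - H" "{c, d} = {src e, tgt e}" by (auto simp: adjacent_def)
      \<comment> \<open>The vertex \<open>c\<close> lies in \<open>R\<close>, which contains no end
        of \<open>e0\<close>.\<close>
      have "e \<noteq> e0" using e(2) cd(2) Zs by (auto simp: R_def doubleton_eq_iff)
      moreover have "(src e \<in> Zs) \<noteq> (tgt e \<in> Zs)" using e(2) cd(2,3) by (auto simp: doubleton_eq_iff)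
      ultimately show ?thesis using e(1) by (auto simp: F_def)
    qed
  qed
  have dil: "dilation x * L e0 = m * peak x" for x
  proof -
    have "L e0 = m * L0" using m by auto
    then show ?thesis unfolding dilation_def using L0 by simp
  qed
  show ?thesis
  proof (rule solutions_of_small_mass[of E e0])
    show "E = insert e0 F" "e0 \<notin> F" "e0 \<notin> H" "src e0 \<notin> R" "tgt e0 \<notin> R"
      using e0 by (auto simp: F_def R_def)
    fix x assume adm: "admissible x"
    note pk = peak[OF adm]
    consider "src e0 = tgt e0" "v0 = src e0" | "src e0 \<noteq> tgt e0" "v0 = src e0" | "src e0 \<noteq> tgt e0" "v0 = tgt e0"
      using v0 by auto
    then show "\<exists>z z1. profile m x (dilation x * L e0) z z1 \<and>
       z 0 = (if src e0 = v0 then fst x else Y x (peak x)) \<and>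
       z (dilation x * L e0) = (if tgt e0 = v0 then fst x else Y x (peak x)) \<and>
       (src e0 \<noteq> v0 \<longrightarrow> z1 0 = 0) \<and> (tgt e0 \<noteq> v0 \<longrightarrow> z1 (dilation x * L e0) = 0) \<and>
       (if src e0 = v0 then z1 0 else 0) - (if tgt e0 = v0 then z1 (dilation x * L e0) else 0) = m * snd x"
    proof cases
      case 1
      \<comment> \<open>The start value is below \<open>b1\<close>, so the peak is not at time 0 and
        the far end \<open>2 * peak x\<close> falls into the reflected branch of the
        profile.\<close>
      have "peak x \<noteq> 0"
        using pk start[OF adm] init(1)[of x] levels by auto
      then have "0 < peak x" using pk by simp
      moreover have "m = 2" using 1 m by simp
      ultimately show ?thesis
        using 1 init unfolding dil
        by (intro exI[of _ "\<lambda>t. if t \<le> peak x then Y x t else Y x (2 * peak x - t)"]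
            exI[of _ "\<lambda>t. if t \<le> peak x then Q x t else - Q x (2 * peak x - t)"])
          (use profile_loop[OF adm] in auto)
    next
      case 2
      then have "m = 1" using m by simp
      then show ?thesis
        using 2 pk init unfolding dil
        by (intro exI[of _ "Y x"] exI[of _ "Q x"]) (use profile_forward[OF adm] in auto)
    next
      case 3
      then have "m = 1" using m by simp
      then show ?thesis
        using 3 pk init unfolding dil
        by (intro exI[of _ "\<lambda>t. Y x (peak x - t)"] exI[of _ "\<lambda>t. - Q x (peak x - t)"])
          (use profile_backward[OF adm] in auto)
    qed
  qed
qed

theorem theorem1p1:
  fixes E H :: "'e set" and L :: "'e \<Rightarrow> real" and src tgt :: "'e \<Rightarrow> 'v"
  assumes "class_G E H L src tgt"
    and "noncompact_graph E H"
    and "finite E"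
    and "has_pendant E H src tgt \<or> has_signpost E H src tgt"
    and "p > (6::real)"
  shows "\<exists>\<mu>0 > 0. \<forall>\<mu>. 0 < \<mu> \<and> \<mu> \<le> \<mu>0 \<longrightarrow>
           (\<exists>u u1 lam. kirchhoff_solution p E H L src tgt u u1 lam \<and>
                      mass E H L u = \<mu> \<and> energy p E H L u u1 > 0 \<and> lam > 0)"
proof -
  have "\<exists>e0 v0. e0 \<in> E - H \<and> v0 \<in> {src e0, tgt e0} \<and>
    (\<forall>e v. v \<in> {src e0, tgt e0} \<longrightarrow> v \<noteq> v0 \<longrightarrow> e \<in> E - {e0} \<longrightarrow> src e \<noteq> v \<and> (e \<notin> H \<longrightarrow> tgt e \<noteq> v))"
    using assms(4)
  proof
    assume "has_signpost E H src tgt"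
    then obtain l where "l \<in> E - H" "src l = tgt l" by (auto simp: has_signpost_def)
    \<comment> \<open>Both ends of the loop are the base, so the condition on the tip is
      vacuous.\<close>
    then show ?thesis by (intro exI[of _ l] exI[of _ "src l"]) auto
  next
    assume "has_pendant E H src tgt"
    then obtain e0 v where e0: "e0 \<in> E - H" "v \<in> {src e0, tgt e0}" "degree E H src tgt v = 1"
      by (auto simp: has_pendant_def)
    let ?A = "{e \<in> E. src e = v}" and ?B = "{e \<in> E - H. tgt e = v}"
    have fin: "finite ?A" "finite ?B" and deg: "card ?A + card ?B = 1"
      using assms(3) e0(3) by (auto simp: degree_def)
    have only: "e = e0" if "e \<in> ?A \<union> ?B" for e
    proof -
      have "card (?A \<union> ?B) \<le> 1" using card_Un_le[of ?A ?B] deg by simp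
      moreover have "e0 \<in> ?A \<union> ?B" using e0 by auto
      ultimately show ?thesis using that fin card_le_Suc0_iff_eq[of "?A \<union> ?B"] by auto
    qed
    \<comment> \<open>A loop counts twice in the degree, so an edge at a vertex of degree 1 is not a
      loop.\<close>
    have "?A = {} \<or> ?B = {}"
    proof -
      have "card ?A = 0 \<or> card ?B = 0" using deg by linarith
      then show ?thesis using fin by (simp only: card_0_eq)
    qed
    then have ne: "src e0 \<noteq> tgt e0" using e0 by auto
    define v0 where "v0 = (if v = src e0 then tgt e0 else src e0)"
    have tip: "src e \<noteq> w \<and> (e \<notin> H \<longrightarrow> tgt e \<noteq> w)" if "w \<in> {src e0, tgt e0}" "w \<noteq> v0" "e \<in> E - {e0}" for e w
    proof -
      have "w = v" using that e0(2) by (auto simp: v0_def split: if_splits)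
      then show ?thesis using only[of e] that(3) by auto
    qed
    have "v0 \<in> {src e0, tgt e0}" by (simp add: v0_def)
    with e0(1) show ?thesis
      by (intro exI[of _ e0] exI[of _ v0] conjI allI impI tip[THEN conjunct1] tip[THEN conjunct2, rule_format])
  qed
  then obtain e0 v0 where e0: "e0 \<in> E - H" "v0 \<in> {src e0, tgt e0}"
    "\<And>e v. v \<in> {src e0, tgt e0} \<Longrightarrow> v \<noteq> v0 \<Longrightarrow> e \<in> E - {e0} \<Longrightarrow> src e \<noteq> v \<and> (e \<notin> H \<longrightarrow> tgt e \<noteq> v)"
    by blast
  show ?thesis
    by (rule solutions_from_special_edge[OF assms(1,3,5) e0 refl refl])
qed

end
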